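(* Let $\Pi$ be any marked partition of a positive integer, other than the marked partitions $1+1$ and $(1+1)$ of $2$. Then there exists a connected vertex-transitive graph whose arc-type is $\Pi$.
   Context: All graphs are finite, simple, undirected and contain at least one edge. An arc of a graph $X$ is an ordered pair $(u,v)$ of adjacent vertices. $X$ is vertex-transitive if $\mathrm{Aut}(X)$ is transitive on the vertices of $X$. Marked partition: a marked partition of a positive integer $d$ is an expression $d = n_1+\dots+n_t+(m_1+m_1)+\dots+(m_s+m_s)$ with $t,s\ge 0$ and all $n_i,m_j$ positive integers; formally, a pair consisting of a multiset $\{n_1,\dots,n_t\}$ (unbracketed summands) and a multiset $\{m_1,\dots,m_s\}$ (bracketed pairs) of positive integers with $\sum n_i+2\sum m_j=d$. The order of the summands is irrelevant, but the bracketing matters. Arc-type: let $X$ be a connected vertex-transitive graph of valency $d$, let $A=\mathrm{Aut}(X)$, and let $A(v)$ be the set of arcs of $X$ starting at a vertex $v$. For an orbit $\Delta$ of $A$ on arcs, its paired orbit is $\Delta^*=\{(w,u):(u,w)\in\Delta\}$; $\Delta$ is self-paired if $\Delta=\Delta^*$. Write the orbits of $A$ on arcs as $\Delta_1,\dots,\Delta_t$ (self-paired) and $\Delta_{t+1},\Delta_{t+1}^*,\dots,\Delta_{t+s},\Delta_{t+s}^*$ (non-self-paired, in pairs). Put $n_i=|A(v)\cap\Delta_i|$ for $1\le i\le t$ and $m_j=|A(v)\cap\Delta_{t+j}|=|A(v)\cap\Delta_{t+j}^*|$ for $1\le j\le s$; these do not depend on $v$. The arc-type of $X$ is the marked partition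 $n_1+\dots+n_t+(m_1+m_1)+\dots+(m_s+m_s)$ of $d$. *)

theory Defs
  imports
    "Graph_Theory.Graph_Theory"
    "HOL-Library.Multiset"
    "HOL-Combinatorics.Permutations"
begin

section \<open>Marked partitions\<close>

text \<open>
  The first component holds the unbracketed summands \<open>n\<^sub>i\<close>; each element \<open>m\<close> of the second
  component stands for one bracketed pair \<open>(m + m)\<close>.
\<close>

type_synonym marked_partition = "nat multiset \<times> nat multiset"

definition marked_partition_of :: "nat \<Rightarrow> marked_partition \<Rightarrow> bool" where
  "marked_partition_of d P \<longleftrightarrow>
     (\<forall>n \<in># fst P. n > 0) \<and> (\<forall>m \<in># snd P. m > 0) \<and>
     sum_mset (fst P) + 2 * sum_mset (snd P) = d"

section \<open>Vertex-transitive graphs\<close>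

text \<open>
  The locale \<open>pair_graph\<close> describes finite simple undirected graphs, with both arcs
  \<open>(u, v)\<close> and \<open>(v, u)\<close> present for every edge.
\<close>

definition nontrivial_graph :: "'a pair_pre_digraph \<Rightarrow> bool" where
  "nontrivial_graph X \<longleftrightarrow> pair_graph X \<and> parcs X \<noteq> {}"

definition graph_aut :: "'a pair_pre_digraph \<Rightarrow> ('a \<Rightarrow> 'a) set" where
  "graph_aut X = {f. f permutes pverts X \<and>
     (\<forall>u \<in> pverts X. \<forall>v \<in> pverts X. (f u, f v) \<in> parcs X \<longleftrightarrow> (u, v) \<in> parcs X)}"

definition vertex_transitive :: "'a pair_pre_digraph \<Rightarrow> bool" where
  "vertex_transitive X \<longleftrightarrow>
     (\<forall>u \<in> pverts X. \<forall>v \<in> pverts X. \<exists>f \<in> graph_aut X. f u = v)"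

section \<open>Arc-type\<close>

definition arc_orbits :: "'a pair_pre_digraph \<Rightarrow> ('a \<times> 'a) set set" where
  "arc_orbits X = (\<lambda>e. (\<lambda>f. map_prod f f e) ` graph_aut X) ` parcs X"

text \<open>
  The number of arcs of \<open>D\<close> starting at a vertex. For an arc-orbit \<open>D\<close> of a vertex-transitive
  graph it is the same at all vertices, see \<open>orbit_valency_eq\<close> below, so that \<open>the_elem\<close>
  is applied to a singleton set.
\<close>

definition orbit_valency :: "'a pair_pre_digraph \<Rightarrow> ('a \<times> 'a) set \<Rightarrow> nat" where
  "orbit_valency X D = the_elem ((\<lambda>v. card (out_arcs (with_proj X) v \<inter> D)) ` pverts X)"

text \<open>
  The paired orbit of \<open>D\<close> is the converse relation. The second component contains one element
  for every unordered pair of distinct mutually paired orbits, namely the common valency of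
  the two, see \<open>orbit_valency_converse\<close> below.
\<close>

definition arc_type :: "'a pair_pre_digraph \<Rightarrow> marked_partition" where
  "arc_type X =
     (image_mset (orbit_valency X) (mset_set {D \<in> arc_orbits X. D\<inverse> = D}),
      image_mset (\<lambda>Q. the_elem (orbit_valency X ` Q))
        (mset_set {{D, D\<inverse>} | D. D \<in> arc_orbits X \<and> D\<inverse> \<noteq> D}))"

section \<open>Well-definedness of the arc-type\<close>

lemma graph_aut_arcs:
  assumes "pair_graph X" "f \<in> graph_aut X" "e \<in> parcs X"
  shows "map_prod f f e \<in> parcs X"
proof -
  interpret pair_graph X by fact
  show ?thesis
    using assms(2,3) in_arcsD1 in_arcsD2 by (cases e) (auto simp: graph_aut_def)
qed

lemma arc_orbits_subset:
  assumes "pair_graph X" "D \<in> arc_orbits X"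
  shows "D \<subseteq> parcs X"
  using assms graph_aut_arcs unfolding arc_orbits_def by blast

lemma graph_aut_comp:
  assumes "f \<in> graph_aut X" "g \<in> graph_aut X"
  shows "g \<circ> f \<in> graph_aut X"
  using assms unfolding graph_aut_def
  by (auto simp: permutes_compose permutes_in_image)

lemma arc_orbits_invariant:
  assumes "D \<in> arc_orbits X" "f \<in> graph_aut X" "e \<in> D"
  shows "map_prod f f e \<in> D"
proof -
  obtain e0 g where D: "D = (\<lambda>f. map_prod f f e0) ` graph_aut X"
    and g: "g \<in> graph_aut X" "e = map_prod g g e0"
    using assms unfolding arc_orbits_def by auto
  have "map_prod f f e = map_prod (f \<circ> g) (f \<circ> g) e0"
    using g by (cases e0) auto
  then show ?thesis
    unfolding D using graph_aut_comp[OF g(1) assms(2)] by blast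
qed

lemma card_out_orbit_le:
  assumes "pair_graph X" "vertex_transitive X" "D \<in> arc_orbits X"
    and "u \<in> pverts X" "v \<in> pverts X"
  shows "card (out_arcs (with_proj X) u \<inter> D) \<le> card (out_arcs (with_proj X) v \<inter> D)"
proof -
  interpret pair_graph X by fact
  obtain f where f: "f \<in> graph_aut X" "f u = v"
    using assms(2,4,5) unfolding vertex_transitive_def by blast
  have "inj f"
    using f(1) permutes_inj unfolding graph_aut_def by blast
  then have inj: "inj_on (map_prod f f) (out_arcs (with_proj X) u \<inter> D)"
    by (auto simp: inj_on_def inj_def)
  have "map_prod f f ` (out_arcs (with_proj X) u \<inter> D) \<subseteq> out_arcs (with_proj X) v \<inter> D"
    using graph_aut_arcs[OF assms(1) f(1)] arc_orbits_invariant[OF assms(3) f(1)] f(2)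
    by (fastforce simp: out_arcs_def)
  moreover have "finite (out_arcs (with_proj X) v \<inter> D)"
    using pair_finite_arcs by (auto simp: out_arcs_def)
  ultimately show ?thesis
    using card_inj_on_le[OF inj] by blast
qed

lemma orbit_valency_eq:
  assumes "pair_graph X" "vertex_transitive X" "D \<in> arc_orbits X" "v \<in> pverts X"
  shows "orbit_valency X D = card (out_arcs (with_proj X) v \<inter> D)"
proof -
  have "(\<lambda>u. card (out_arcs (with_proj X) u \<inter> D)) ` pverts X
          = {card (out_arcs (with_proj X) v \<inter> D)}"
  proof (intro equalityI subsetI)
    fix n assume "n \<in> (\<lambda>u. card (out_arcs (with_proj X) u \<inter> D)) ` pverts X"
    then obtain u where u: "u \<in> pverts X" "n = card (out_arcs (with_proj X) u \<inter> D)"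
      by blast
    then show "n \<in> {card (out_arcs (with_proj X) v \<inter> D)}"
      using card_out_orbit_le[OF assms(1-3) u(1) assms(4)]
        card_out_orbit_le[OF assms(1-3) assms(4) u(1)] by simp
  qed (use assms(4) in blast)
  then show ?thesis
    unfolding orbit_valency_def by simp
qed

lemma arc_orbits_converse:
  assumes "pair_graph X" "D \<in> arc_orbits X"
  shows "D\<inverse> \<in> arc_orbits X"
proof -
  interpret pair_graph X by fact
  obtain u v where uv: "(u, v) \<in> parcs X" "D = (\<lambda>f. map_prod f f (u, v)) ` graph_aut X"
    using assms(2) unfolding arc_orbits_def by auto
  have "D\<inverse> = (\<lambda>f. map_prod f f (v, u)) ` graph_aut X"
    unfolding uv(2) by auto
  then show ?thesis
    unfolding arc_orbits_def using arcs_symmetric[OF uv(1)] by blast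
qed

lemma card_orbit:
  assumes "pair_graph X" "vertex_transitive X" "D \<in> arc_orbits X"
  shows "card D = card (pverts X) * orbit_valency X D"
proof -
  interpret pair_graph X by fact
  have sub: "D \<subseteq> parcs X"
    using assms arc_orbits_subset by blast
  have D: "D = (\<Union>v \<in> pverts X. out_arcs (with_proj X) v \<inter> D)"
  proof (intro equalityI subsetI)
    fix e assume "e \<in> D"
    moreover from this have "e \<in> parcs X" "fst e \<in> pverts X"
      using sub arc_fst_in_verts by blast+
    ultimately show "e \<in> (\<Union>v \<in> pverts X. out_arcs (with_proj X) v \<inter> D)"
      by (simp add: out_arcs_def)
  qed blast
  have "card D = (\<Sum>v \<in> pverts X. card (out_arcs (with_proj X) v \<inter> D))"
    by (subst D, rule card_UN_disjoint)
       (auto simp: out_arcs_def intro: finite_subset[OF _ pair_finite_arcs] pair_finite_verts)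
  also have "\<dots> = (\<Sum>v \<in> pverts X. orbit_valency X D)"
    by (rule sum.cong) (simp_all add: orbit_valency_eq[OF assms])
  also have "\<dots> = card (pverts X) * orbit_valency X D"
    by simp
  finally show ?thesis .
qed

lemma orbit_valency_converse:
  assumes "pair_graph X" "vertex_transitive X" "D \<in> arc_orbits X"
  shows "orbit_valency X (D\<inverse>) = orbit_valency X D"
proof -
  interpret pair_graph X by fact
  have "pverts X \<noteq> {}"
    using assms(3) in_arcsD1 unfolding arc_orbits_def by fastforce
  then have "card (pverts X) > 0"
    using pair_finite_verts by (simp add: card_gt_0_iff)
  moreover have "card (D\<inverse>) = card D"
    by (simp add: card_inverse)
  ultimately show ?thesis
    using card_orbit[OF assms] card_orbit[OF assms(1,2) arc_orbits_converse[OF assms(1,3)]]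
    by auto
qed

end

theory Submission
  imports Defs "HOL-Library.Product_Plus" "HOL-Number_Theory.Cong" "HOL-Library.Numeral_Type"
begin

text \<open>
  Start from a vertex-transitive bipartite graph for a small marked partition and adjoin summands
  one at a time. Take a family of copies of the current graph \<open>X\<close>, indexed by the vertices of a
  second structure, and let a vertex of \<open>X\<close> also change its index, in a way that depends on its
  colour. If automorphisms can tell the new arcs from the old ones, the orbits on the old arcs are
  those of \<open>X\<close> and the new arcs contribute exactly one summand, bracketed or not. What tells them
  apart are the 4-cycles and 6-cycles through a corner: moves of the index at different colours
  interact so little that few short cycles pass through a corner between two new arcs.
\<close>

section \<open>Orbits on arcs\<close>

text \<open>Bipartiteness is the lever: the colour of a vertex decides which of two index moves is
  available there, and a colour-swapping automorphism of \<open>X\<close> still lifts because the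
  two moves can be exchanged. A summand 1 is the delicate one to adjoin. Every vertex then gets a
  single new arc, and two constructions are at hand: in one the new arcs lie on as many 4-cycles as
  possible, in the other on none. The first is recognizable if \<open>X\<close> has corners outside
  all 4-cycles, the second if \<open>X\<close> has corners on 4-cycles; so the induction carries the
  alternative \<open>unsquared\<close> or \<open>squared\<close>. Both alternatives force valency at
  least 2, hence \<open>K2\<close> cannot start the induction. Connected graphs of valency 2 are
  cycles, which are arc-transitive; this is why 1+1 and (1+1) are exceptions. As a result,
  partitions with all summands equal to 1 must start from special graphs for 1+1+1, 1+(1+1) and
  (1+1)+(1+1), whereas a larger summand supplies a start by itself: a complete bipartite graph, or
  for a bracketed pair a Bouwer graph, whose arcs can be permuted freely but never reversed.\<close>

definition vtg :: "'a pair_pre_digraph \<Rightarrow> bool" where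
  "vtg X \<longleftrightarrow> pair_graph X \<and> vertex_transitive X \<and> parcs X \<noteq> {} \<and>
     (\<forall>u \<in> pverts X. \<forall>v \<in> pverts X. (u, v) \<in> (parcs X)\<^sup>*)"

lemma pair_graphI:
  assumes "finite (pverts X)" "parcs X \<subseteq> pverts X \<times> pverts X" "sym (parcs X)" "irrefl (parcs X)"
  shows "pair_graph X"
proof (unfold_locales)
  show "finite (parcs X)" using assms by (meson finite_SigmaI finite_subset)
  show "symmetric (with_proj X)" using assms(3) by (simp add: symmetric_def)
qed (use assms in \<open>auto simp: irrefl_def\<close>)

lemma pair_graphD:
  assumes "pair_graph X"
  shows "finite (pverts X)" "finite (parcs X)"
    "\<And>u v. (u, v) \<in> parcs X \<Longrightarrow> u \<in> pverts X" "\<And>u v. (u, v) \<in> parcs X \<Longrightarrow> v \<in> pverts X"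
    "\<And>u v. (u, v) \<in> parcs X \<Longrightarrow> (v, u) \<in> parcs X" "\<And>u. (u, u) \<notin> parcs X"
proof -
  interpret pair_graph X by fact
  show "finite (pverts X)" "finite (parcs X)"
    "\<And>u v. (u, v) \<in> parcs X \<Longrightarrow> u \<in> pverts X" "\<And>u v. (u, v) \<in> parcs X \<Longrightarrow> v \<in> pverts X"
    "\<And>u v. (u, v) \<in> parcs X \<Longrightarrow> (v, u) \<in> parcs X"
    using pair_finite_verts pair_finite_arcs arcs_symmetric in_arcsD1 in_arcsD2 by auto
  show "\<And>u. (u, u) \<notin> parcs X" using pair_no_loops by fastforce
qed

lemma vtgD:
  assumes "vtg X"
  shows "pair_graph X" "vertex_transitive X" "parcs X \<noteq> {}" "pverts X \<noteq> {}"
    "\<And>u v. u \<in> pverts X \<Longrightarrow> v \<in> pverts X \<Longrightarrow> (u, v) \<in> (parcs X)\<^sup>*"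
    "finite (pverts X)" "finite (parcs X)"
    "\<And>u v. (u, v) \<in> parcs X \<Longrightarrow> u \<in> pverts X" "\<And>u v. (u, v) \<in> parcs X \<Longrightarrow> v \<in> pverts X"
    "\<And>u v. (u, v) \<in> parcs X \<Longrightarrow> (v, u) \<in> parcs X" "\<And>u. (u, u) \<notin> parcs X"
proof -
  show g: "pair_graph X" and "vertex_transitive X" and ne: "parcs X \<noteq> {}"
    and "\<And>u v. u \<in> pverts X \<Longrightarrow> v \<in> pverts X \<Longrightarrow> (u, v) \<in> (parcs X)\<^sup>*"
    using assms unfolding vtg_def by auto
  note D = pair_graphD[OF g]
  show "finite (pverts X)" "finite (parcs X)"
    "\<And>u v. (u, v) \<in> parcs X \<Longrightarrow> u \<in> pverts X" "\<And>u v. (u, v) \<in> parcs X \<Longrightarrow> v \<in> pverts X"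
    "\<And>u v. (u, v) \<in> parcs X \<Longrightarrow> (v, u) \<in> parcs X" "\<And>u. (u, u) \<notin> parcs X"
    using D by auto
  show "pverts X \<noteq> {}" using ne D(3) by fastforce
qed

lemma graph_autD:
  assumes "f \<in> graph_aut X"
  shows "\<And>v. f v \<in> pverts X \<longleftrightarrow> v \<in> pverts X" "inj f"
    "\<And>u v. u \<in> pverts X \<Longrightarrow> v \<in> pverts X \<Longrightarrow> (f u, f v) \<in> parcs X \<longleftrightarrow> (u, v) \<in> parcs X"
  using assms permutes_inj unfolding graph_aut_def by (auto simp: permutes_in_image)

lemma graph_aut_arc_iff:
  assumes "pair_graph X" "f \<in> graph_aut X"
  shows "(f u, f v) \<in> parcs X \<longleftrightarrow> (u, v) \<in> parcs X"
  using graph_autD(1,3)[OF assms(2)] pair_graphD(3,4)[OF assms(1)] by blast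

text \<open>By finiteness an injective arc-preserving map permutes the vertices and also the arcs,
  so it reflects arcs as well. The extension by the identity is forced by
  \<open>permutes\<close>.\<close>

lemma graph_autI:
  assumes g: "pair_graph X" and f: "f ` pverts X \<subseteq> pverts X" "inj_on f (pverts X)"
    and a: "\<And>u v. (u, v) \<in> parcs X \<Longrightarrow> (f u, f v) \<in> parcs X"
  shows "(\<lambda>v. if v \<in> pverts X then f v else v) \<in> graph_aut X" (is "?f \<in> _")
proof -
  note D = pair_graphD[OF g]
  have bij: "bij_betw f (pverts X) (pverts X)"
    using endo_inj_surj[OF D(1) f] f(2) by (simp add: bij_betw_def)
  have "bij_betw ?f (pverts X) (pverts X)"
    using bij by (simp cong: bij_betw_cong)
  then have p: "?f permutes pverts X"
    by (rule bij_imp_permutes) simp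
  have inj: "inj_on (map_prod f f) (parcs X)"
    using inj_onD[OF f(2)] D(3,4) by (auto intro!: inj_onI)
  have "map_prod f f ` parcs X = parcs X"
    by (rule endo_inj_surj[OF D(2) _ inj]) (use a in auto)
  then have "(u, v) \<in> parcs X" if uv: "u \<in> pverts X" "v \<in> pverts X" "(f u, f v) \<in> parcs X" for u v
  proof -
    have "(f u, f v) \<in> map_prod f f ` parcs X"
      using uv(3) \<open>map_prod f f ` parcs X = parcs X\<close> by simp
    then obtain u' v' where 1: "(u', v') \<in> parcs X" "f u' = f u" "f v' = f v" by force
    then have "u' = u" "v' = v"
      using inj_onD[OF f(2)] uv(1,2) D(3)[OF 1(1)] D(4)[OF 1(1)] by blast+
    then show ?thesis using 1 by simp
  qed
  then show ?thesis
    unfolding graph_aut_def using p a by auto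
qed

lemma graph_autI_exists:
  assumes "pair_graph X" "f ` pverts X \<subseteq> pverts X" "inj_on f (pverts X)"
    "\<And>u v. (u, v) \<in> parcs X \<Longrightarrow> (f u, f v) \<in> parcs X"
  shows "\<exists>g \<in> graph_aut X. \<forall>v \<in> pverts X. g v = f v"
  using graph_autI[OF assms] by (intro bexI) auto

lemma graph_aut_inv:
  assumes f: "f \<in> graph_aut X"
  shows "inv f \<in> graph_aut X"
proof -
  have p: "f permutes pverts X" using f by (simp add: graph_aut_def)
  note q = permutes_inv[OF p]
  have "(inv f u, inv f v) \<in> parcs X \<longleftrightarrow> (u, v) \<in> parcs X"
    if "u \<in> pverts X" "v \<in> pverts X" for u v
    using graph_autD(3)[OF f, of "inv f u" "inv f v"] that permutes_in_image[OF q]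
    by (simp add: permutes_inverses[OF p])
  then show ?thesis using q by (simp add: graph_aut_def)
qed

lemma graph_aut_id: "id \<in> graph_aut X"
  by (simp add: graph_aut_def permutes_id)

definition arc_orbit :: "'a pair_pre_digraph \<Rightarrow> 'a \<times> 'a \<Rightarrow> ('a \<times> 'a) set" where
  "arc_orbit X e = (\<lambda>f. map_prod f f e) ` graph_aut X"

lemma arc_orbits_eq: "arc_orbits X = arc_orbit X ` parcs X"
  by (simp add: arc_orbits_def arc_orbit_def)

lemma arc_orbit_refl: "e \<in> arc_orbit X e"
  unfolding arc_orbit_def using graph_aut_id by (rule image_eqI[rotated]) (cases e, simp)

lemma arc_orbit_closed:
  assumes "e \<in> arc_orbit X e0" "f \<in> graph_aut X"
  shows "map_prod f f e \<in> arc_orbit X e0"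
proof -
  obtain g where g: "g \<in> graph_aut X" "e = map_prod g g e0"
    using assms(1) by (auto simp: arc_orbit_def)
  then have "map_prod f f e = map_prod (f \<circ> g) (f \<circ> g) e0" by (cases e0) auto
  then show ?thesis unfolding arc_orbit_def using graph_aut_comp[OF g(1) assms(2)] by blast
qed

lemma arc_orbit_subset:
  assumes "e \<in> D" "\<And>f e. f \<in> graph_aut X \<Longrightarrow> e \<in> D \<Longrightarrow> map_prod f f e \<in> D"
  shows "arc_orbit X e \<subseteq> D"
  using assms unfolding arc_orbit_def by blast

lemma arc_orbit_sym:
  assumes "e \<in> arc_orbit X e'" shows "e' \<in> arc_orbit X e"
proof -
  obtain f where f: "f \<in> graph_aut X" "e = map_prod f f e'"
    using assms by (auto simp: arc_orbit_def)
  have "map_prod (inv f) (inv f) e = e'"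
    using graph_autD(2)[OF f(1)] f(2) by (cases e') simp
  then show ?thesis unfolding arc_orbit_def using graph_aut_inv[OF f(1)] by blast
qed

lemma arc_orbit_eqI:
  assumes "e \<in> arc_orbit X e'" shows "arc_orbit X e = arc_orbit X e'"
proof (intro equalityI)
  show "arc_orbit X e \<subseteq> arc_orbit X e'"
    by (rule arc_orbit_subset[OF assms arc_orbit_closed])
  show "arc_orbit X e' \<subseteq> arc_orbit X e"
    by (rule arc_orbit_subset[OF arc_orbit_sym[OF assms] arc_orbit_closed])
qed

lemma arc_orbitsI:
  assumes "D \<subseteq> parcs X" "D \<noteq> {}"
    and "\<And>f e. f \<in> graph_aut X \<Longrightarrow> e \<in> D \<Longrightarrow> map_prod f f e \<in> D"
    and "\<And>e e'. e \<in> D \<Longrightarrow> e' \<in> D \<Longrightarrow> \<exists>f \<in> graph_aut X. map_prod f f e = e'"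
  shows "D \<in> arc_orbits X"
proof -
  obtain e where e: "e \<in> D" using assms(2) by blast
  have "arc_orbit X e = D"
  proof
    show "arc_orbit X e \<subseteq> D" using arc_orbit_subset assms(3) e by metis
    show "D \<subseteq> arc_orbit X e" using assms(4)[OF e] by (force simp: arc_orbit_def)
  qed
  then show ?thesis using e assms(1) by (auto simp: arc_orbits_eq)
qed

lemma arc_orbits_disjoint:
  assumes "D \<in> arc_orbits X" "D' \<in> arc_orbits X" "e \<in> D" "e \<in> D'"
  shows "D = D'"
proof -
  obtain d d' where "D = arc_orbit X d" "D' = arc_orbit X d'"
    using assms(1,2) by (auto simp: arc_orbits_eq)
  then show ?thesis using assms(3,4) arc_orbit_eqI by metis
qed

lemma arc_orbits_nonempty: "D \<in> arc_orbits X \<Longrightarrow> D \<noteq> {}"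
  using arc_orbit_refl by (force simp: arc_orbits_eq)

text \<open>Orbits are disjoint and nonempty, so orbits that cover all arcs are all the
  orbits.\<close>

lemma arc_orbits_eqI:
  assumes "\<D> \<subseteq> arc_orbits X" "parcs X \<subseteq> \<Union> \<D>" "pair_graph X"
  shows "arc_orbits X = \<D>"
proof
  show "arc_orbits X \<subseteq> \<D>"
  proof
    fix D assume D: "D \<in> arc_orbits X"
    then obtain e where e: "e \<in> D" using arc_orbits_nonempty by blast
    then obtain D' where "D' \<in> \<D>" "e \<in> D'"
      using assms(2) arc_orbits_subset[OF assms(3) D] by blast
    then show "D \<in> \<D>" using arc_orbits_disjoint[OF D _ e] assms(1) by blast
  qed
qed (fact assms(1))

lemma orbit_valency_card:
  assumes "vtg X" "D \<in> arc_orbits X" "v \<in> pverts X"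
  shows "orbit_valency X D = card {w. (v, w) \<in> D}"
proof -
  note D = vtgD[OF assms(1)]
  have "out_arcs (with_proj X) v \<inter> D = Pair v ` {w. (v, w) \<in> D}"
    using arc_orbits_subset[OF D(1) assms(2)] by (auto simp: out_arcs_def)
  then show ?thesis
    unfolding orbit_valency_eq[OF D(1,2) assms(2,3)] by (simp add: card_image inj_on_def)
qed

section \<open>The marked partition of a family of arc orbits\<close>

text \<open>The formula of \<open>arc_type\<close> for an arbitrary family of arc sets, which makes
  it additive over disjoint families.\<close>

definition family_type :: "(('a \<times> 'a) set \<Rightarrow> nat) \<Rightarrow> ('a \<times> 'a) set set \<Rightarrow> marked_partition" where
  "family_type val \<D> =
     (image_mset val (mset_set {D \<in> \<D>. D\<inverse> = D}),
      image_mset (\<lambda>Q. the_elem (val ` Q)) (mset_set {{D, D\<inverse>} | D. D \<in> \<D> \<and> D\<inverse> \<noteq> D}))"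

lemma arc_type_family: "arc_type X = family_type (orbit_valency X) (arc_orbits X)"
  by (simp add: arc_type_def family_type_def)

text \<open>Closure under converse keeps each bracketed pair \<open>{D, D\<inverse>}\<close> inside
  one of the two families.\<close>

lemma family_type_union:
  assumes "finite \<A>" "finite \<B>" "\<A> \<inter> \<B> = {}"
    and "\<And>D. D \<in> \<A> \<Longrightarrow> D\<inverse> \<in> \<A>" "\<And>D. D \<in> \<B> \<Longrightarrow> D\<inverse> \<in> \<B>"
  shows "family_type val (\<A> \<union> \<B>) = family_type val \<A> + family_type val \<B>"
proof -
  let ?S = "\<lambda>\<D>. {D \<in> \<D>. D\<inverse> = D}" and ?P = "\<lambda>\<D>. {{D, D\<inverse>} | D. D \<in> \<D> \<and> D\<inverse> \<noteq> D}"
  have fin: "finite (?P \<D>)" if "finite \<D>" for \<D> :: "('a \<times> 'a) set set"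
  proof -
    have "?P \<D> \<subseteq> (\<lambda>D. {D, D\<inverse>}) ` \<D>" by blast
    then show ?thesis by (rule finite_subset) (use that in simp)
  qed
  have "?S (\<A> \<union> \<B>) = ?S \<A> \<union> ?S \<B>" "?S \<A> \<inter> ?S \<B> = {}" using assms(3) by blast+
  then have 1: "mset_set (?S (\<A> \<union> \<B>)) = mset_set (?S \<A>) + mset_set (?S \<B>)"
    using assms(1,2) by (simp add: mset_set_Union)
  have "?P (\<A> \<union> \<B>) = ?P \<A> \<union> ?P \<B>" by blast
  moreover have "?P \<A> \<inter> ?P \<B> = {}"
  proof -
    have "{D, D\<inverse>} \<noteq> {E, E\<inverse>}" if "D \<in> \<A>" "E \<in> \<B>" for D E
      using that assms(3) assms(5)[of E] by (auto simp: doubleton_eq_iff)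
    then show ?thesis by blast
  qed
  ultimately have 2: "mset_set (?P (\<A> \<union> \<B>)) = mset_set (?P \<A>) + mset_set (?P \<B>)"
    using fin assms(1,2) by (simp add: mset_set_Union)
  show ?thesis unfolding family_type_def 1 2 by (simp add: plus_prod_def)
qed

lemma mset_set_memD: "x \<in># mset_set A \<Longrightarrow> x \<in> A"
  by (cases "finite A") auto

lemma family_type_image:
  assumes "inj_on L \<D>" "\<And>D. D \<in> \<D> \<Longrightarrow> D\<inverse> \<in> \<D>"
    and "\<And>D. D \<in> \<D> \<Longrightarrow> L (D\<inverse>) = (L D)\<inverse>" "\<And>D. D \<in> \<D> \<Longrightarrow> val' (L D) = val D"
  shows "family_type val' (L ` \<D>) = family_type val \<D>"
proof -
  have iff: "(L D)\<inverse> = L D \<longleftrightarrow> D\<inverse> = D" if "D \<in> \<D>" for D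
    using assms(1-3) that by (metis inj_on_contraD)
  let ?S = "{D \<in> \<D>. D\<inverse> = D}" and ?P = "{{D, D\<inverse>} | D. D \<in> \<D> \<and> D\<inverse> \<noteq> D}"
  have S: "{D \<in> L ` \<D>. D\<inverse> = D} = L ` ?S" using iff by auto
  have "image_mset val' (mset_set (L ` ?S)) = image_mset val' (image_mset L (mset_set ?S))"
    using assms(1) by (simp add: image_mset_mset_set inj_on_def)
  also have "\<dots> = image_mset val (mset_set ?S)"
    using assms(4) by (auto simp: image_mset.compositionality intro!: image_mset_cong
        dest!: mset_set_memD)
  finally have 1: "image_mset val' (mset_set (L ` ?S)) = image_mset val (mset_set ?S)" .
  let ?T = "{D \<in> \<D>. D\<inverse> \<noteq> D}"
  have "{D \<in> L ` \<D>. D\<inverse> \<noteq> D} = L ` ?T" using iff by auto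
  then have "{{D, D\<inverse>} | D. D \<in> L ` \<D> \<and> D\<inverse> \<noteq> D} = (\<lambda>D. {D, D\<inverse>}) ` L ` ?T"
    by (simp only: setcompr_eq_image Collect_mem_eq)
  also have "\<dots> = (\<lambda>D. L ` {D, D\<inverse>}) ` ?T"
    unfolding image_image by (rule image_cong) (use assms(3) in auto)
  also have "\<dots> = image L ` ?P"
    by (simp only: setcompr_eq_image image_image)
  finally have P: "{{D, D\<inverse>} | D. D \<in> L ` \<D> \<and> D\<inverse> \<noteq> D} = image L ` ?P" .
  define PP where "PP = ?P"
  have sub: "Q \<subseteq> \<D>" if "Q \<in> PP" for Q using that assms(2) by (auto simp: PP_def)
  have inj: "inj_on (image L) PP"
    using sub assms(1) by (auto intro!: inj_onI simp: inj_on_image_eq_iff)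
  have "image_mset (\<lambda>Q. the_elem (val' ` Q)) (mset_set (image L ` PP))
      = image_mset (\<lambda>Q. the_elem (val' ` L ` Q)) (mset_set PP)"
    unfolding image_mset_mset_set[OF inj, symmetric] image_mset.compositionality comp_def ..
  also have "\<dots> = image_mset (\<lambda>Q. the_elem (val ` Q)) (mset_set PP)"
  proof (rule image_mset_cong)
    fix Q assume "Q \<in># mset_set PP"
    then have "Q \<in> PP" by (rule mset_set_memD)
    then have "val' ` L ` Q = val ` Q"
      unfolding image_image by (intro image_cong refl) (use sub[of Q] assms(4) in blast)
    then show "the_elem (val' ` L ` Q) = the_elem (val ` Q)" by simp
  qed
  finally show ?thesis unfolding family_type_def S P 1 PP_def by (rule arg_cong)
qed

lemma family_type_selfpaired:
  assumes "D\<inverse> = D" shows "family_type val {D} = ({#val D#}, {#})"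
proof -
  have "{E \<in> {D}. E\<inverse> = E} = {D}" "{{E, E\<inverse>} | E. E \<in> {D} \<and> E\<inverse> \<noteq> E} = {}"
    using assms by auto
  then show ?thesis unfolding family_type_def by simp
qed

lemma family_type_pair:
  assumes "D\<inverse> \<noteq> D" "val (D\<inverse>) = val D" shows "family_type val {D, D\<inverse>} = ({#}, {#val D#})"
proof -
  have 1: "{E \<in> {D, D\<inverse>}. E\<inverse> = E} = {}" using assms by auto
  have 2: "{{E, E\<inverse>} | E. E \<in> {D, D\<inverse>} \<and> E\<inverse> \<noteq> E} = {{D, D\<inverse>}}"
    using assms(1) by (auto simp: doubleton_eq_iff)
  show ?thesis unfolding family_type_def 1 2 using assms by simp
qed

section \<open>Graphs fibred into copies of a smaller graph\<close>

text \<open>The copies \<open>\<phi> i\<close> partition the vertices of \<open>Z\<close>, but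
  \<open>Z\<close> may have further arcs. The assumptions \<open>preserved\<close> and
  \<open>lifts\<close> say that automorphisms of \<open>Z\<close> respect the copied arcs and
  induce, between any two copies, every automorphism of \<open>X\<close>.\<close>

locale fibration =
  fixes X :: "'a pair_pre_digraph" and Z :: "'b pair_pre_digraph"
    and I :: "'i set" and \<phi> :: "'i \<Rightarrow> 'a \<Rightarrow> 'b"
  assumes X: "vtg X" and Z: "vtg Z" and I_nonempty: "I \<noteq> {}"
    and \<phi>_inj: "\<And>i j x y. i \<in> I \<Longrightarrow> j \<in> I \<Longrightarrow> x \<in> pverts X \<Longrightarrow> y \<in> pverts X \<Longrightarrow>
      \<phi> i x = \<phi> j y \<Longrightarrow> i = j \<and> x = y"
    and \<phi>_surj: "\<And>z. z \<in> pverts Z \<Longrightarrow> \<exists>i \<in> I. \<exists>x \<in> pverts X. z = \<phi> i x"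
    and \<phi>_verts: "\<And>i x. i \<in> I \<Longrightarrow> x \<in> pverts X \<Longrightarrow> \<phi> i x \<in> pverts Z"
    and \<phi>_arcs: "\<And>i x y. i \<in> I \<Longrightarrow> (x, y) \<in> parcs X \<Longrightarrow> (\<phi> i x, \<phi> i y) \<in> parcs Z"
    and preserved: "\<And>f i x y. f \<in> graph_aut Z \<Longrightarrow> i \<in> I \<Longrightarrow> (x, y) \<in> parcs X \<Longrightarrow>
      \<exists>j \<in> I. \<exists>x' y'. (x', y') \<in> parcs X \<and> f (\<phi> i x) = \<phi> j x' \<and> f (\<phi> i y) = \<phi> j y'"
    and lifts: "\<And>g i j. g \<in> graph_aut X \<Longrightarrow> i \<in> I \<Longrightarrow> j \<in> I \<Longrightarrow>
      \<exists>f \<in> graph_aut Z. \<forall>x \<in> pverts X. f (\<phi> i x) = \<phi> j (g x)"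
begin

definition lift :: "('a \<times> 'a) set \<Rightarrow> ('b \<times> 'b) set" where
  "lift D = {(\<phi> i x, \<phi> i y) | i x y. i \<in> I \<and> (x, y) \<in> D}"

text \<open>\<open>X\<close> is connected and copied arcs go to copied arcs, so the image of a whole
  copy stays in one copy; injectivity makes the induced map an automorphism of
  \<open>X\<close>.\<close>

lemma aut_layer:
  assumes f: "f \<in> graph_aut Z" and i: "i \<in> I"
  shows "\<exists>j \<in> I. \<exists>g \<in> graph_aut X. \<forall>x \<in> pverts X. f (\<phi> i x) = \<phi> j (g x)"
proof -
  note X = vtgD[OF X]
  obtain x0 where x0: "x0 \<in> pverts X" using X(4) by blast
  obtain j y0 where j: "j \<in> I" "y0 \<in> pverts X" "f (\<phi> i x0) = \<phi> j y0"
    using \<phi>_surj \<phi>_verts[OF i x0] graph_autD(1)[OF f] by meson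
  have ex: "\<exists>y \<in> pverts X. f (\<phi> i x) = \<phi> j y" if "x \<in> pverts X" for x
  proof -
    have "(x0, x) \<in> (parcs X)\<^sup>*" using X(5) x0 that by blast
    then show ?thesis
    proof induction
      case base then show ?case using j by blast
    next
      case (step x x')
      obtain y where y: "y \<in> pverts X" "f (\<phi> i x) = \<phi> j y" using step.IH by blast
      obtain k u u' where k: "k \<in> I" "(u, u') \<in> parcs X" "f (\<phi> i x) = \<phi> k u" "f (\<phi> i x') = \<phi> k u'"
        using preserved[OF f i step.hyps(2)] by blast
      have "k = j" using \<phi>_inj[OF k(1) j(1) X(8)[OF k(2)] y(1)] k(3) y(2) by simp
      then show ?case using k X(9) by blast
    qed
  qed
  define g where "g x = (SOME y. y \<in> pverts X \<and> f (\<phi> i x) = \<phi> j y)" for x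
  have g: "g x \<in> pverts X" "f (\<phi> i x) = \<phi> j (g x)" if "x \<in> pverts X" for x
    using someI_ex[of "\<lambda>y. y \<in> pverts X \<and> f (\<phi> i x) = \<phi> j y"] ex[OF that] unfolding g_def by blast+
  have "inj_on g (pverts X)"
  proof (rule inj_onI)
    fix x y assume xy: "x \<in> pverts X" "y \<in> pverts X" "g x = g y"
    then have "f (\<phi> i x) = f (\<phi> i y)" using g by simp
    then have "\<phi> i x = \<phi> i y" using graph_autD(2)[OF f] by (simp add: inj_eq)
    then show "x = y" using \<phi>_inj[OF i i xy(1,2)] by simp
  qed
  moreover have "(g x, g y) \<in> parcs X" if xy: "(x, y) \<in> parcs X" for x y
  proof -
    obtain k u v where k: "k \<in> I" "(u, v) \<in> parcs X" "f (\<phi> i x) = \<phi> k u" "f (\<phi> i y) = \<phi> k v"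
      using preserved[OF f i xy] by blast
    have "u = g x" using \<phi>_inj[OF k(1) j(1) X(8)[OF k(2)]] g X(8)[OF xy] k(3) by metis
    moreover have "v = g y" using \<phi>_inj[OF k(1) j(1) X(9)[OF k(2)]] g X(9)[OF xy] k(4) by metis
    ultimately show ?thesis using k(2) by simp
  qed
  ultimately obtain g' where "g' \<in> graph_aut X" "\<forall>x \<in> pverts X. g' x = g x"
    using graph_autI_exists[OF X(1), of g] g(1) by blast
  then show ?thesis using g(2) j(1) by (metis)
qed

lemma lift_subset: "D \<subseteq> parcs X \<Longrightarrow> lift D \<subseteq> lift (parcs X)"
  unfolding lift_def by blast

lemma lift_memb:
  assumes "D \<subseteq> parcs X" "i \<in> I" "x \<in> pverts X"
  shows "(\<phi> i x, z) \<in> lift D \<longleftrightarrow> (\<exists>y. (x, y) \<in> D \<and> z = \<phi> i y)"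
proof
  assume "(\<phi> i x, z) \<in> lift D"
  then obtain j x' y' where j: "\<phi> i x = \<phi> j x'" "z = \<phi> j y'" "j \<in> I" "(x', y') \<in> D"
    unfolding lift_def by auto
  then have "i = j \<and> x = x'"
    using \<phi>_inj[OF assms(2) j(3) assms(3)] vtgD(8)[OF X, of x' y'] assms(1) by auto
  then show "\<exists>y. (x, y) \<in> D \<and> z = \<phi> i y" using j by auto
qed (use assms(2) in \<open>auto simp: lift_def\<close>)

text \<open>One inclusion is \<open>aut_layer\<close>, the other is \<open>lifts\<close>. As
  \<open>lifts\<close> reaches every copy, the orbit spreads over all copies.\<close>

lemma lift_arc_orbit:
  assumes i: "i \<in> I" and xy: "(x, y) \<in> parcs X"
  shows "arc_orbit Z (\<phi> i x, \<phi> i y) = lift (arc_orbit X (x, y))"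
proof (intro equalityI subsetI)
  note V = vtgD(8,9)[OF X xy]
  fix e assume "e \<in> arc_orbit Z (\<phi> i x, \<phi> i y)"
  then obtain f where f: "f \<in> graph_aut Z" "e = (f (\<phi> i x), f (\<phi> i y))" by (auto simp: arc_orbit_def)
  then obtain j g where "j \<in> I" "g \<in> graph_aut X" "\<forall>x \<in> pverts X. f (\<phi> i x) = \<phi> j (g x)"
    using aut_layer[OF f(1) i] by blast
  then show "e \<in> lift (arc_orbit X (x, y))"
    using V f(2) unfolding lift_def arc_orbit_def by auto
next
  note V = vtgD(8,9)[OF X xy]
  fix e assume "e \<in> lift (arc_orbit X (x, y))"
  then obtain j g where j: "j \<in> I" "g \<in> graph_aut X" "e = (\<phi> j (g x), \<phi> j (g y))"
    unfolding lift_def arc_orbit_def by auto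
  then obtain f where "f \<in> graph_aut Z" "\<forall>x \<in> pverts X. f (\<phi> i x) = \<phi> j (g x)"
    using lifts[OF j(2) i j(1)] by blast
  then show "e \<in> arc_orbit Z (\<phi> i x, \<phi> i y)"
    using V j(3) unfolding arc_orbit_def by (auto intro!: image_eqI[of _ _ f])
qed

lemma layer_orbits: "{D \<in> arc_orbits Z. D \<subseteq> lift (parcs X)} = lift ` arc_orbits X"
proof (intro equalityI subsetI)
  fix D assume D: "D \<in> {D \<in> arc_orbits Z. D \<subseteq> lift (parcs X)}"
  then obtain e where e: "e \<in> D" using arc_orbits_nonempty by blast
  then obtain i x y where i: "i \<in> I" "(x, y) \<in> parcs X" "e = (\<phi> i x, \<phi> i y)"
    using D unfolding lift_def by blast
  obtain e0 where "D = arc_orbit Z e0" using D by (auto simp: arc_orbits_eq)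
  then have "D = arc_orbit Z (\<phi> i x, \<phi> i y)" using e i(3) arc_orbit_eqI by blast
  then show "D \<in> lift ` arc_orbits X"
    using lift_arc_orbit[OF i(1,2)] i(2) by (auto simp: arc_orbits_eq)
next
  fix D assume "D \<in> lift ` arc_orbits X"
  then obtain x y where xy: "(x, y) \<in> parcs X" "D = lift (arc_orbit X (x, y))"
    by (auto simp: arc_orbits_eq)
  obtain i where i: "i \<in> I" using I_nonempty by blast
  have "arc_orbit X (x, y) \<subseteq> parcs X"
    using arc_orbits_subset[OF vtgD(1)[OF X]] xy(1) by (auto simp: arc_orbits_eq)
  moreover have "D \<in> arc_orbits Z"
    using lift_arc_orbit[OF i xy(1)] \<phi>_arcs[OF i xy(1)] xy(2) by (auto simp: arc_orbits_eq)
  ultimately show "D \<in> {D \<in> arc_orbits Z. D \<subseteq> lift (parcs X)}"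
    using lift_subset xy(2) by auto
qed

text \<open>Lifting is a bijection between the orbits of \<open>X\<close> and those of
  \<open>Z\<close> inside the copies. It commutes with converses and keeps valencies, since the
  out-neighbours of a vertex in a lifted orbit all lie in its own copy.\<close>

theorem layer_type:
  "family_type (orbit_valency Z) {D \<in> arc_orbits Z. D \<subseteq> lift (parcs X)} = arc_type X"
  unfolding layer_orbits arc_type_family
proof (rule family_type_image)
  note sub = arc_orbits_subset[OF vtgD(1)[OF X]]
  obtain i where i: "i \<in> I" using I_nonempty by blast
  show "inj_on lift (arc_orbits X)"
  proof (rule inj_onI)
    have le: "D \<subseteq> D'" if D: "D \<in> arc_orbits X" "D' \<in> arc_orbits X" "lift D = lift D'" for D D'
    proof
      fix e assume e: "e \<in> D"
      obtain x y where xy: "e = (x, y)" by (cases e)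
      then have V: "x \<in> pverts X" "y \<in> pverts X"
        using vtgD(8,9)[OF X] sub[OF D(1)] e by auto
      have "(\<phi> i x, \<phi> i y) \<in> lift D'"
        using lift_memb[OF sub[OF D(1)] i V(1)] e xy D(3) by blast
      then obtain y' where "(x, y') \<in> D'" "\<phi> i y = \<phi> i y'"
        using lift_memb[OF sub[OF D(2)] i V(1)] by blast
      moreover from this have "y' = y"
        using \<phi>_inj[OF i i V(2)] vtgD(9)[OF X] sub[OF D(2)] by blast
      ultimately show "e \<in> D'" using xy by simp
    qed
    fix D D' assume "D \<in> arc_orbits X" "D' \<in> arc_orbits X" "lift D = lift D'"
    then show "D = D'" using le by (metis subset_antisym)
  qed
  show "D\<inverse> \<in> arc_orbits X" if "D \<in> arc_orbits X" for D
    by (rule arc_orbits_converse[OF vtgD(1)[OF X] that])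
  show "lift (D\<inverse>) = (lift D)\<inverse>" for D unfolding lift_def by blast
  fix D assume D: "D \<in> arc_orbits X"
  obtain x where x: "x \<in> pverts X" using vtgD(4)[OF X] by blast
  have "lift D \<in> arc_orbits Z" using D layer_orbits by blast
  then have "orbit_valency Z (lift D) = card {w. (\<phi> i x, w) \<in> lift D}"
    by (rule orbit_valency_card[OF Z _ \<phi>_verts[OF i x]])
  also have "{w. (\<phi> i x, w) \<in> lift D} = \<phi> i ` {y. (x, y) \<in> D}"
    using lift_memb[OF sub[OF D] i x] by auto
  also have "card \<dots> = card {y. (x, y) \<in> D}"
  proof (rule card_image, rule inj_onI)
    fix y y' assume "y \<in> {y. (x, y) \<in> D}" "y' \<in> {y. (x, y) \<in> D}" "\<phi> i y = \<phi> i y'"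
    then show "y = y'" using \<phi>_inj[OF i i] vtgD(9)[OF X] sub[OF D] by blast
  qed
  also have "\<dots> = orbit_valency X D" using orbit_valency_card[OF X D x] by simp
  finally show "orbit_valency Z (lift D) = orbit_valency X D" .
qed

lemma lift_invariant:
  assumes "f \<in> graph_aut Z" "e \<in> lift (parcs X)"
  shows "map_prod f f e \<in> lift (parcs X)"
  using preserved[OF assms(1)] assms(2) unfolding lift_def by fastforce

end

lemma arc_orbits_finite: "vtg Z \<Longrightarrow> finite (arc_orbits Z)"
  using vtgD(7) by (auto simp: arc_orbits_eq)

text \<open>Invariance of \<open>K\<close> puts every orbit entirely into \<open>K\<close> or
  entirely into its complement.\<close>

lemma arc_type_split:
  assumes Z: "vtg Z" and K: "K \<union> K' = parcs Z" "K \<inter> K' = {}" "K\<inverse> = K" "K'\<inverse> = K'"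
    and inv: "\<And>f e. f \<in> graph_aut Z \<Longrightarrow> e \<in> K \<Longrightarrow> map_prod f f e \<in> K"
  shows "arc_type Z = family_type (orbit_valency Z) {D \<in> arc_orbits Z. D \<subseteq> K}
    + family_type (orbit_valency Z) {D \<in> arc_orbits Z. D \<subseteq> K'}"
proof -
  have sub: "D \<subseteq> parcs Z" if "D \<in> arc_orbits Z" for D
    using arc_orbits_subset[OF vtgD(1)[OF Z] that] .
  have dich: "D \<subseteq> K \<or> D \<subseteq> K'" if D: "D \<in> arc_orbits Z" for D
  proof (cases "D \<inter> K = {}")
    case True then show ?thesis using sub[OF D] K(1) by blast
  next
    case False
    then obtain e where e: "e \<in> D" "e \<in> K" by blast
    obtain e0 where "D = arc_orbit Z e0" using D by (auto simp: arc_orbits_eq)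
    then have "D = arc_orbit Z e" using e(1) arc_orbit_eqI by blast
    then show ?thesis using arc_orbit_subset[OF e(2) inv] by blast
  qed
  have "arc_orbits Z = {D \<in> arc_orbits Z. D \<subseteq> K} \<union> {D \<in> arc_orbits Z. D \<subseteq> K'}"
    using dich by blast
  moreover have "{D \<in> arc_orbits Z. D \<subseteq> K} \<inter> {D \<in> arc_orbits Z. D \<subseteq> K'} = {}"
    using K(2) arc_orbits_nonempty by fastforce
  moreover have "D\<inverse> \<in> {D \<in> arc_orbits Z. D \<subseteq> M}" if "D \<in> {D \<in> arc_orbits Z. D \<subseteq> M}" "M\<inverse> = M" for D M
    using that arc_orbits_converse[OF vtgD(1)[OF Z]] by (metis (mono_tags, lifting) converse_mono mem_Collect_eq)
  ultimately show ?thesis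
    unfolding arc_type_family using family_type_union[where val = "orbit_valency Z"] arc_orbits_finite[OF Z] K(3,4)
    by (metis (no_types, lifting) finite_Un)
qed

text \<open>The two families of copies share all vertices and divide the arcs between them; each
  contributes the arc-type of its own fibre.\<close>

lemma arc_type_two_fibrations:
  assumes "fibration X Z I \<phi>" "fibration Y Z J \<psi>"
    and "fibration.lift I \<phi> (parcs X) \<union> fibration.lift J \<psi> (parcs Y) = parcs Z"
    and "fibration.lift I \<phi> (parcs X) \<inter> fibration.lift J \<psi> (parcs Y) = {}"
  shows "arc_type Z = arc_type X + arc_type Y"
proof -
  interpret A: fibration X Z I \<phi> by fact
  interpret B: fibration Y Z J \<psi> by fact
  have "(A.lift (parcs X))\<inverse> = A.lift (parcs X)" "(B.lift (parcs Y))\<inverse> = B.lift (parcs Y)"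
    using vtgD(10)[OF A.X] vtgD(10)[OF B.X] unfolding A.lift_def B.lift_def by blast+
  then show ?thesis
    using arc_type_split[OF A.Z assms(3,4) _ _ A.lift_invariant] A.layer_type B.layer_type by simp
qed

section \<open>Realizable marked partitions\<close>

text \<open>For distinct neighbours \<open>w\<close>, \<open>w'\<close> of \<open>v\<close>, the
  corner \<open>w\<close>-\<open>v\<close>-\<open>w'\<close> lies on a 4-cycle with opposite vertex
  \<open>u\<close>.\<close>

definition in_square :: "'a pair_pre_digraph \<Rightarrow> 'a \<Rightarrow> 'a \<Rightarrow> 'a \<Rightarrow> bool" where
  "in_square X w v w' \<longleftrightarrow> (\<exists>u. u \<noteq> v \<and> (w, u) \<in> parcs X \<and> (u, w') \<in> parcs X)"

text \<open>Asks for some partner of each arc, not all; so \<open>unsquared\<close> and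
  \<open>squared\<close> may hold together, and either forces valency at least 2.\<close>

definition unsquared :: "'a pair_pre_digraph \<Rightarrow> bool" where
  "unsquared X \<longleftrightarrow> (\<forall>(v, w) \<in> parcs X. \<exists>w'. (v, w') \<in> parcs X \<and> w' \<noteq> w \<and> \<not> in_square X w v w')"

definition squared :: "'a pair_pre_digraph \<Rightarrow> bool" where
  "squared X \<longleftrightarrow> (\<forall>(v, w) \<in> parcs X. \<exists>w'. (v, w') \<in> parcs X \<and> w' \<noteq> w \<and> in_square X w v w')"

definition bipartition :: "'a pair_pre_digraph \<Rightarrow> ('a \<Rightarrow> bool) \<Rightarrow> bool" where
  "bipartition X p \<longleftrightarrow> (\<forall>(u, v) \<in> parcs X. p u \<noteq> p v)"

lemma in_square_aut:
  assumes "pair_graph X" "f \<in> graph_aut X"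
  shows "in_square X (f w) (f v) (f w') \<longleftrightarrow> in_square X w v w'"
proof -
  have imp: "in_square X (f w) (f v) (f w')" if "in_square X w v w'" "f \<in> graph_aut X" for f w v w'
  proof -
    obtain u where "u \<noteq> v" "(w, u) \<in> parcs X" "(u, w') \<in> parcs X"
      using \<open>in_square X w v w'\<close> by (auto simp: in_square_def)
    then show ?thesis
      unfolding in_square_def using graph_aut_arc_iff[OF assms(1) that(2)] graph_autD(2)[OF that(2)]
      by (intro exI[of _ "f u"]) (auto simp: inj_eq)
  qed
  have "inv f (f z) = z" for z using graph_autD(2)[OF assms(2)] by simp
  then show ?thesis
    using imp[OF _ assms(2), of w v w'] imp[OF _ graph_aut_inv[OF assms(2)], of "f w" "f v" "f w'"] by auto
qed

lemma vtgI:
  assumes g: "pair_graph X" and ne: "parcs X \<noteq> {}"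
    and vt: "\<And>u v. u \<in> pverts X \<Longrightarrow> v \<in> pverts X \<Longrightarrow> \<exists>f \<in> graph_aut X. f u = v"
    and r: "\<And>v. v \<in> pverts X \<Longrightarrow> (r, v) \<in> (parcs X)\<^sup>*"
  shows "vtg X"
proof -
  have s: "sym ((parcs X)\<^sup>*)"
    using pair_graphD(5)[OF g] by (intro sym_rtrancl symI)
  have "(u, v) \<in> (parcs X)\<^sup>*" if "u \<in> pverts X" "v \<in> pverts X" for u v
    using symD[OF s r[OF that(1)]] r[OF that(2)] by (rule rtrancl_trans)
  then show ?thesis using g ne vt unfolding vtg_def vertex_transitive_def by auto
qed

text \<open>The induction invariant: a bipartition to twist the next product with, and one of the
  two alternatives needed to adjoin a summand 1. Fixing the vertex type \<open>nat\<close> allows a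
  single existential statement for all constructions.\<close>

definition realized :: "marked_partition \<Rightarrow> bool" where
  "realized P \<longleftrightarrow> (\<exists>(X :: nat pair_pre_digraph) p. vtg X \<and> bipartition X p \<and>
     (unsquared X \<or> squared X) \<and> arc_type X = P)"

lemma image_arc_iff:
  assumes h: "inj_on h V" and A: "A \<subseteq> V \<times> V" and uv: "u \<in> V" "v \<in> V"
  shows "(h u, h v) \<in> map_prod h h ` A \<longleftrightarrow> (u, v) \<in> A"
proof
  assume "(h u, h v) \<in> map_prod h h ` A"
  then obtain u' v' where 1: "(u', v') \<in> A" "h u = h u'" "h v = h v'" by auto
  have "u' \<in> V" "v' \<in> V" using A 1(1) by blast+
  then have "u = u'" "v = v'" using inj_onD[OF h 1(2)] inj_onD[OF h 1(3)] uv by auto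
  then show "(u, v) \<in> A" using 1 by simp
qed force

lemma transport:
  fixes Z :: "'b pair_pre_digraph"
  assumes Z: "vtg Z"
  shows "\<exists>(X :: nat pair_pre_digraph) h. inj_on h (pverts Z) \<and> pverts X = h ` pverts Z \<and>
    parcs X = map_prod h h ` parcs Z \<and> vtg X \<and> arc_type X = arc_type Z"
proof -
  note ZD = vtgD[OF Z]
  obtain h :: "'b \<Rightarrow> nat" where h: "inj_on h (pverts Z)"
    using finite_imp_inj_to_nat_seg[OF ZD(6)] by blast
  define X where "X = \<lparr>pverts = h ` pverts Z, parcs = map_prod h h ` parcs Z\<rparr>"
  have PX: "pverts X = h ` pverts Z" "parcs X = map_prod h h ` parcs Z" by (simp_all add: X_def)
  have arc: "(h u, h v) \<in> parcs X \<longleftrightarrow> (u, v) \<in> parcs Z" if "u \<in> pverts Z" "v \<in> pverts Z" for u v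
    unfolding PX by (rule image_arc_iff[OF h _ that]) (use ZD(8,9) in auto)
  have g: "pair_graph X"
  proof (rule pair_graphI)
    show "finite (pverts X)" using ZD(6) PX by simp
    show "parcs X \<subseteq> pverts X \<times> pverts X" using ZD(8,9) unfolding PX by auto
    show "sym (parcs X)" using ZD(10) unfolding PX by (force simp: sym_def)
    show "irrefl (parcs X)"
      using inj_onD[OF h] ZD(8,9,11) unfolding PX irrefl_def by (auto, metis)
  qed
  have aut: "\<exists>f' \<in> graph_aut X. \<forall>v \<in> pverts Z. f' (h v) = h (f v)" if f: "f \<in> graph_aut Z" for f
  proof -
    let ?k = "inv_into (pverts Z) h"
    have k: "?k (h v) = v" if "v \<in> pverts Z" for v using h that by simp
    note V = graph_autD(1)[OF f]
    have "\<exists>f' \<in> graph_aut X. \<forall>v \<in> pverts X. f' v = (h \<circ> f \<circ> ?k) v"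
    proof (rule graph_autI_exists[OF g])
      show "(h \<circ> f \<circ> ?k) ` pverts X \<subseteq> pverts X" using k V unfolding PX by auto
      show "inj_on (h \<circ> f \<circ> ?k) (pverts X)"
      proof (rule inj_onI)
        fix a b assume ab: "a \<in> pverts X" "b \<in> pverts X" "(h \<circ> f \<circ> ?k) a = (h \<circ> f \<circ> ?k) b"
        then obtain y z where yz: "y \<in> pverts Z" "z \<in> pverts Z" "a = h y" "b = h z" unfolding PX by blast
        then have "f y = f z" using ab(3) k V inj_onD[OF h] by simp
        then show "a = b" using graph_autD(2)[OF f] yz by (simp add: inj_eq)
      qed
      show "((h \<circ> f \<circ> ?k) u, (h \<circ> f \<circ> ?k) v) \<in> parcs X" if "(u, v) \<in> parcs X" for u v
        using that k ZD(8,9) graph_aut_arc_iff[OF ZD(1) f] unfolding PX by auto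
    qed
    then show ?thesis using k unfolding PX by auto
  qed
  obtain r where r: "r \<in> pverts Z" using ZD(4) by blast
  have "vtg X"
  proof (rule vtgI[OF g])
    show "parcs X \<noteq> {}" using ZD(3) PX by simp
    fix v assume "v \<in> pverts X"
    then obtain z where z: "z \<in> pverts Z" "v = h z" unfolding PX by blast
    have "(r, z) \<in> (parcs Z)\<^sup>*" using ZD(5) r z by blast
    then have "(h r, h z) \<in> (parcs X)\<^sup>*"
    proof induction
      case (step y z)
      then have "(h y, h z) \<in> parcs X" unfolding PX by force
      then show ?case using step.IH by (rule rtrancl_into_rtrancl[rotated])
    qed simp
    then show "(h r, v) \<in> (parcs X)\<^sup>*" using z by simp
  next
    fix u v assume "u \<in> pverts X" "v \<in> pverts X"
    then obtain y z where yz: "y \<in> pverts Z" "z \<in> pverts Z" "u = h y" "v = h z" unfolding PX by blast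
    then obtain f where "f \<in> graph_aut Z" "f y = z" using ZD(2) unfolding vertex_transitive_def by blast
    then show "\<exists>f \<in> graph_aut X. f u = v" using aut yz by metis
  qed
  \<comment> \<open>An isomorphic copy is a fibration with one layer, so \<open>layer_type\<close>
    also gives the invariance of the arc-type under isomorphism.\<close>
  have fib: "fibration Z X {()} (\<lambda>_. h)"
  proof
    show "vtg Z" "vtg X" by fact+
    show "\<exists>j\<in>{()}. \<exists>x' y'. (x', y') \<in> parcs Z \<and> f (h x) = h x' \<and> f (h y) = h y'"
      if "f \<in> graph_aut X" "(x, y) \<in> parcs Z" for f x y
    proof -
      have "(f (h x), f (h y)) \<in> parcs X"
        using graph_aut_arc_iff[OF g that(1)] that(2) unfolding PX by force
      then show ?thesis unfolding PX by auto
    qed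
    show "\<exists>f\<in>graph_aut X. \<forall>x\<in>pverts Z. f (h x) = h (g x)" if "g \<in> graph_aut Z" for g
      using aut[OF that] .
  qed (use h PX arc ZD(8,9) in \<open>auto simp: inj_on_def\<close>)
  have "fibration.lift {()} (\<lambda>_. h) (parcs Z) = parcs X"
    unfolding fibration.lift_def[OF fib] PX by force
  then have "{D \<in> arc_orbits X. D \<subseteq> fibration.lift {()} (\<lambda>_. h) (parcs Z)} = arc_orbits X"
    using arc_orbits_subset[OF g] by auto
  then have "arc_type X = arc_type Z"
    using fibration.layer_type[OF fib] arc_type_family[of X] by simp
  then show ?thesis using h PX \<open>vtg X\<close> by blast
qed

lemma realizedI:
  fixes Z :: "'b pair_pre_digraph"
  assumes Z: "vtg Z" and p: "bipartition Z p" and s: "unsquared Z \<or> squared Z"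
  shows "realized (arc_type Z)"
proof -
  note ZD = vtgD[OF Z]
  obtain X :: "nat pair_pre_digraph" and h where h: "inj_on h (pverts Z)" and
    PX: "pverts X = h ` pverts Z" "parcs X = map_prod h h ` parcs Z" and
    X: "vtg X" "arc_type X = arc_type Z"
    using transport[OF Z] by blast
  have arc: "(h u, h v) \<in> parcs X \<longleftrightarrow> (u, v) \<in> parcs Z" if "u \<in> pverts Z" "v \<in> pverts Z" for u v
    unfolding PX by (rule image_arc_iff[OF h _ that]) (use ZD(8,9) in auto)
  have sq: "in_square X (h w) (h v) (h w') \<longleftrightarrow> in_square Z w v w'"
    if V: "w \<in> pverts Z" "v \<in> pverts Z" "w' \<in> pverts Z" for w v w'
  proof
    assume "in_square X (h w) (h v) (h w')"
    then obtain u where u: "u \<noteq> h v" "(h w, u) \<in> parcs X" "(u, h w') \<in> parcs X"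
      by (auto simp: in_square_def)
    then obtain z where z: "z \<in> pverts Z" "u = h z" using vtgD(9)[OF X(1)] PX(1) by blast
    have "(w, z) \<in> parcs Z" "(z, w') \<in> parcs Z" "z \<noteq> v"
      using u arc[OF V(1) z(1)] arc[OF z(1) V(3)] z(2) by auto
    then show "in_square Z w v w'" unfolding in_square_def by blast
  next
    assume "in_square Z w v w'"
    then obtain u where u: "u \<noteq> v" "(w, u) \<in> parcs Z" "(u, w') \<in> parcs Z"
      by (auto simp: in_square_def)
    show "in_square X (h w) (h v) (h w')"
    proof -
      have "u \<in> pverts Z" using u ZD(9) by blast
      then have "(h w, h u) \<in> parcs X" "(h u, h w') \<in> parcs X" "h u \<noteq> h v"
        using u arc V inj_onD[OF h, of u v] by auto
      then show ?thesis unfolding in_square_def by blast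
    qed
  qed
  have tr: "\<exists>w'. (v, w') \<in> parcs X \<and> w' \<noteq> w \<and> (in_square X w v w' \<longleftrightarrow> b)"
    if Q: "\<And>v w. (v, w) \<in> parcs Z \<Longrightarrow> \<exists>w'. (v, w') \<in> parcs Z \<and> w' \<noteq> w \<and> (in_square Z w v w' \<longleftrightarrow> b)"
      and vw: "(v, w) \<in> parcs X" for b v w
  proof -
    obtain y z where yz: "v = h y" "w = h z" "(y, z) \<in> parcs Z" using vw unfolding PX by auto
    obtain z' where z': "(y, z') \<in> parcs Z" "z' \<noteq> z" "in_square Z z y z' \<longleftrightarrow> b"
      using Q[OF yz(3)] by blast
    have V: "y \<in> pverts Z" "z \<in> pverts Z" "z' \<in> pverts Z" using ZD(8,9) yz(3) z'(1) by blast+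
    then have "(v, h z') \<in> parcs X" "h z' \<noteq> w" "in_square X w v (h z') \<longleftrightarrow> b"
      using arc[of y z'] sq[of z y z'] z' yz(1,2) inj_onD[OF h, of z' z] by auto
    then show ?thesis by blast
  qed
  have "unsquared X \<or> squared X"
    using s
  proof
    assume "unsquared Z"
    then have "\<exists>w'. (v, w') \<in> parcs X \<and> w' \<noteq> w \<and> (in_square X w v w' \<longleftrightarrow> False)" if "(v, w) \<in> parcs X" for v w
      by (intro tr[OF _ that]) (auto simp: unsquared_def)
    then show ?thesis by (auto simp: unsquared_def)
  next
    assume "squared Z"
    then have "\<exists>w'. (v, w') \<in> parcs X \<and> w' \<noteq> w \<and> (in_square X w v w' \<longleftrightarrow> True)" if "(v, w) \<in> parcs X" for v w
      by (intro tr[OF _ that]) (auto simp: squared_def)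
    then show ?thesis by (auto simp: squared_def)
  qed
  moreover have "bipartition X (\<lambda>v. p (inv_into (pverts Z) h v))"
    using p ZD(8,9) h unfolding bipartition_def PX by (fastforce simp: inv_into_f_f)
  ultimately show ?thesis unfolding realized_def using X by blast
qed

text \<open>In a connected graph a 2-colouring is unique up to exchanging the colours.\<close>

lemma bipartition_aut:
  assumes X: "vtg X" and p: "bipartition X p" and g: "g \<in> graph_aut X"
  shows "\<exists>s. \<forall>x \<in> pverts X. p (g x) = (p x \<noteq> s)"
proof -
  note D = vtgD[OF X]
  obtain r where r: "r \<in> pverts X" using D(4) by blast
  have "p (g x) = (p x \<noteq> (p r \<noteq> p (g r)))" if x: "x \<in> pverts X" for x
  proof -
    have "(r, x) \<in> (parcs X)\<^sup>*" using D(5) r x by blast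
    then show ?thesis
    proof induction
      case (step y z)
      have "(g y, g z) \<in> parcs X" using graph_aut_arc_iff[OF D(1) g] step.hyps(2) by blast
      then have "p (g y) \<noteq> p (g z)" "p y \<noteq> p z" using p step.hyps(2) unfolding bipartition_def by auto
      then show ?case using step.IH by auto
    qed auto
  qed
  then show ?thesis by blast
qed

section \<open>Twisted products\<close>

text \<open>
  Copies of \<open>X\<close> are indexed by \<open>Q\<close>; the indices carry two graph structures, and a vertex of
  \<open>X\<close> moves along one or the other according to its colour in the bipartition.
\<close>

locale twisted =
  fixes X :: "'a pair_pre_digraph" and p :: "'a \<Rightarrow> bool"
    and Q :: "'q set" and \<Gamma> :: "bool \<Rightarrow> ('q \<times> 'q) set"
  assumes X: "vtg X" and p: "bipartition X p"
    and Q: "finite Q" "Q \<noteq> {}"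
    and \<Gamma>_sub: "\<And>b q q'. (q, q') \<in> \<Gamma> b \<Longrightarrow> q \<in> Q \<and> q' \<in> Q"
    and \<Gamma>_sym: "\<And>b q q'. (q, q') \<in> \<Gamma> b \<Longrightarrow> (q', q) \<in> \<Gamma> b"
    and \<Gamma>_irrefl: "\<And>b q. (q, q) \<notin> \<Gamma> b"
    and \<Gamma>_ex: "\<And>b q. q \<in> Q \<Longrightarrow> \<exists>q'. (q, q') \<in> \<Gamma> b"
    and \<Gamma>_trans: "\<And>q q'. q \<in> Q \<Longrightarrow> q' \<in> Q \<Longrightarrow> \<exists>\<alpha>. \<alpha> ` Q \<subseteq> Q \<and> inj_on \<alpha> Q \<and>
      (\<forall>b u v. (u, v) \<in> \<Gamma> b \<longrightarrow> (\<alpha> u, \<alpha> v) \<in> \<Gamma> b) \<and> \<alpha> q = q'"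
    and \<Gamma>_swap: "\<exists>\<tau>. \<tau> ` Q \<subseteq> Q \<and> inj_on \<tau> Q \<and> (\<forall>b u v. (u, v) \<in> \<Gamma> b \<longrightarrow> (\<tau> u, \<tau> v) \<in> \<Gamma> (\<not> b))"
    and \<Gamma>_conn: "\<And>q q'. q \<in> Q \<Longrightarrow> q' \<in> Q \<Longrightarrow> (q, q') \<in> (\<Gamma> False \<union> \<Gamma> True)\<^sup>*"
begin

lemmas XD = vtgD[OF X]

definition Xarcs :: "(('q \<times> 'a) \<times> ('q \<times> 'a)) set" where
  "Xarcs = {((q, x), (q, x')) | q x x'. q \<in> Q \<and> (x, x') \<in> parcs X}"

definition Qarcs :: "(('q \<times> 'a) \<times> ('q \<times> 'a)) set" where
  "Qarcs = {((q, x), (q', x)) | q q' x. x \<in> pverts X \<and> (q, q') \<in> \<Gamma> (p x)}"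

definition Z :: "('q \<times> 'a) pair_pre_digraph" where
  "Z = \<lparr>pverts = Q \<times> pverts X, parcs = Xarcs \<union> Qarcs\<rparr>"

lemma Z_simps [simp]: "pverts Z = Q \<times> pverts X" "parcs Z = Xarcs \<union> Qarcs"
  by (simp_all add: Z_def)

lemma Xarcs_iff [simp]: "((q, x), (q', x')) \<in> Xarcs \<longleftrightarrow> q' = q \<and> q \<in> Q \<and> (x, x') \<in> parcs X"
  by (auto simp: Xarcs_def)

lemma Qarcs_iff [simp]:
  "((q, x), (q', x')) \<in> Qarcs \<longleftrightarrow> x' = x \<and> x \<in> pverts X \<and> (q, q') \<in> \<Gamma> (p x)"
  by (auto simp: Qarcs_def)

lemma p_arc: "(x, y) \<in> parcs X \<Longrightarrow> p y = (\<not> p x)"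
  using p unfolding bipartition_def by auto

lemma Xarcs_Qarcs: "Xarcs \<inter> Qarcs = {}"
  using XD(11) by (auto simp: Xarcs_def)

lemma Xarcs_converse: "Xarcs\<inverse> = Xarcs" and Qarcs_converse: "Qarcs\<inverse> = Qarcs"
  using XD(10) \<Gamma>_sym by auto

lemma X_arc_ex: "x \<in> pverts X \<Longrightarrow> \<exists>y. (x, y) \<in> parcs X"
proof -
  assume x: "x \<in> pverts X"
  obtain u v where uv: "(u, v) \<in> parcs X" using XD(3) by auto
  then obtain f where f: "f \<in> graph_aut X" "f u = x"
    using XD(2,8) x unfolding vertex_transitive_def by blast
  then have "(x, f v) \<in> parcs X" using graph_aut_arc_iff[OF XD(1) f(1)] uv by auto
  then show ?thesis by blast
qed

lemma Z_graph: "pair_graph Z"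
proof (rule pair_graphI)
  show "finite (pverts Z)" using Q XD(6) by simp
  show "parcs Z \<subseteq> pverts Z \<times> pverts Z" using XD(8,9) \<Gamma>_sub by (auto simp: Xarcs_def Qarcs_def)
  show "sym (parcs Z)" using XD(10) \<Gamma>_sym by (auto simp: sym_def)
  show "irrefl (parcs Z)" using XD(11) \<Gamma>_irrefl by (auto simp: irrefl_def)
qed

section \<open>Automorphisms and connectedness of a twisted product\<close>

lemma product_aut:
  assumes g: "g \<in> graph_aut X" "\<And>x. x \<in> pverts X \<Longrightarrow> p (g x) = (p x \<noteq> s)"
    and \<alpha>: "\<alpha> ` Q \<subseteq> Q" "inj_on \<alpha> Q" "\<And>b u v. (u, v) \<in> \<Gamma> b \<Longrightarrow> (\<alpha> u, \<alpha> v) \<in> \<Gamma> (b \<noteq> s)"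
  shows "\<exists>f \<in> graph_aut Z. \<forall>q \<in> Q. \<forall>x \<in> pverts X. f (q, x) = (\<alpha> q, g x)"
proof -
  have "\<exists>f \<in> graph_aut Z. \<forall>v \<in> pverts Z. f v = map_prod \<alpha> g v"
  proof (rule graph_autI_exists[OF Z_graph])
    show "map_prod \<alpha> g ` pverts Z \<subseteq> pverts Z" using \<alpha>(1) graph_autD(1)[OF g(1)] by auto
    show "inj_on (map_prod \<alpha> g) (pverts Z)"
      using inj_onD[OF \<alpha>(2)] graph_autD(2)[OF g(1)] by (auto intro!: inj_onI dest: injD)
    show "(map_prod \<alpha> g u, map_prod \<alpha> g v) \<in> parcs Z" if "(u, v) \<in> parcs Z" for u v
      using that \<alpha>(1,3) g(2) graph_autD(1)[OF g(1)] graph_aut_arc_iff[OF XD(1) g(1)]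
      by (cases u; cases v) auto
  qed
  then show ?thesis by auto
qed

text \<open>If \<open>g\<close> exchanges the colours, the index structures must be exchanged too.
  That is what \<open>\<Gamma>_swap\<close> provides; a further simultaneous symmetry of both
  structures then corrects the target index.\<close>

lemma layer_aut:
  assumes g: "g \<in> graph_aut X" and q: "q \<in> Q" "q' \<in> Q"
  shows "\<exists>f \<in> graph_aut Z. \<forall>x \<in> pverts X. f (q, x) = (q', g x)"
proof -
  obtain s where s: "\<And>x. x \<in> pverts X \<Longrightarrow> p (g x) = (p x \<noteq> s)"
    using bipartition_aut[OF X p g] by blast
  show ?thesis
  proof (cases s)
    case False
    obtain \<alpha> where \<alpha>: "\<alpha> ` Q \<subseteq> Q" "inj_on \<alpha> Q" "\<And>b u v. (u, v) \<in> \<Gamma> b \<Longrightarrow> (\<alpha> u, \<alpha> v) \<in> \<Gamma> b" "\<alpha> q = q'"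
      using \<Gamma>_trans[OF q] by blast
    have "\<exists>f \<in> graph_aut Z. \<forall>q \<in> Q. \<forall>x \<in> pverts X. f (q, x) = (\<alpha> q, g x)"
      using product_aut[OF g s \<alpha>(1,2)] \<alpha>(3) False by simp
    then show ?thesis using \<alpha>(4) q by blast
  next
    case True
    obtain \<tau> where \<tau>: "\<tau> ` Q \<subseteq> Q" "inj_on \<tau> Q" "\<And>b u v. (u, v) \<in> \<Gamma> b \<Longrightarrow> (\<tau> u, \<tau> v) \<in> \<Gamma> (\<not> b)"
      using \<Gamma>_swap by blast
    obtain \<alpha> where \<alpha>: "\<alpha> ` Q \<subseteq> Q" "inj_on \<alpha> Q" "\<And>b u v. (u, v) \<in> \<Gamma> b \<Longrightarrow> (\<alpha> u, \<alpha> v) \<in> \<Gamma> b" "\<alpha> (\<tau> q) = q'"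
      using \<Gamma>_trans[of "\<tau> q" q'] \<tau>(1) q by blast
    have 1: "(\<alpha> \<circ> \<tau>) ` Q \<subseteq> Q" using \<alpha>(1) \<tau>(1) by auto
    have 2: "inj_on (\<alpha> \<circ> \<tau>) Q" using comp_inj_on[OF \<tau>(2)] inj_on_subset[OF \<alpha>(2) \<tau>(1)] by blast
    have 3: "((\<alpha> \<circ> \<tau>) u, (\<alpha> \<circ> \<tau>) v) \<in> \<Gamma> (b \<noteq> s)" if "(u, v) \<in> \<Gamma> b" for b u v
      using \<alpha>(3)[OF \<tau>(3)[OF that]] True by simp
    obtain f where f: "f \<in> graph_aut Z" "\<forall>q \<in> Q. \<forall>x \<in> pverts X. f (q, x) = ((\<alpha> \<circ> \<tau>) q, g x)"
      using product_aut[OF g s 1 2 3] by blast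
    then show ?thesis using \<alpha>(4) q(1) by (intro bexI[of _ f]) auto
  qed
qed

lemma Z_conn:
  assumes "q \<in> Q" "x \<in> pverts X" "q' \<in> Q" "x' \<in> pverts X"
  shows "((q, x), (q', x')) \<in> (parcs Z)\<^sup>*"
proof -
  have layer: "((u, y), (u, z)) \<in> (parcs Z)\<^sup>*" if "u \<in> Q" "y \<in> pverts X" "z \<in> pverts X" for u y z
  proof -
    have "(y, z) \<in> (parcs X)\<^sup>*" using XD(5) that by blast
    then show ?thesis
    proof induction
      case (step v w)
      then have "((u, v), (u, w)) \<in> parcs Z" using that by simp
      then show ?case using step.IH by (rule rtrancl_into_rtrancl[rotated])
    qed simp
  qed
  have "(q, q') \<in> (\<Gamma> False \<union> \<Gamma> True)\<^sup>*" using \<Gamma>_conn assms by blast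
  then have "((q, x), (q', x)) \<in> (parcs Z)\<^sup>*"
  proof induction
    case (step u v)
    \<comment> \<open>The index moves along \<open>\<Gamma> b\<close> only at a vertex of colour
      \<open>b\<close>; walk there inside the layer, move, and walk back.\<close>
    obtain b where b: "(u, v) \<in> \<Gamma> b" using step.hyps(2) by blast
    obtain y where "(x, y) \<in> parcs X" using X_arc_ex assms(2) by blast
    then obtain z where z: "z \<in> pverts X" "p z = b" using XD(9) assms(2) p_arc by (metis (full_types))
    have "((u, x), (u, z)) \<in> (parcs Z)\<^sup>*" "((v, z), (v, x)) \<in> (parcs Z)\<^sup>*"
      using layer \<Gamma>_sub[OF b] z assms(2) by blast+
    moreover have "((u, z), (v, z)) \<in> parcs Z" using b z by simp
    ultimately show ?case using step.IH by (meson rtrancl_into_rtrancl rtrancl_trans)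
  qed simp
  then show ?thesis using layer[OF assms(3,2,4)] by (rule rtrancl_trans)
qed

lemma Z_vtg: "vtg Z"
proof -
  obtain q0 x0 where r: "q0 \<in> Q" "x0 \<in> pverts X" using Q(2) XD(4) by blast
  show ?thesis
  proof (rule vtgI[OF Z_graph])
    obtain q' where "(q0, q') \<in> \<Gamma> (p x0)" using \<Gamma>_ex[OF r(1)] by blast
    then have "((q0, x0), (q', x0)) \<in> parcs Z" using r by simp
    then show "parcs Z \<noteq> {}" by blast
    fix u v assume "u \<in> pverts Z" "v \<in> pverts Z"
    then obtain q x q' x' where uv: "u = (q, x)" "v = (q', x')" "q \<in> Q" "q' \<in> Q" "x \<in> pverts X" "x' \<in> pverts X"
      by auto
    obtain g where g: "g \<in> graph_aut X" "g x = x'"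
      using XD(2) uv unfolding vertex_transitive_def by blast
    show "\<exists>f\<in>graph_aut Z. f u = v" using layer_aut[OF g(1) uv(3,4)] uv g(2) by auto
  next
    show "((q0, x0), v) \<in> (parcs Z)\<^sup>*" if "v \<in> pverts Z" for v
      using Z_conn[OF r] that by auto
  qed
qed

lemma Z_bipartition:
  assumes "\<And>b u v. (u, v) \<in> \<Gamma> b \<Longrightarrow> c u \<noteq> c v"
  shows "bipartition Z (\<lambda>(q, x). c q \<noteq> p x)"
  using assms p_arc unfolding bipartition_def by (auto simp: Xarcs_def Qarcs_def)

text \<open>Closing such a 4-cycle would need the same index move at \<open>x\<close> and at
  \<open>y\<close>, but these have different colours and their structures share no pair.\<close>

lemma mixed_not_square:
  assumes "\<Gamma> False \<inter> \<Gamma> True = {}" "(x, y) \<in> parcs X" "(q, q') \<in> \<Gamma> (p x)"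
  shows "\<not> in_square Z (q, y) (q, x) (q', x)" "\<not> in_square Z (q', x) (q, x) (q, y)"
proof -
  have d: "(u, v) \<notin> \<Gamma> (\<not> b)" if "(u, v) \<in> \<Gamma> b" for u v b using assms(1) that by (cases b) auto
  have "x \<noteq> y" "q \<noteq> q'" using assms(2,3) XD(11) \<Gamma>_irrefl by blast+
  then show "\<not> in_square Z (q, y) (q, x) (q', x)" "\<not> in_square Z (q', x) (q, x) (q, y)"
    using assms(2,3) d[OF assms(3)] d[OF \<Gamma>_sym[OF assms(3)]] p_arc[OF assms(2)]
    unfolding in_square_def by auto
qed

text \<open>An old and a new arc leave every vertex, so each arc has a partner of the other
  kind.\<close>

lemma Z_unsquared:
  assumes "\<Gamma> False \<inter> \<Gamma> True = {}"
  shows "unsquared Z"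
  unfolding unsquared_def
proof (intro ballI, clarify)
  fix q x q' x' assume "((q, x), (q', x')) \<in> parcs Z"
  then consider "q' = q" "q \<in> Q" "(x, x') \<in> parcs X" | "x' = x" "x \<in> pverts X" "(q, q') \<in> \<Gamma> (p x)" by auto
  then show "\<exists>w'. ((q, x), w') \<in> parcs Z \<and> w' \<noteq> (q', x') \<and> \<not> in_square Z (q', x') (q, x) w'"
  proof cases
    case 1
    obtain u where u: "(q, u) \<in> \<Gamma> (p x)" using \<Gamma>_ex[OF 1(2)] by blast
    show ?thesis using mixed_not_square(1)[OF assms 1(3) u] 1 u XD(8,11)
      by (intro exI[of _ "(u, x)"]) auto
  next
    case 2
    obtain y where y: "(x, y) \<in> parcs X" using X_arc_ex 2 by blast
    show ?thesis using mixed_not_square(2)[OF assms y 2(3)] 2 y XD(11) \<Gamma>_sub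
      by (intro exI[of _ "(q, y)"]) auto
  qed
qed

lemma X_fibration:
  assumes "\<And>f e. f \<in> graph_aut Z \<Longrightarrow> e \<in> Xarcs \<Longrightarrow> map_prod f f e \<in> Xarcs"
  shows "fibration X Z Q Pair"
proof
  show "vtg X" "vtg Z" by (fact X Z_vtg)+
  show "\<exists>j\<in>Q. \<exists>x' y'. (x', y') \<in> parcs X \<and> f (i, x) = (j, x') \<and> f (i, y) = (j, y')"
    if "f \<in> graph_aut Z" "i \<in> Q" "(x, y) \<in> parcs X" for f i x y
    using assms[OF that(1), of "((i, x), (i, y))"] that(2,3) by (auto simp: Xarcs_def)
qed (use Q layer_aut in auto)

end

text \<open>6-cycles all of whose corners lie on 4-cycles are discounted. In a complete bipartite
  graph every corner lies on a 4-cycle, so there no 6-cycle counts, and one criterion serves for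
  these graphs and for graphs with few 6-cycles.\<close>

definition good_corner :: "'a pair_pre_digraph \<Rightarrow> 'a \<Rightarrow> 'a \<Rightarrow> 'a \<Rightarrow> bool" where
  "good_corner X w v w' \<longleftrightarrow> (\<exists>a b c. distinct [w, v, w', a, b, c] \<and>
     {(w, v), (v, w'), (w', a), (a, b), (b, c), (c, w)} \<subseteq> parcs X \<and>
     \<not> (in_square X w v w' \<and> in_square X v w' a \<and> in_square X w' a b \<and>
        in_square X a b c \<and> in_square X b c w \<and> in_square X c w v))"

text \<open>The reverse implication comes from the inverse automorphism.\<close>

lemma graph_aut_iffI:
  assumes "f \<in> graph_aut X"
    and imp: "\<And>f u v w. f \<in> graph_aut X \<Longrightarrow> P u v w \<Longrightarrow> P (f u) (f v) (f w)"
  shows "P (f u) (f v) (f w) \<longleftrightarrow> P u v w"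
proof -
  have "inv f (f z) = z" for z using graph_autD(2)[OF assms(1)] by simp
  then show ?thesis using imp[OF assms(1)] imp[OF graph_aut_inv[OF assms(1)], of "f u" "f v" "f w"] by auto
qed

lemma good_corner_aut:
  assumes g: "pair_graph X" and f: "f \<in> graph_aut X"
  shows "good_corner X (f u) (f v) (f w) \<longleftrightarrow> good_corner X u v w"
proof (rule graph_aut_iffI[OF f])
  fix f u v w assume f: "f \<in> graph_aut X" and "good_corner X u v w"
  then obtain a b c where "distinct [u, v, w, a, b, c]"
    "{(u, v), (v, w), (w, a), (a, b), (b, c), (c, u)} \<subseteq> parcs X"
    "\<not> (in_square X u v w \<and> in_square X v w a \<and> in_square X w a b \<and>
        in_square X a b c \<and> in_square X b c u \<and> in_square X c u v)"
    unfolding good_corner_def by blast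
  then show "good_corner X (f u) (f v) (f w)"
    unfolding good_corner_def
    by (intro exI[of _ "f a"] exI[of _ "f b"] exI[of _ "f c"])
      (simp add: graph_aut_arc_iff[OF g f] in_square_aut[OF g f] inj_eq[OF graph_autD(2)[OF f]])
qed

section \<open>Telling old arcs from new ones\<close>

context twisted
begin

text \<open>Any automorphism-invariant relation that holds on the new arcs and fails on the old ones
  separates the two kinds; each construction supplies its own \<open>\<Phi>\<close>.\<close>

lemma Xarcs_preservedI:
  assumes \<Phi>: "\<And>f v w. f \<in> graph_aut Z \<Longrightarrow> \<Phi> (f v) (f w) \<longleftrightarrow> \<Phi> v w"
    and Q: "\<And>v w. (v, w) \<in> Qarcs \<Longrightarrow> \<Phi> v w" and X: "\<And>v w. (v, w) \<in> Xarcs \<Longrightarrow> \<not> \<Phi> v w"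
    and f: "f \<in> graph_aut Z"
  shows "e \<in> Xarcs \<Longrightarrow> map_prod f f e \<in> Xarcs" "e \<in> Qarcs \<Longrightarrow> map_prod f f e \<in> Qarcs"
proof -
  have 1: "map_prod f f e \<in> Xarcs \<union> Qarcs" if "e \<in> Xarcs \<union> Qarcs"
    using graph_aut_arcs[OF Z_graph f, of e] that by simp
  show "map_prod f f e \<in> Xarcs" if "e \<in> Xarcs"
    using 1 that Q X \<Phi>[OF f] by (cases e) (metis UnE UnI1 map_prod_simp)
  show "map_prod f f e \<in> Qarcs" if "e \<in> Qarcs"
    using 1 that Q X \<Phi>[OF f] by (cases e) (metis UnE UnI2 map_prod_simp)
qed

definition square_at :: "bool \<Rightarrow> 'q \<Rightarrow> 'q \<Rightarrow> 'q \<Rightarrow> bool" where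
  "square_at b u v w \<longleftrightarrow> (\<exists>z. z \<noteq> v \<and> (u, z) \<in> \<Gamma> b \<and> (z, w) \<in> \<Gamma> b)"

text \<open>Conditions on the index alone that leave no countable 6-cycle through \<open>q1\<close>,
  \<open>q\<close>, \<open>q2\<close> at a vertex of colour \<open>b\<close>. The clauses on
  \<open>r\<close> handle 6-cycles that also use old arcs, the last clause those with new arcs
  only.\<close>

definition bad_partner :: "bool \<Rightarrow> 'q \<Rightarrow> 'q \<Rightarrow> 'q \<Rightarrow> bool" where
  "bad_partner b q1 q q2 \<longleftrightarrow> q2 \<noteq> q1 \<and> (q, q2) \<in> \<Gamma> b \<and>
     (\<forall>r. ((q2, r) \<in> \<Gamma> (\<not> b) \<longrightarrow> (r, q1) \<notin> \<Gamma> b \<union> \<Gamma> (\<not> b)) \<and>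
          ((q2, r) \<in> \<Gamma> b \<longrightarrow> (r, q1) \<notin> \<Gamma> (\<not> b))) \<and>
     (\<forall>a c d. distinct [q1, q, q2, a, c, d] \<longrightarrow>
        {(q2, a), (a, c), (c, d), (d, q1)} \<subseteq> \<Gamma> b \<longrightarrow>
        square_at b q1 q q2 \<and> square_at b q q2 a \<and> square_at b q2 a c \<and>
        square_at b a c d \<and> square_at b c d q1 \<and> square_at b d q1 q)"

lemma square_at_lift:
  "square_at (p x) u v w \<Longrightarrow> x \<in> pverts X \<Longrightarrow> in_square Z (u, x) (v, x) (w, x)"
  unfolding square_at_def in_square_def by auto

text \<open>Old arcs change the colour, so an even number of the four remaining arcs are old. Four
  old ones would give \<open>q2 = q1\<close>. With two, they cannot be consecutive without repeating
  a vertex, so some index move happens at the other colour, which the clauses on \<open>r\<close>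
  exclude. Thus all four are new and the last clause applies.\<close>

lemma bad_partner_not_good:
  assumes x: "x \<in> pverts X" and q1: "(q, q1) \<in> \<Gamma> (p x)" and bad: "bad_partner (p x) q1 q q2"
  shows "\<not> good_corner Z (q1, x) (q, x) (q2, x)"
proof
  assume "good_corner Z (q1, x) (q, x) (q2, x)"
  then obtain a b c where dist: "distinct [(q1, x), (q, x), (q2, x), a, b, c]"
    and arcs: "{((q1, x), (q, x)), ((q, x), (q2, x)), ((q2, x), a), (a, b), (b, c), (c, (q1, x))} \<subseteq> parcs Z"
    and ns: "\<not> (in_square Z (q1, x) (q, x) (q2, x) \<and> in_square Z (q, x) (q2, x) a \<and> in_square Z (q2, x) a b \<and>
        in_square Z a b c \<and> in_square Z b c (q1, x) \<and> in_square Z c (q1, x) (q, x))"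
    unfolding good_corner_def by blast
  have abc: "((q2, x), a) \<in> Xarcs \<union> Qarcs" "(a, b) \<in> Xarcs \<union> Qarcs" "(b, c) \<in> Xarcs \<union> Qarcs"
    "(c, (q1, x)) \<in> Xarcs \<union> Qarcs"
    using arcs by simp_all
  obtain a1 a2 b1 b2 c1 c2 where e: "a = (a1, a2)" "b = (b1, b2)" "c = (c1, c2)"
    by (metis surj_pair)
  have par: "p v = (\<not> p u)" if "(u, v) \<in> parcs X" for u v using p_arc that by blast
  have r: "q2 \<noteq> q1" "\<And>r. (q2, r) \<in> \<Gamma> (\<not> p x) \<Longrightarrow> (r, q1) \<notin> \<Gamma> (p x)"
    "\<And>r. (q2, r) \<in> \<Gamma> (\<not> p x) \<Longrightarrow> (r, q1) \<notin> \<Gamma> (\<not> p x)"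
    "\<And>r. (q2, r) \<in> \<Gamma> (p x) \<Longrightarrow> (r, q1) \<notin> \<Gamma> (\<not> p x)"
    using bad unfolding bad_partner_def by auto
  have 1: "(a1 = q2 \<and> p a2 = (\<not> p x)) \<or> (a2 = x \<and> (q2, a1) \<in> \<Gamma> (p x))"
    and 2: "(b1 = a1 \<and> p b2 = (\<not> p a2)) \<or> (b2 = a2 \<and> (a1, b1) \<in> \<Gamma> (p a2))"
    and 3: "(c1 = b1 \<and> p c2 = (\<not> p b2)) \<or> (c2 = b2 \<and> (b1, c1) \<in> \<Gamma> (p b2))"
    and 4: "(q1 = c1 \<and> p x = (\<not> p c2)) \<or> (x = c2 \<and> (c1, q1) \<in> \<Gamma> (p c2))"
    using abc par unfolding e Un_iff Xarcs_iff Qarcs_iff by blast+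
  have ne: "(b1, b2) \<noteq> (q2, x)" "(c1, c2) \<noteq> (a1, a2)" "(b1, b2) \<noteq> (q1, x)"
    using dist unfolding e by auto
  have "a2 = x \<and> b2 = x \<and> c2 = x \<and> (q2, a1) \<in> \<Gamma> (p x) \<and> (a1, b1) \<in> \<Gamma> (p x) \<and>
      (b1, c1) \<in> \<Gamma> (p x) \<and> (c1, q1) \<in> \<Gamma> (p x)"
    using 1 2 3 4 r ne
    by (cases "p x"; cases "p a2"; cases "p b2"; cases "p c2"; simp; blast?)
  then have all: "a = (a1, x)" "b = (b1, x)" "c = (c1, x)" "(q2, a1) \<in> \<Gamma> (p x)" "(a1, b1) \<in> \<Gamma> (p x)"
    "(b1, c1) \<in> \<Gamma> (p x)" "(c1, q1) \<in> \<Gamma> (p x)" using e by auto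
  then have "distinct [q1, q, q2, a1, b1, c1]" using dist by auto
  then have "square_at (p x) q1 q q2 \<and> square_at (p x) q q2 a1 \<and> square_at (p x) q2 a1 b1 \<and>
        square_at (p x) a1 b1 c1 \<and> square_at (p x) b1 c1 q1 \<and> square_at (p x) c1 q1 q"
    using bad all(4-7) unfolding bad_partner_def by blast
  then show False using ns square_at_lift[OF _ x] all(1-3) by blast
qed

text \<open>Every corner at an old arc is good: take a path of two old arcs, repeat it in an
  adjacent copy and join the ends. The ends have equal colours, so the same index move is available
  at both, and the mixed corners make the 6-cycle count. A new arc has a partner with which it makes
  no good corner.\<close>

lemma kinds_preserved:
  assumes disj: "\<Gamma> False \<inter> \<Gamma> True = {}"
    and deg: "\<And>x y. (x, y) \<in> parcs X \<Longrightarrow> \<exists>y'. y' \<noteq> y \<and> (x, y') \<in> parcs X"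
    and bad: "\<And>b q q1. (q, q1) \<in> \<Gamma> b \<Longrightarrow> \<exists>q2. bad_partner b q1 q q2"
    and f: "f \<in> graph_aut Z"
  shows "e \<in> Xarcs \<Longrightarrow> map_prod f f e \<in> Xarcs" "e \<in> Qarcs \<Longrightarrow> map_prod f f e \<in> Qarcs"
proof -
  define \<Phi> where "\<Phi> v w \<longleftrightarrow> (\<exists>w'. (v, w') \<in> parcs Z \<and> w' \<noteq> w \<and> \<not> good_corner Z w v w')" for v w
  have \<Phi>_imp: "\<Phi> (f v) (f w)" if f: "f \<in> graph_aut Z" and "\<Phi> v w" for f v w
  proof -
    obtain w' where "(v, w') \<in> parcs Z" "w' \<noteq> w" "\<not> good_corner Z w v w'"
      using \<open>\<Phi> v w\<close> unfolding \<Phi>_def by blast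
    then show ?thesis unfolding \<Phi>_def
      using graph_aut_arc_iff[OF Z_graph f] good_corner_aut[OF Z_graph f] inj_eq[OF graph_autD(2)[OF f]]
      by (intro exI[of _ "f w'"]) simp
  qed
  have \<Phi>: "\<Phi> (f v) (f w) \<longleftrightarrow> \<Phi> v w" if "f \<in> graph_aut Z" for f v w
    using graph_aut_iffI[OF that, of "\<lambda>u v w. \<Phi> v w"] \<Phi>_imp by blast
  have Q: "\<Phi> v w" if "(v, w) \<in> Qarcs" for v w
  proof -
    obtain q q1 x where x: "v = (q, x)" "w = (q1, x)" "x \<in> pverts X" "(q, q1) \<in> \<Gamma> (p x)"
      using \<open>(v, w) \<in> Qarcs\<close> by (auto simp: Qarcs_def)
    obtain q2 where q2: "bad_partner (p x) q1 q q2" using bad[OF x(4)] by blast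
    then show ?thesis
      unfolding \<Phi>_def using bad_partner_not_good[OF x(3,4) q2] x
      by (intro exI[of _ "(q2, x)"]) (auto simp: bad_partner_def)
  qed
  have "\<not> \<Phi> v w" if "(v, w) \<in> Xarcs" for v w
  proof -
    obtain q x y where x: "v = (q, x)" "w = (q, y)" "q \<in> Q" "(x, y) \<in> parcs X"
      using \<open>(v, w) \<in> Xarcs\<close> by (auto simp: Xarcs_def)
    note pxy = p_arc[OF x(4)] and V = XD(8,9)[OF x(4)] and yx = XD(10)[OF x(4)]
    have "good_corner Z w v w'" if w': "(v, w') \<in> parcs Z" "w' \<noteq> w" for w'
    proof -
      consider y' where "w' = (q, y')" "y' \<noteq> y" "(x, y') \<in> parcs X"
        | q' where "w' = (q', x)" "(q, q') \<in> \<Gamma> (p x)"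
        using w' x by (cases w') auto
      then show ?thesis
      proof cases
        case 1
        note py' = p_arc[OF 1(3)] and V' = XD(9)[OF 1(3)] and y'x = XD(10)[OF 1(3)]
        \<comment> \<open>The path \<open>y\<close>, \<open>x\<close>, \<open>y'\<close> in two
          copies, joined at \<open>y\<close> and \<open>y'\<close>.\<close>
        obtain q' where q': "(q, q') \<in> \<Gamma> (p y')" using \<Gamma>_ex[OF x(3)] by blast
        have ne: "q' \<noteq> q" "x \<noteq> y" "x \<noteq> y'" using \<Gamma>_irrefl q' XD(11) x(4) 1(3) by blast+
        have "\<not> in_square Z v w' (q', y')"
          using mixed_not_square(1)[OF disj y'x q'] x(1) 1(1) by simp
        then show ?thesis
          unfolding good_corner_def
          by (intro exI[of _ "(q', y')"] exI[of _ "(q', x)"] exI[of _ "(q', y)"])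
            (use x 1 q' ne pxy py' V V' yx y'x \<Gamma>_sym[OF q'] \<Gamma>_sub[OF q'] in auto)
      next
        case 2
        \<comment> \<open>The path \<open>x\<close>, \<open>y\<close>, \<open>z\<close> in two
          copies, joined at \<open>x\<close> and \<open>z\<close>. Here a second neighbour of
          \<open>y\<close> is required.\<close>
        obtain z where z: "z \<noteq> x" "(y, z) \<in> parcs X" using deg[OF yx] by blast
        note pz = p_arc[OF z(2)] and zy = XD(10)[OF z(2)]
        have ne: "q' \<noteq> q" "x \<noteq> y" "z \<noteq> y" using \<Gamma>_irrefl 2(2) XD(11) x(4) z(2) by blast+
        have "\<not> in_square Z w v w'"
          using mixed_not_square(1)[OF disj x(4) 2(2)] x 2 by simp
        then show ?thesis
          unfolding good_corner_def
          by (intro exI[of _ "(q', y)"] exI[of _ "(q', z)"] exI[of _ "(q, z)"])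
            (use x 2 z ne pxy pz V zy yx XD(9)[OF z(2)] \<Gamma>_sym[OF 2(2)] \<Gamma>_sub[OF 2(2)] in auto)
      qed
    qed
    then show ?thesis unfolding \<Phi>_def by blast
  qed
  then show "e \<in> Xarcs \<Longrightarrow> map_prod f f e \<in> Xarcs" "e \<in> Qarcs \<Longrightarrow> map_prod f f e \<in> Qarcs"
    using Xarcs_preservedI[where \<Phi> = \<Phi>, OF \<Phi> Q _ f] by blast+
qed

end

section \<open>Arc-transitive graphs and the single edge\<close>

lemma arc_type_arc_transitive:
  assumes X: "vtg X" and t: "\<And>e e'. e \<in> parcs X \<Longrightarrow> e' \<in> parcs X \<Longrightarrow> \<exists>f \<in> graph_aut X. map_prod f f e = e'"
    and v: "v \<in> pverts X" "card {w. (v, w) \<in> parcs X} = n"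
  shows "arc_type X = ({#n#}, {#})"
proof -
  note D = vtgD[OF X]
  have "parcs X \<in> arc_orbits X"
    by (rule arc_orbitsI) (use t D(3) graph_aut_arcs[OF D(1)] in auto)
  then have o: "arc_orbits X = {parcs X}"
    by (intro arc_orbits_eqI[OF _ _ D(1)]) auto
  have "(parcs X)\<inverse> = parcs X" using D(10) by auto
  moreover have "orbit_valency X (parcs X) = n"
    using orbit_valency_card[OF X _ v(1)] v(2) o by simp
  ultimately show ?thesis unfolding arc_type_family o by (simp add: family_type_selfpaired)
qed

lemma vtg_move: "vtg X \<Longrightarrow> u \<in> pverts X \<Longrightarrow> v \<in> pverts X \<Longrightarrow> \<exists>f \<in> graph_aut X. f u = v"
  unfolding vtg_def vertex_transitive_def by blast

lemma vtg_arc_ex: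
  assumes X: "vtg X" and x: "x \<in> pverts X"
  shows "\<exists>y. (x, y) \<in> parcs X"
proof -
  note D = vtgD[OF X]
  obtain u v where uv: "(u, v) \<in> parcs X" using D(3) by auto
  obtain f where f: "f \<in> graph_aut X" "f u = x" using vtg_move[OF X D(8)[OF uv] x] by blast
  then have "(x, f v) \<in> parcs X" using graph_aut_arc_iff[OF D(1) f(1)] uv by auto
  then show ?thesis by blast
qed

lemma graph_aut_inverse: "f \<in> graph_aut X \<Longrightarrow> f (inv f v) = v"
  unfolding graph_aut_def by (auto simp: permutes_inverses)

definition K2 :: "bool pair_pre_digraph" where
  "K2 = \<lparr>pverts = UNIV, parcs = {(a, b). a \<noteq> b}\<rparr>"

lemma K2_simps [simp]: "pverts K2 = UNIV" "(a, b) \<in> parcs K2 \<longleftrightarrow> a \<noteq> b"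
  by (simp_all add: K2_def)

lemma K2_aut: "(\<lambda>a. a \<noteq> s) \<in> graph_aut K2"
proof -
  have "pair_graph K2" by (rule pair_graphI) (auto simp: sym_def irrefl_def)
  then have "(\<lambda>v. if v \<in> pverts K2 then v \<noteq> s else v) \<in> graph_aut K2"
    by (rule graph_autI) (auto intro: inj_onI)
  then show ?thesis by simp
qed

lemma K2_vtg: "vtg K2"
proof (rule vtgI)
  show "pair_graph K2" by (rule pair_graphI) (auto simp: sym_def irrefl_def)
  show "parcs K2 \<noteq> {}" by (auto simp: K2_def)
  show "\<exists>f\<in>graph_aut K2. f u = v" for u v
    by (rule bexI[OF _ K2_aut[of "u \<noteq> v"]]) auto
  show "(False, v) \<in> (parcs K2)\<^sup>*" for v
    by (cases v) (auto intro: r_into_rtrancl)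
qed

lemma K2_bipartition: "bipartition K2 id"
  by (auto simp: bipartition_def)

lemma K2_type: "arc_type K2 = ({#1#}, {#})"
proof (rule arc_type_arc_transitive[OF K2_vtg])
  show "\<exists>f\<in>graph_aut K2. map_prod f f e = e'" if "e \<in> parcs K2" "e' \<in> parcs K2" for e e'
    by (rule bexI[OF _ K2_aut[of "fst e \<noteq> fst e'"]]) (use that in \<open>cases e; cases e'; auto\<close>)
  have "{w. (False, w) \<in> parcs K2} = {True}" by auto
  then show "card {w. (False, w) \<in> parcs K2} = 1" by simp
qed simp

section \<open>Prisms\<close>

definition flips :: "(bool \<times> bool) set" where
  "flips = {(a, b). a \<noteq> b}"

lemma flips_iff [simp]: "(a, b) \<in> flips \<longleftrightarrow> a \<noteq> b"
  by (simp add: flips_def)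

text \<open>In a prism a rung forms a 4-cycle with every other arc at its end, while an old arc has
  a partner with which it forms none, since \<open>X\<close> is \<open>unsquared\<close>. Both
  structures equal \<open>flips\<close> here, so they are not disjoint and the result is
  \<open>squared\<close>.\<close>

lemma realized_prism:
  assumes X: "vtg X" and p: "bipartition X p" and u: "unsquared X"
  shows "realized (arc_type X + ({#1#}, {#}))"
proof -
  interpret twisted X p "UNIV :: bool set" "\<lambda>_. flips"
  proof
    show "\<exists>\<alpha>. \<alpha> ` UNIV \<subseteq> UNIV \<and> inj_on \<alpha> UNIV \<and>
        (\<forall>(b::bool) u v. (u, v) \<in> flips \<longrightarrow> (\<alpha> u, \<alpha> v) \<in> flips) \<and> \<alpha> q = q'" for q q' :: bool
      by (rule exI[of _ "\<lambda>a. a \<noteq> (q \<noteq> q')"]) (auto simp: flips_def intro: inj_onI)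
    show "\<exists>\<tau> :: bool \<Rightarrow> bool. \<tau> ` UNIV \<subseteq> UNIV \<and> inj_on \<tau> UNIV \<and>
        (\<forall>(b::bool) u v. (u, v) \<in> flips \<longrightarrow> (\<tau> u, \<tau> v) \<in> flips)"
      by (rule exI[of _ id]) auto
    show "(q, q') \<in> (flips \<union> flips)\<^sup>*" for q q' :: bool
      by (cases "q = q'") (auto simp: flips_def intro: r_into_rtrancl)
    show "\<exists>q'. (q, q') \<in> flips" for q :: bool by (auto simp: flips_def)
  qed (use X p in \<open>auto simp: flips_def\<close>)
  define \<Phi> where "\<Phi> v w \<longleftrightarrow> (\<forall>w'. (v, w') \<in> parcs Z \<longrightarrow> w' \<noteq> w \<longrightarrow> in_square Z w v w')" for v w
  have \<Phi>_imp: "\<Phi> (f v) (f w)" if f: "f \<in> graph_aut Z" and vw: "\<Phi> v w" for f v w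
    unfolding \<Phi>_def
  proof (intro allI impI)
    fix w' assume w': "(f v, w') \<in> parcs Z" "w' \<noteq> f w"
    have "w' = f (inv f w')"
      using graph_aut_inverse[OF f] by simp
    then have "in_square Z w v (inv f w')"
      using vw w' graph_aut_arc_iff[OF Z_graph f] unfolding \<Phi>_def by metis
    then show "in_square Z (f w) (f v) w'"
      using \<open>w' = f (inv f w')\<close> in_square_aut[OF Z_graph f] by metis
  qed
  have \<Phi>: "\<Phi> (f v) (f w) \<longleftrightarrow> \<Phi> v w" if "f \<in> graph_aut Z" for f v w
    using graph_aut_iffI[OF that, of "\<lambda>u v w. \<Phi> v w"] \<Phi>_imp by blast
  have 1: "\<Phi> v w" if vw: "(v, w) \<in> Qarcs" for v w
    unfolding \<Phi>_def
  proof (intro allI impI)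
    fix w' assume w': "(v, w') \<in> parcs Z" "w' \<noteq> w"
    obtain q q' x where x: "v = (q, x)" "w = (q', x)" "x \<in> pverts X" "q \<noteq> q'"
      using vw by (auto simp: Qarcs_def)
    then obtain y where y: "w' = (q, y)" "(x, y) \<in> parcs X" using w' by (cases w') auto
    then have "((q', x), (q', y)) \<in> parcs Z" "((q', y), (q, y)) \<in> parcs Z" "(q', y) \<noteq> (q, x)"
      using x(4) XD(9)[OF y(2)] by auto
    then show "in_square Z w v w'" unfolding in_square_def x(1,2) y(1) by blast
  qed
  have 2: "\<not> \<Phi> v w" if "(v, w) \<in> Xarcs" for v w
  proof -
    obtain q x y where x: "v = (q, x)" "w = (q, y)" "(x, y) \<in> parcs X"
      using \<open>(v, w) \<in> Xarcs\<close> by (auto simp: Xarcs_def)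
    obtain y' where y': "(x, y') \<in> parcs X" "y' \<noteq> y" "\<not> in_square X y x y'"
      using u x(3) unfolding unsquared_def by blast
    \<comment> \<open>No new 4-cycle arises: from \<open>(q, y)\<close> the other layer is reached
      only at \<open>y\<close>, and that vertex leads back only to \<open>(q, y)\<close>.\<close>
    have "\<not> in_square Z (q, y) (q, x) (q, y')"
      using y'(2,3) unfolding in_square_def by auto
    then show ?thesis unfolding \<Phi>_def using x y' by auto
  qed
  have presX: "map_prod f f e \<in> Xarcs" if "f \<in> graph_aut Z" "e \<in> Xarcs" for f e
    using \<Phi> 1 2 that Xarcs_preservedI(1)[where \<Phi> = \<Phi>] by blast
  have presQ: "map_prod f f e \<in> Qarcs" if "f \<in> graph_aut Z" "e \<in> Qarcs" for f e
    using \<Phi> 1 2 that Xarcs_preservedI(2)[where \<Phi> = \<Phi>] by blast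
  note pres = presX presQ
  have fX: "fibration X Z UNIV Pair" by (rule X_fibration[OF pres(1)])
  have fK: "fibration K2 Z (pverts X) (\<lambda>x q. (q, x))"
  proof
    show "vtg K2" "vtg Z" by (fact K2_vtg Z_vtg)+
    show "pverts X \<noteq> {}" by (fact XD(4))
    show "\<exists>j\<in>pverts X. \<exists>x' y'. (x', y') \<in> parcs K2 \<and> f (x, i) = (x', j) \<and> f (y, i) = (y', j)"
      if "f \<in> graph_aut Z" "i \<in> pverts X" "(x, y) \<in> parcs K2" for f i x y
      using pres(2)[OF that(1), of "((x, i), (y, i))"] that(2,3) by (auto simp: Qarcs_def)
    show "\<exists>f\<in>graph_aut Z. \<forall>x\<in>pverts K2. f (x, i) = (g x, j)"
      if "g \<in> graph_aut K2" "i \<in> pverts X" "j \<in> pverts X" for g i j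
    proof -
      obtain h where h: "h \<in> graph_aut X" "h i = j"
        using XD(2) \<open>i \<in> _\<close> \<open>j \<in> _\<close> unfolding vertex_transitive_def by blast
      obtain s where s: "\<And>x. x \<in> pverts X \<Longrightarrow> p (h x) = (p x \<noteq> s)"
        using bipartition_aut[OF X p h(1)] by blast
      have "\<exists>f \<in> graph_aut Z. \<forall>q \<in> UNIV. \<forall>x \<in> pverts X. f (q, x) = (g q, h x)"
        by (rule product_aut[OF h(1) s])
          (use graph_autD(2)[OF that(1)] in \<open>auto simp: inj_eq\<close>)
      then show ?thesis using h(2) that(2) by auto
    qed
  qed auto
  have "Xarcs \<union> Qarcs = parcs Z" "Xarcs \<inter> Qarcs = {}" using Xarcs_Qarcs by auto
  moreover have "fibration.lift UNIV Pair (parcs X) = Xarcs"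
    unfolding fibration.lift_def[OF fX] Xarcs_def by auto
  moreover have "fibration.lift (pverts X) (\<lambda>x q. (q, x)) (parcs K2) = Qarcs"
    unfolding fibration.lift_def[OF fK] Qarcs_def by auto
  ultimately have "arc_type Z = arc_type X + arc_type K2"
    using arc_type_two_fibrations[OF fX fK] by simp
  moreover have "squared Z"
    unfolding squared_def
  proof (intro ballI, clarify)
    fix q x q' x' assume "((q, x), (q', x')) \<in> parcs Z"
    then consider "q' = q" "(x, x') \<in> parcs X" | "x' = x" "x \<in> pverts X" "q' \<noteq> q" by auto
    then show "\<exists>w'. ((q, x), w') \<in> parcs Z \<and> w' \<noteq> (q', x') \<and> in_square Z (q', x') (q, x) w'"
    proof cases
      case 1
      show ?thesis
        unfolding in_square_def using 1 XD(8,9)[OF 1(2)] XD(10)[OF 1(2)]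
        by (intro exI[of _ "(\<not> q, x)"] exI[of _ "(\<not> q, x')"] conjI) auto
    next
      case 2
      obtain y where y: "(x, y) \<in> parcs X" using X_arc_ex 2 by blast
      show ?thesis
        unfolding in_square_def using 2 y XD(8,9)[OF y]
        by (intro exI[of _ "(q, y)"] exI[of _ "(q', y)"] conjI) auto
    qed
  qed
  ultimately show ?thesis
    using realizedI[OF Z_vtg Z_bipartition[of id]] K2_type by simp
qed

section \<open>Parity lamplighters\<close>

text \<open>
  The index is a pair of vertices of \<open>Y\<close>; one colour class of \<open>X\<close> moves its first and the
  other its second component.
\<close>

definition slot :: "bool \<Rightarrow> 'b \<Rightarrow> 'b \<Rightarrow> 'b \<times> 'b" where
  "slot b y r = (if b then (r, y) else (y, r))"

lemma slot_inj [simp]: "slot b y r = slot b y' r' \<longleftrightarrow> y = y' \<and> r = r'"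
  by (auto simp: slot_def)

lemma slot_not: "slot (\<not> b) y r = slot b r y"
  by (simp add: slot_def)

lemma slot_ex: "\<exists>y r. q = slot b y r"
  by (cases q; cases b) (auto simp: slot_def)

text \<open>In \<open>slot b y r\<close> the component \<open>y\<close> moves and \<open>r\<close>
  rests; this form treats both colours uniformly.\<close>

definition lamp :: "'b pair_pre_digraph \<Rightarrow> bool \<Rightarrow> (('b \<times> 'b) \<times> ('b \<times> 'b)) set" where
  "lamp Y b = {(slot b y r, slot b y' r) | y y' r. (y, y') \<in> parcs Y \<and> r \<in> pverts Y}"

lemma lamp_iff: "(slot b y r, q) \<in> lamp Y b \<longleftrightarrow> r \<in> pverts Y \<and> (\<exists>y'. (y, y') \<in> parcs Y \<and> q = slot b y' r)"
  unfolding lamp_def by auto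

lemma lamp_not_iff:
  "(slot b y r, q) \<in> lamp Y (\<not> b) \<longleftrightarrow> y \<in> pverts Y \<and> (\<exists>r'. (r, r') \<in> parcs Y \<and> q = slot b y r')"
  using lamp_iff[of "\<not> b" r y q Y] by (simp add: slot_not)

locale lamplighter =
  fixes X :: "'a pair_pre_digraph" and p :: "'a \<Rightarrow> bool"
    and Y :: "'b pair_pre_digraph" and pY :: "'b \<Rightarrow> bool"
  assumes lX: "vtg X" "bipartition X p" and lY: "vtg Y" "bipartition Y pY"
begin

lemmas YD = vtgD[OF lY(1)]

lemma slot_mem: "slot b y r \<in> pverts Y \<times> pverts Y \<longleftrightarrow> y \<in> pverts Y \<and> r \<in> pverts Y"
  by (auto simp: slot_def)

lemma slot_map: "map_prod f g (slot b y r) = (if b then slot b (g y) (f r) else slot b (f y) (g r))"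
  by (simp add: slot_def)

sublocale twisted X p "pverts Y \<times> pverts Y" "lamp Y"
proof
  show "vtg X" "bipartition X p" by (fact lX)+
  show "finite (pverts Y \<times> pverts Y)" "pverts Y \<times> pverts Y \<noteq> {}" using YD(4,6) by auto
  show "q \<in> pverts Y \<times> pverts Y \<and> q' \<in> pverts Y \<times> pverts Y" if "(q, q') \<in> lamp Y b" for q q' b
    using that YD(8,9) unfolding lamp_def by (auto simp: slot_def)
  show "(q', q) \<in> lamp Y b" if "(q, q') \<in> lamp Y b" for q q' b
    using that YD(10) unfolding lamp_def by blast
  show "(q, q) \<notin> lamp Y b" for q b
    using YD(11) unfolding lamp_def by auto
  show "\<exists>q'. (q, q') \<in> lamp Y b" if "q \<in> pverts Y \<times> pverts Y" for q b
  proof -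
    obtain y r where q: "q = slot b y r" using slot_ex[of q b] by blast
    have "y \<in> pverts Y" "r \<in> pverts Y" using slot_mem[of b y r] \<open>q \<in> _\<close> q by auto
    then show ?thesis using vtg_arc_ex[OF lY(1)] lamp_iff q by metis
  qed
  show "\<exists>\<alpha>. \<alpha> ` (pverts Y \<times> pverts Y) \<subseteq> pverts Y \<times> pverts Y \<and> inj_on \<alpha> (pverts Y \<times> pverts Y) \<and>
      (\<forall>b u v. (u, v) \<in> lamp Y b \<longrightarrow> (\<alpha> u, \<alpha> v) \<in> lamp Y b) \<and> \<alpha> q = q'"
    if q: "q \<in> pverts Y \<times> pverts Y" "q' \<in> pverts Y \<times> pverts Y" for q q'
  proof -
    obtain f where f: "f \<in> graph_aut Y" "f (fst q) = fst q'"
      using YD(2) q unfolding vertex_transitive_def by (auto simp: mem_Times_iff)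
    obtain g where g: "g \<in> graph_aut Y" "g (snd q) = snd q'"
      using YD(2) q unfolding vertex_transitive_def by (auto simp: mem_Times_iff)
    have 1: "(map_prod f g u, map_prod f g v) \<in> lamp Y b" if uv: "(u, v) \<in> lamp Y b" for b u v
    proof -
      obtain y y' r where y: "u = slot b y r" "v = slot b y' r" "(y, y') \<in> parcs Y" "r \<in> pverts Y"
        using uv unfolding lamp_def by blast
      show ?thesis
        using y graph_aut_arc_iff[OF YD(1) f(1)] graph_aut_arc_iff[OF YD(1) g(1)] graph_autD(1)[OF f(1)]
          graph_autD(1)[OF g(1)] by (auto simp: slot_map lamp_iff)
    qed
    have 2: "inj_on (map_prod f g) (pverts Y \<times> pverts Y)"
      by (auto intro!: inj_onI
          simp: inj_eq[OF graph_autD(2)[OF f(1)]] inj_eq[OF graph_autD(2)[OF g(1)]])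
    have 3: "map_prod f g ` (pverts Y \<times> pverts Y) \<subseteq> pverts Y \<times> pverts Y"
      using graph_autD(1)[OF f(1)] graph_autD(1)[OF g(1)] by auto
    have "map_prod f g q = q'" using f(2) g(2) by (cases q; cases q') simp
    then show ?thesis using 1 2 3 by blast
  qed
  show "\<exists>\<tau>. \<tau> ` (pverts Y \<times> pverts Y) \<subseteq> pverts Y \<times> pverts Y \<and> inj_on \<tau> (pverts Y \<times> pverts Y) \<and>
      (\<forall>b u v. (u, v) \<in> lamp Y b \<longrightarrow> (\<tau> u, \<tau> v) \<in> lamp Y (\<not> b))"
    by (rule exI[of _ prod.swap]) (auto simp: lamp_def slot_def inj_on_def)
  show "(q, q') \<in> (lamp Y False \<union> lamp Y True)\<^sup>*"
    if q: "q \<in> pverts Y \<times> pverts Y" "q' \<in> pverts Y \<times> pverts Y" for q q'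
  proof -
    have step: "(slot b y r, slot b y' r) \<in> (lamp Y False \<union> lamp Y True)\<^sup>*"
      if "y \<in> pverts Y" "y' \<in> pverts Y" "r \<in> pverts Y" for b y y' r
    proof -
      have "(y, y') \<in> (parcs Y)\<^sup>*" using YD(5) that by blast
      then show ?thesis
      proof induction
        case (step u v)
        then have "(slot b u r, slot b v r) \<in> lamp Y b" using that by (auto simp: lamp_iff)
        then have "(slot b u r, slot b v r) \<in> lamp Y False \<union> lamp Y True" by (cases b) auto
        with step.IH show ?case by (rule rtrancl_into_rtrancl)
      qed simp
    qed
    obtain a b a' b' where e: "q = (a, b)" "q' = (a', b')" by (cases q; cases q')
    have "((a, b), (a', b)) \<in> (lamp Y False \<union> lamp Y True)\<^sup>*"
      using step[of a a' b False] q e by (auto simp: slot_def)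
    moreover have "((a', b), (a', b')) \<in> (lamp Y False \<union> lamp Y True)\<^sup>*"
      using step[of b b' a' True] q e by (auto simp: slot_def)
    ultimately show ?thesis using e by (auto intro: rtrancl_trans)
  qed
qed

lemma lamp_disjoint: "lamp Y False \<inter> lamp Y True = {}"
  using YD(11) by (auto simp: lamp_def slot_def)

text \<open>\<open>g\<close> acts on the component moved at colour \<open>b\<close>,
  \<open>k\<close> on the resting one, and \<open>s\<close> exchanges the components. This suffices
  to carry one copy of \<open>Y\<close> to another by any prescribed \<open>g\<close>.\<close>

lemma lamp_swap_aut:
  assumes "g \<in> graph_aut Y" "k \<in> graph_aut Y"
  defines "\<alpha> \<equiv> \<lambda>b s q. (if s then prod.swap else id) ((if b then map_prod k g else map_prod g k) q)"
  shows "\<alpha> b s ` (pverts Y \<times> pverts Y) \<subseteq> pverts Y \<times> pverts Y" "inj_on (\<alpha> b s) (pverts Y \<times> pverts Y)"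
    "\<And>c u v. (u, v) \<in> lamp Y c \<Longrightarrow> (\<alpha> b s u, \<alpha> b s v) \<in> lamp Y (c \<noteq> s)"
    "\<alpha> b s (slot b y r) = slot (b \<noteq> s) (g y) (k r)"
proof -
  note G = graph_autD(1)[OF assms(1)] graph_autD(1)[OF assms(2)]
    inj_eq[OF graph_autD(2)[OF assms(1)]] inj_eq[OF graph_autD(2)[OF assms(2)]]
    graph_aut_arc_iff[OF YD(1) assms(1)] graph_aut_arc_iff[OF YD(1) assms(2)]
  show "\<alpha> b s ` (pverts Y \<times> pverts Y) \<subseteq> pverts Y \<times> pverts Y" using G by (auto simp: \<alpha>_def)
  show "inj_on (\<alpha> b s) (pverts Y \<times> pverts Y)"
    using G by (cases b; cases s) (auto simp: \<alpha>_def intro!: inj_onI)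
  show "(\<alpha> b s u, \<alpha> b s v) \<in> lamp Y (c \<noteq> s)" if "(u, v) \<in> lamp Y c" for c u v
  proof -
    obtain y y' r where y: "u = slot c y r" "v = slot c y' r" "(y, y') \<in> parcs Y" "r \<in> pverts Y"
      using \<open>(u, v) \<in> lamp Y c\<close> unfolding lamp_def by blast
    show ?thesis using y G
      by (cases b; cases s; cases c) (auto simp: \<alpha>_def lamp_def slot_def)
  qed
  show "\<alpha> b s (slot b y r) = slot (b \<noteq> s) (g y) (k r)"
    by (cases b; cases s) (auto simp: \<alpha>_def slot_def)
qed

text \<open>Fixing a vertex \<open>x\<close> of \<open>X\<close> and a resting component
  \<open>r\<close> leaves one copy of \<open>Y\<close>; these copies cover exactly the new
  arcs.\<close>

theorem lamplighter_type:
  assumes pres: "\<And>f e. f \<in> graph_aut Z \<Longrightarrow> e \<in> Xarcs \<Longrightarrow> map_prod f f e \<in> Xarcs"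
    "\<And>f e. f \<in> graph_aut Z \<Longrightarrow> e \<in> Qarcs \<Longrightarrow> map_prod f f e \<in> Qarcs"
  shows "realized (arc_type X + arc_type Y)"
proof -
  let ?\<psi> = "\<lambda>i y. (slot (p (fst i)) y (snd i), fst i)"
  have Q: "Qarcs = {(?\<psi> i y, ?\<psi> i y') | i y y'. i \<in> pverts X \<times> pverts Y \<and> (y, y') \<in> parcs Y}"
  proof (intro equalityI subsetI)
    fix e assume "e \<in> Qarcs"
    then obtain x y y' r where "e = ((slot (p x) y r, x), (slot (p x) y' r, x))" "x \<in> pverts X"
      "r \<in> pverts Y" "(y, y') \<in> parcs Y"
      unfolding Qarcs_def lamp_def by blast
    then show "e \<in> {(?\<psi> i y, ?\<psi> i y') | i y y'. i \<in> pverts X \<times> pverts Y \<and> (y, y') \<in> parcs Y}"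
      by (intro CollectI exI[of _ "(x, r)"] exI[of _ y] exI[of _ y']) simp
  next
    fix e assume "e \<in> {(?\<psi> i y, ?\<psi> i y') | i y y'. i \<in> pverts X \<times> pverts Y \<and> (y, y') \<in> parcs Y}"
    then show "e \<in> Qarcs" by (auto simp: lamp_iff)
  qed
  have fX: "fibration X Z (pverts Y \<times> pverts Y) Pair" by (rule X_fibration[OF pres(1)])
  have fY: "fibration Y Z (pverts X \<times> pverts Y) ?\<psi>"
  proof
    show "vtg Y" "vtg Z" by (fact lY Z_vtg)+
    show "pverts X \<times> pverts Y \<noteq> {}" using XD(4) YD(4) by auto
    show "\<exists>i\<in>pverts X \<times> pverts Y. \<exists>y\<in>pverts Y. z = ?\<psi> i y" if z: "z \<in> pverts Z" for z
    proof -
      obtain q x where "z = (q, x)" by (cases z)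
      moreover obtain y r where "q = slot (p x) y r" using slot_ex[of q "p x"] by blast
      ultimately show ?thesis using z slot_mem by auto
    qed
    show "?\<psi> i y \<in> pverts Z" if "i \<in> pverts X \<times> pverts Y" "y \<in> pverts Y" for i y
      using that slot_mem by auto
    show "(?\<psi> i y, ?\<psi> i y') \<in> parcs Z" if "i \<in> pverts X \<times> pverts Y" "(y, y') \<in> parcs Y" for i y y'
      using that Q by auto
    show "\<exists>j\<in>pverts X \<times> pverts Y. \<exists>x' y'. (x', y') \<in> parcs Y \<and> f (?\<psi> i x) = ?\<psi> j x' \<and> f (?\<psi> i y) = ?\<psi> j y'"
      if "f \<in> graph_aut Z" "i \<in> pverts X \<times> pverts Y" "(x, y) \<in> parcs Y" for f i x y
    proof -
      have "(?\<psi> i x, ?\<psi> i y) \<in> Qarcs" using that(2,3) unfolding Q by blast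
      then have "(f (?\<psi> i x), f (?\<psi> i y)) \<in> Qarcs" using pres(2)[OF that(1)] by (metis map_prod_simp)
      then show ?thesis unfolding Q by blast
    qed
    show "\<exists>f\<in>graph_aut Z. \<forall>y\<in>pverts Y. f (?\<psi> i y) = ?\<psi> j (g y)"
      if g: "g \<in> graph_aut Y" and ij: "i \<in> pverts X \<times> pverts Y" "j \<in> pverts X \<times> pverts Y" for g i j
    proof -
      obtain x r x' r' where e: "i = (x, r)" "j = (x', r')" "x \<in> pverts X" "r \<in> pverts Y"
        "x' \<in> pverts X" "r' \<in> pverts Y" using ij by auto
      obtain h where h: "h \<in> graph_aut X" "h x = x'"
        using XD(2) e unfolding vertex_transitive_def by blast
      obtain k where k: "k \<in> graph_aut Y" "k r = r'"
        using YD(2) e unfolding vertex_transitive_def by blast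
      obtain s where s: "\<And>x. x \<in> pverts X \<Longrightarrow> p (h x) = (p x \<noteq> s)"
        using bipartition_aut[OF lX h(1)] by blast
      obtain f where f: "f \<in> graph_aut Z" "\<And>q x'. q \<in> pverts Y \<times> pverts Y \<Longrightarrow> x' \<in> pverts X \<Longrightarrow>
          f (q, x') = ((if s then prod.swap else id) ((if p x then map_prod k g else map_prod g k) q), h x')"
        using product_aut[OF h(1) s lamp_swap_aut(1-3)[OF g k(1)], of "p x"] by blast
      have "f (?\<psi> i y) = ?\<psi> j (g y)" if "y \<in> pverts Y" for y
        using f(2)[of "slot (p x) y r" x] lamp_swap_aut(4)[OF g k(1), of s "p x" y r] s[OF e(3)]
          e h(2) k(2) that slot_mem by auto
      then show ?thesis using f(1) by blast
    qed
  qed auto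
  have "Xarcs \<union> Qarcs = parcs Z" "Xarcs \<inter> Qarcs = {}" using Xarcs_Qarcs by auto
  moreover have "fibration.lift (pverts Y \<times> pverts Y) Pair (parcs X) = Xarcs"
    unfolding fibration.lift_def[OF fX] Xarcs_def by auto
  moreover have "fibration.lift (pverts X \<times> pverts Y) ?\<psi> (parcs Y) = Qarcs"
    unfolding fibration.lift_def[OF fY] Q ..
  ultimately have "arc_type Z = arc_type X + arc_type Y"
    using arc_type_two_fibrations[OF fX fY] by simp
  moreover have bip: "bipartition Z (\<lambda>(q, x). (pY (fst q) \<noteq> pY (snd q)) \<noteq> p x)"
  proof (rule Z_bipartition)
    fix b u v assume "(u, v) \<in> lamp Y b"
    then obtain y y' r where y: "u = slot b y r" "v = slot b y' r" "(y, y') \<in> parcs Y"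
      unfolding lamp_def by blast
    have "pY y \<noteq> pY y'" using lY(2) y(3) unfolding bipartition_def by blast
    then show "(pY (fst u) \<noteq> pY (snd u)) \<noteq> (pY (fst v) \<noteq> pY (snd v))"
      unfolding y by (auto simp: slot_def)
  qed
  ultimately show ?thesis
    using realizedI[OF Z_vtg bip disjI1[OF Z_unsquared[OF lamp_disjoint]]] by simp
qed

text \<open>A single move of the resting component cannot return to \<open>r\<close>, and two such
  moves do not take \<open>y2\<close> to \<open>y1\<close>. A 6-cycle that only moves the active
  component is a 6-cycle of \<open>Y\<close>.\<close>

lemma lamp_bad_partner:
  assumes "\<And>y y1. (y, y1) \<in> parcs Y \<Longrightarrow> \<exists>y2. (y, y2) \<in> parcs Y \<and> y2 \<noteq> y1 \<and> \<not> good_corner Y y1 y y2"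
    and "(q, q1) \<in> lamp Y b"
  shows "\<exists>q2. bad_partner b q1 q q2"
proof -
  obtain y y1 r where y: "q = slot b y r" "q1 = slot b y1 r" "(y, y1) \<in> parcs Y" "r \<in> pverts Y"
    using assms(2) unfolding lamp_def by blast
  obtain y2 where y2: "(y, y2) \<in> parcs Y" "y2 \<noteq> y1" "\<not> good_corner Y y1 y y2"
    using assms(1)[OF y(3)] by blast
  have sq: "square_at b (slot b u r) (slot b v r) (slot b w r)" if "in_square Y u v w" for u v w
  proof -
    obtain z where "z \<noteq> v" "(u, z) \<in> parcs Y" "(z, w) \<in> parcs Y"
      using \<open>in_square Y u v w\<close> unfolding in_square_def by blast
    then show ?thesis unfolding square_at_def
      using y(4) by (intro exI[of _ "slot b z r"]) (auto simp: lamp_iff)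
  qed
  have "bad_partner b q1 q (slot b y2 r)"
    unfolding bad_partner_def
  proof (intro conjI allI impI)
    show "slot b y2 r \<noteq> q1" "(q, slot b y2 r) \<in> lamp Y b" using y y2 by (auto simp: lamp_iff)
    fix t
    show "(t, q1) \<notin> lamp Y b \<union> lamp Y (\<not> b)" if "(slot b y2 r, t) \<in> lamp Y (\<not> b)"
      using that y y2(2) YD(11) by (auto simp: lamp_iff lamp_not_iff)
    show "(t, q1) \<notin> lamp Y (\<not> b)" if "(slot b y2 r, t) \<in> lamp Y b"
      using that y y2(2) YD(11) by (auto simp: lamp_iff lamp_not_iff)
  next
    fix a c d
    assume dist: "distinct [q1, q, slot b y2 r, a, c, d]"
      and arcs: "{(slot b y2 r, a), (a, c), (c, d), (d, q1)} \<subseteq> lamp Y b"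
    obtain a' c' d' where e: "a = slot b a' r" "c = slot b c' r" "d = slot b d' r"
      "(y2, a') \<in> parcs Y" "(a', c') \<in> parcs Y" "(c', d') \<in> parcs Y" "(d', y1) \<in> parcs Y"
      using arcs y(2) by (auto simp: lamp_iff)
    have dist': "distinct [y1, y, y2, a', c', d']" using dist e y by auto
    have all: "in_square Y y1 y y2 \<and> in_square Y y y2 a' \<and> in_square Y y2 a' c' \<and>
      in_square Y a' c' d' \<and> in_square Y c' d' y1 \<and> in_square Y d' y1 y"
    proof -
      have "{(y1, y), (y, y2), (y2, a'), (a', c'), (c', d'), (d', y1)} \<subseteq> parcs Y"
        using y2(1) YD(10)[OF y(3)] e(4-7) by simp
      then show ?thesis
        using y2(3) dist' unfolding good_corner_def by blast
    qed
    show "square_at b q1 q (slot b y2 r)" "square_at b q (slot b y2 r) a" "square_at b (slot b y2 r) a c"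
      "square_at b a c d" "square_at b c d q1" "square_at b d q1 q"
      using all sq e y by auto
  qed
  then show ?thesis by blast
qed

end

lemma realized_lamplighter:
  assumes X: "vtg X" "bipartition X p" and Y: "vtg Y" "bipartition Y pY"
    and deg: "unsquared X \<or> squared X"
    and bad: "\<And>y y1. (y, y1) \<in> parcs Y \<Longrightarrow> \<exists>y2. (y, y2) \<in> parcs Y \<and> y2 \<noteq> y1 \<and> \<not> good_corner Y y1 y y2"
  shows "realized (arc_type X + arc_type Y)"
proof -
  interpret lamplighter X p Y pY by unfold_locales (fact X Y)+
  have deg: "\<exists>y'. y' \<noteq> y \<and> (x, y') \<in> parcs X" if "(x, y) \<in> parcs X" for x y
    using deg that unfolding unsquared_def squared_def by blast
  show ?thesis
    by (rule lamplighter_type; rule kinds_preserved[OF lamp_disjoint deg lamp_bad_partner[OF bad]])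
qed

section \<open>Adjoining a summand 1\<close>

lemma lamp_K2_unique: "(q, u) \<in> lamp K2 b \<Longrightarrow> (q, v) \<in> lamp K2 b \<Longrightarrow> v = u"
  by (auto simp: lamp_def slot_def split: if_splits)

text \<open>The counterpart of \<open>realized_prism\<close>. Only one new arc leaves each vertex,
  so all its corners are mixed and lie on no 4-cycle, whereas each old arc has a corner on a 4-cycle
  of \<open>X\<close>.\<close>

lemma realized_lamplighter_K2:
  assumes X: "vtg X" "bipartition X p" and s: "squared X"
  shows "realized (arc_type X + ({#1#}, {#}))"
proof -
  interpret lamplighter X p K2 id by unfold_locales (fact X K2_vtg K2_bipartition)+
  define \<Phi> where "\<Phi> v w \<longleftrightarrow> (\<forall>w'. (v, w') \<in> parcs Z \<longrightarrow> w' \<noteq> w \<longrightarrow> \<not> in_square Z w v w')" for v w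
  have \<Phi>_imp: "\<Phi> (f v) (f w)" if f: "f \<in> graph_aut Z" and vw: "\<Phi> v w" for f v w
    unfolding \<Phi>_def
  proof (intro allI impI)
    fix w' assume w': "(f v, w') \<in> parcs Z" "w' \<noteq> f w"
    have e: "w' = f (inv f w')"
      using graph_aut_inverse[OF f] by simp
    then have "\<not> in_square Z w v (inv f w')"
      using vw w' graph_aut_arc_iff[OF Z_graph f] unfolding \<Phi>_def by metis
    then show "\<not> in_square Z (f w) (f v) w'"
      using e in_square_aut[OF Z_graph f] by metis
  qed
  have \<Phi>: "\<Phi> (f v) (f w) \<longleftrightarrow> \<Phi> v w" if "f \<in> graph_aut Z" for f v w
    using graph_aut_iffI[OF that, of "\<lambda>u v w. \<Phi> v w"] \<Phi>_imp by blast
  have 1: "\<Phi> v w" if "(v, w) \<in> Qarcs" for v w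
  proof -
    obtain q q1 x where x: "v = (q, x)" "w = (q1, x)" "x \<in> pverts X" "(q, q1) \<in> lamp K2 (p x)"
      using \<open>(v, w) \<in> Qarcs\<close> by (auto simp: Qarcs_def simp del: K2_simps(1))
    have "\<not> in_square Z w v w'" if w': "(v, w') \<in> parcs Z" "w' \<noteq> w" for w'
    proof -
      obtain u z where u: "w' = (u, z)" by (cases w')
      then have "((q, x), (u, z)) \<in> Xarcs" using w' x(1,2) lamp_K2_unique[OF x(4), of u] by (auto simp del: K2_simps(1))
      then have z: "w' = (q, z)" "(x, z) \<in> parcs X" using u by (auto simp del: K2_simps(1))
      show ?thesis using mixed_not_square(2)[OF lamp_disjoint z(2) x(4)] x z by (simp del: K2_simps(1))
    qed
    then show ?thesis unfolding \<Phi>_def by blast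
  qed
  have 2: "\<not> \<Phi> v w" if "(v, w) \<in> Xarcs" for v w
  proof -
    obtain q x y where x: "v = (q, x)" "w = (q, y)" "(x, y) \<in> parcs X" "q \<in> pverts K2 \<times> pverts K2"
      using \<open>(v, w) \<in> Xarcs\<close> by (auto simp: Xarcs_def simp del: K2_simps(1))
    obtain y' where y': "(x, y') \<in> parcs X" "y' \<noteq> y" "in_square X y x y'"
      using s x(3) unfolding squared_def by blast
    have "in_square Z (q, y) (q, x) (q, y')"
      using y'(3) x(4) unfolding in_square_def by (auto simp del: K2_simps(1))
    then show ?thesis unfolding \<Phi>_def using x y' by (auto simp del: K2_simps(1))
  qed
  have presX: "map_prod f f e \<in> Xarcs" if "f \<in> graph_aut Z" "e \<in> Xarcs" for f e
    using \<Phi> 1 2 that Xarcs_preservedI(1)[where \<Phi> = \<Phi>] by blast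
  have presQ: "map_prod f f e \<in> Qarcs" if "f \<in> graph_aut Z" "e \<in> Qarcs" for f e
    using \<Phi> 1 2 that Xarcs_preservedI(2)[where \<Phi> = \<Phi>] by blast
  note pres = presX presQ
  show ?thesis using lamplighter_type[OF pres] K2_type by simp
qed

lemma realized_add_one:
  assumes "realized P"
  shows "realized (P + ({#1#}, {#}))"
  using assms realized_prism realized_lamplighter_K2 unfolding realized_def[of P] by blast

section \<open>A chiral index set\<close>

text \<open>Vertex-transitivity moves tails anywhere, and by uniqueness the heads follow.\<close>

lemma functional_orbit:
  assumes Z: "vtg Z" and D: "D \<subseteq> parcs Z"
    and inv: "\<And>f u v. f \<in> graph_aut Z \<Longrightarrow> (u, v) \<in> D \<Longrightarrow> (f u, f v) \<in> D"
    and fn: "\<And>v. v \<in> pverts Z \<Longrightarrow> \<exists>!w. (v, w) \<in> D"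
  shows "D \<in> arc_orbits Z" "orbit_valency Z D = 1"
proof -
  note ZD = vtgD[OF Z]
  obtain v where v: "v \<in> pverts Z" using ZD(4) by blast
  show D_orb: "D \<in> arc_orbits Z"
  proof (rule arc_orbitsI[OF D])
    show "D \<noteq> {}" using fn[OF v] by blast
    show "map_prod f f e \<in> D" if "f \<in> graph_aut Z" "e \<in> D" for f e
      using inv[OF that(1)] that(2) by (cases e) auto
    fix e e' assume e: "e \<in> D" "e' \<in> D"
    obtain a b a' b' where ab: "e = (a, b)" "e' = (a', b')" by (cases e; cases e')
    have V: "a \<in> pverts Z" "a' \<in> pverts Z" using e D ZD(8) unfolding ab by blast+
    obtain f where f: "f \<in> graph_aut Z" "f a = a'" using vtg_move[OF Z V] by blast
    have "(a', f b) \<in> D" using inv[OF f(1), of a b] e f(2) unfolding ab by simp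
    then have "f b = b'" using fn[OF V(2)] e unfolding ab by blast
    then show "\<exists>f\<in>graph_aut Z. map_prod f f e = e'" using f ab by auto
  qed
  obtain w where "(v, w) \<in> D" "\<And>w'. (v, w') \<in> D \<Longrightarrow> w' = w" using fn[OF v] by blast
  then have "{w. (v, w) \<in> D} = {w}" by blast
  then show "orbit_valency Z D = 1" using orbit_valency_card[OF Z D_orb v] by simp
qed

text \<open>\<open>(j, x)\<close> stands for the affine map \<open>z |-> 2^j z + x\<close> over the
  field with five elements, where 2 generates the multiplicative group. A list makes finite checks
  computable.\<close>

definition grid :: "(nat \<times> nat) list" where
  "grid = List.product [0..<4] [0..<5]"

text \<open>
  Right multiplication by two generators of the group of order 20 formed by the affine maps of
  the field with five elements. Some automorphism of this group swaps the generators, but none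
  inverts them both or sends each to the inverse of the other.
\<close>

fun turn :: "bool \<Rightarrow> nat \<times> nat \<Rightarrow> nat \<times> nat" where
  "turn b (j, x) = ((j + 1) mod 4, (if b then x + 2 ^ j else x) mod 5)"

text \<open>The generators \<open>z |-> 2z\<close> and \<open>z |-> 2z + 1\<close> have order 4, so
  the cube is the inverse.\<close>

definition unturn :: "bool \<Rightarrow> nat \<times> nat \<Rightarrow> nat \<times> nat" where
  "unturn b q = turn b (turn b (turn b q))"

definition spin :: "bool \<Rightarrow> ((nat \<times> nat) \<times> (nat \<times> nat)) set" where
  "spin b = {(q, q'). q \<in> set grid \<and> (q' = turn b q \<or> q' = unturn b q)}"

text \<open>Left multiplication by \<open>(k, c)\<close>; it commutes with the right multiplications
  \<open>turn\<close>.\<close>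

fun shift :: "nat \<times> nat \<Rightarrow> nat \<times> nat \<Rightarrow> nat \<times> nat" where
  "shift (k, c) (j, x) = ((j + k) mod 4, (2 ^ k * x + c) mod 5)"

text \<open>Conjugation by \<open>z |-> -z - 1\<close>, which exchanges the fixed points 0 and -1 of
  the two generators. The summand 4 stands for -1 and keeps the subtraction of naturals
  exact.\<close>

fun reflect :: "nat \<times> nat \<Rightarrow> nat \<times> nat" where
  "reflect (j, x) = (j, (2 ^ j + 4 - x) mod 5)"

lemma turn_facts:
  "\<forall>b \<in> set [False, True]. \<forall>q \<in> set grid. turn b q \<in> set grid \<and> unturn b (turn b q) = q \<and>
     unturn b q \<in> set grid \<and> turn b (unturn b q) = q \<and> turn b q \<noteq> q \<and> unturn b q \<noteq> q \<and> turn b q \<noteq> unturn b q \<and>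
     turn b (turn b q) = unturn b (unturn b q) \<and> turn b (turn b q) \<noteq> q \<and>
     turn b q \<noteq> turn (\<not> b) q \<and> turn b q \<noteq> unturn (\<not> b) q \<and> unturn b q \<noteq> unturn (\<not> b) q"
  by code_simp

lemma shift_facts:
  "\<forall>s \<in> set grid. \<forall>q \<in> set grid. shift s q \<in> set grid \<and>
     (\<forall>b \<in> set [False, True]. shift s (turn b q) = turn b (shift s q))"
  by code_simp

lemma shift_move:
  "\<forall>q \<in> set grid. \<forall>q' \<in> set grid. \<exists>s \<in> set grid. shift s q = q'"
  by code_simp

lemma shift_onto:
  "\<forall>q \<in> set grid. \<forall>s \<in> set grid. \<exists>q' \<in> set grid. shift s q' = q"
  by code_simp

lemma reflect_facts:
  "\<forall>q \<in> set grid. reflect q \<in> set grid \<and> reflect (reflect q) = q \<and>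
     (\<forall>b \<in> set [False, True]. reflect (turn b q) = turn (\<not> b) (reflect q))"
  by code_simp

text \<open>The clauses on \<open>r\<close> in \<open>bad_partner\<close> as a finite check, with
  the two neighbours \<open>turn b q\<close> and \<open>unturn b q\<close> as partners of each
  other.\<close>

definition hexagon_free :: "bool" where
  "hexagon_free \<longleftrightarrow> (\<forall>b \<in> set [False, True]. \<forall>q \<in> set grid. \<forall>(q1, q2) \<in> set [(turn b q, unturn b q), (unturn b q, turn b q)].
     (\<forall>r \<in> set [turn (\<not> b) q2, unturn (\<not> b) q2]. \<forall>c \<in> set [False, True]. r \<noteq> turn c q1 \<and> r \<noteq> unturn c q1) \<and>
     (\<forall>r \<in> set [turn b q2, unturn b q2]. r \<noteq> turn (\<not> b) q1 \<and> r \<noteq> unturn (\<not> b) q1))"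

lemma hexagon_free: hexagon_free
  by code_simp

text \<open>
  A closed walk using the two generators in the pattern below starts with a forward step: this
  is how an automorphism recognizes the direction of a step.
\<close>

definition heading :: "bool \<Rightarrow> nat \<times> nat \<Rightarrow> nat \<times> nat \<Rightarrow> bool" where
  "heading b q q' \<longleftrightarrow> (q, q') \<in> spin b \<and> (\<exists>q2 q3 q4 q5. (q', q2) \<in> spin (\<not> b) \<and>
     (q2, q3) \<in> spin (\<not> b) \<and> (q3, q4) \<in> spin b \<and> (q4, q5) \<in> spin b \<and> (q5, q) \<in> spin (\<not> b))"

definition steps :: "bool \<Rightarrow> nat \<times> nat \<Rightarrow> (nat \<times> nat) list" where
  "steps b q = [turn b q, unturn b q]"

text \<open>Collects the ends of all walks with a given pattern of generators, each step in either
  direction, so that closing up can be decided by evaluation.\<close>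

fun chain :: "bool list \<Rightarrow> nat \<times> nat \<Rightarrow> (nat \<times> nat) list" where
  "chain [] q = [q]"
| "chain (b # bs) q = concat (map (chain bs) (steps b q))"

text \<open>The relation behind the first part: forward with \<open>b\<close>, back twice with
  \<open>\<not> b\<close>, forward twice with \<open>b\<close>, back once with
  \<open>\<not> b\<close>. No choice of the later directions closes the walk after a backward first
  step.\<close>

lemma headings_origin:
  "(0, 0) \<in> set (chain [\<not> b, \<not> b, b, b, \<not> b] (turn b (0, 0)))"
  "(0, 0) \<notin> set (chain [\<not> b, \<not> b, b, b, \<not> b] (unturn b (0, 0)))"
  by (cases b; simp add: steps_def unturn_def)+

declare turn.simps [simp del] shift.simps [simp del] reflect.simps [simp del]

section \<open>Regular action and steps on the group of order 20\<close>

lemma mem_bool [simp]: "b \<in> set [False, True]"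
  by (cases b) auto

lemma turn_grid:
  assumes "q \<in> set grid"
  shows "turn b q \<in> set grid" "unturn b q \<in> set grid" "unturn b (turn b q) = q" "turn b (unturn b q) = q"
    "turn b q \<noteq> q" "unturn b q \<noteq> q" "turn b q \<noteq> unturn b q" "turn b (turn b q) = unturn b (unturn b q)"
    "turn b (turn b q) \<noteq> q" "turn b q \<noteq> turn (\<not> b) q" "turn b q \<noteq> unturn (\<not> b) q" "unturn b q \<noteq> unturn (\<not> b) q"
  using turn_facts assms mem_bool[of b] by blast+

lemma shift_grid:
  assumes "q \<in> set grid" "s \<in> set grid"
  shows "shift s q \<in> set grid" "shift s (turn b q) = turn b (shift s q)"
    "shift s (unturn b q) = unturn b (shift s q)"
proof -
  have 1: "shift s q \<in> set grid" "shift s (turn b q) = turn b (shift s q)" if "q \<in> set grid" for q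
    using shift_facts that assms(2) mem_bool[of b] by blast+
  show "shift s q \<in> set grid" "shift s (turn b q) = turn b (shift s q)" using 1 assms(1) by blast+
  show "shift s (unturn b q) = unturn b (shift s q)"
    using 1 assms(1) turn_grid(1) by (simp add: unturn_def)
qed

lemma shift_inj: "s \<in> set grid \<Longrightarrow> inj_on (shift s) (set grid)"
proof (rule eq_card_imp_inj_on)
  assume s: "s \<in> set grid"
  have "set grid \<subseteq> shift s ` set grid"
  proof
    fix q assume "q \<in> set grid"
    then obtain q' where "q' \<in> set grid" "q = shift s q'" using shift_onto s by metis
    then show "q \<in> shift s ` set grid" by blast
  qed
  moreover have "shift s ` set grid \<subseteq> set grid" using shift_grid(1) s by blast
  ultimately show "card (shift s ` set grid) = card (set grid)" by (metis subset_antisym)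
qed simp

lemma spin_iff: "(q, q') \<in> spin b \<longleftrightarrow> q \<in> set grid \<and> q' \<in> set (steps b q)"
  by (auto simp: spin_def steps_def)

lemma spin_grid: "(q, q') \<in> spin b \<Longrightarrow> q \<in> set grid \<and> q' \<in> set grid"
  by (auto simp: spin_def turn_grid)

lemma spin_sym: "(q, q') \<in> spin b \<Longrightarrow> (q', q) \<in> spin b"
  by (auto simp: spin_def turn_grid)

lemma spin_shift: "s \<in> set grid \<Longrightarrow> (q, q') \<in> spin b \<Longrightarrow> (shift s q, shift s q') \<in> spin b"
  by (auto simp: spin_def shift_grid)

lemma spin_reflect:
  assumes "(q, q') \<in> spin b"
  shows "(reflect q, reflect q') \<in> spin (\<not> b)"
proof -
  have r: "reflect q \<in> set grid" "reflect (turn b q) = turn (\<not> b) (reflect q)" if "q \<in> set grid" for q b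
    using reflect_facts that mem_bool[of b] by blast+
  have u: "reflect (unturn b q) = unturn (\<not> b) (reflect q)" if "q \<in> set grid" for q b
    by (simp add: unturn_def r turn_grid(1) that)
  show ?thesis using assms by (auto simp: spin_def r u)
qed

section \<open>Recognizing the direction of a step\<close>

lemma chain_spin:
  assumes "u \<in> set grid"
  shows "q \<in> set (chain (c # cs) u) \<longleftrightarrow> (\<exists>v. (u, v) \<in> spin c \<and> v \<in> set grid \<and> q \<in> set (chain cs v))"
proof -
  have "v \<in> set (steps c u) \<longleftrightarrow> (u, v) \<in> spin c \<and> v \<in> set grid" for v
    using assms spin_grid[of u v c] by (auto simp: spin_iff)
  then show ?thesis by auto
qed

lemma heading_chain:
  assumes "(q, q') \<in> spin b"
  shows "heading b q q' \<longleftrightarrow> q \<in> set (chain [\<not> b, \<not> b, b, b, \<not> b] q')"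
proof -
  have q': "q' \<in> set grid" using spin_grid assms by blast
  have 0: "q \<in> set (chain [\<not> b] u) \<longleftrightarrow> (u, q) \<in> spin (\<not> b)" if "u \<in> set grid" for u
    unfolding chain_spin[OF that] by (auto simp del: split_paired_Ex dest: spin_grid)
  show ?thesis
  proof
    assume "heading b q q'"
    then obtain q2 q3 q4 q5 where s: "(q', q2) \<in> spin (\<not> b)" "(q2, q3) \<in> spin (\<not> b)" "(q3, q4) \<in> spin b"
      "(q4, q5) \<in> spin b" "(q5, q) \<in> spin (\<not> b)"
      unfolding heading_def by blast
    note g = s[THEN spin_grid]
    have "q \<in> set (chain [\<not> b] q5)" using 0 s(5) g by blast
    then have "q \<in> set (chain [b, \<not> b] q4)" using chain_spin s(4) g by blast
    then have "q \<in> set (chain [b, b, \<not> b] q3)" using chain_spin s(3) g by blast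
    then have "q \<in> set (chain [\<not> b, b, b, \<not> b] q2)" using chain_spin s(2) g by blast
    then show "q \<in> set (chain [\<not> b, \<not> b, b, b, \<not> b] q')" using chain_spin s(1) g by blast
  next
    assume "q \<in> set (chain [\<not> b, \<not> b, b, b, \<not> b] q')"
    then obtain q2 where 2: "(q', q2) \<in> spin (\<not> b)" "q2 \<in> set grid" "q \<in> set (chain [\<not> b, b, b, \<not> b] q2)"
      using chain_spin[OF q'] by blast
    then obtain q3 where 3: "(q2, q3) \<in> spin (\<not> b)" "q3 \<in> set grid" "q \<in> set (chain [b, b, \<not> b] q3)"
      using chain_spin[OF 2(2)] by blast
    then obtain q4 where 4: "(q3, q4) \<in> spin b" "q4 \<in> set grid" "q \<in> set (chain [b, \<not> b] q4)"
      using chain_spin[OF 3(2)] by blast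
    then obtain q5 where 5: "(q4, q5) \<in> spin b" "q5 \<in> set grid" "q \<in> set (chain [\<not> b] q5)"
      using chain_spin[OF 4(2)] by blast
    then show "heading b q q'" using assms 0 2 3 4 unfolding heading_def by blast
  qed
qed

text \<open>Shifts preserve headings and reach every point, which reduces the claim to the
  origin.\<close>

lemma heading_iff:
  assumes q: "q \<in> set grid"
  shows "heading b q q' \<longleftrightarrow> q' = turn b q"
proof -
  have o: "(0, 0) \<in> set grid" by (simp add: grid_def)
  have sh: "heading b (shift s u) (shift s v)" if h: "heading b u v" and s: "s \<in> set grid" for u v s
  proof -
    obtain q2 q3 q4 q5 where w: "(v, q2) \<in> spin (\<not> b)" "(q2, q3) \<in> spin (\<not> b)" "(q3, q4) \<in> spin b"
      "(q4, q5) \<in> spin b" "(q5, u) \<in> spin (\<not> b)" "(u, v) \<in> spin b"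
      using h unfolding heading_def by blast
    show ?thesis using w[THEN spin_shift[OF s]] unfolding heading_def by blast
  qed
  have orig: "heading b (0, 0) v \<longleftrightarrow> v = turn b (0, 0)" for v
  proof
    assume h: "heading b (0, 0) v"
    then have sp: "((0, 0), v) \<in> spin b" by (simp add: heading_def)
    then have "v = turn b (0, 0) \<or> v = unturn b (0, 0)" by (simp add: spin_def)
    then show "v = turn b (0, 0)"
      using heading_chain[OF sp] h headings_origin(2) by blast
  next
    assume v: "v = turn b (0, 0)"
    then have "((0, 0), v) \<in> spin b" using o by (simp add: spin_def)
    then show "heading b (0, 0) v"
      using heading_chain headings_origin(1) v by blast
  qed
  show ?thesis
  proof
    assume h: "heading b q q'"
    obtain s where s: "s \<in> set grid" "shift s q = (0, 0)" using shift_move q o by blast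
    have "shift s q' = turn b (shift s q)" using sh[OF h s(1)] orig s(2) by simp
    also have "\<dots> = shift s (turn b q)" using shift_grid(2)[OF q s(1)] by simp
    finally show "q' = turn b q"
      using inj_onD[OF shift_inj[OF s(1)]] turn_grid(1)[OF q] h spin_grid unfolding heading_def by blast
  next
    assume q': "q' = turn b q"
    obtain s where s: "s \<in> set grid" "shift s (0, 0) = q" using shift_move q o by blast
    then show "heading b q q'"
      using sh[of "(0, 0)" "turn b (0, 0)" s] orig shift_grid(2)[OF o s(1)] q' by simp
  qed
qed


text \<open>Generators of order 4 make every component of \<open>spin b\<close> a 4-cycle, so a walk
  with one generator has no room for a hexagon.\<close>

lemma opposite_facts:
  "\<forall>b \<in> set [False, True]. \<forall>q \<in> set grid. \<forall>(q1, q2) \<in> set [(turn b q, unturn b q), (unturn b q, turn b q)].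
     \<forall>a \<in> set (steps b q2). a \<noteq> q \<longrightarrow> (\<forall>c \<in> set (steps b a). c = q1 \<or> c = q2)"
  by code_simp

lemma partner_ex:
  assumes "(q, q1) \<in> spin b"
  shows "\<exists>q2. (q1, q2) \<in> set [(turn b q, unturn b q), (unturn b q, turn b q)]"
proof -
  have "q1 = turn b q \<or> q1 = unturn b q" using assms by (simp add: spin_def)
  then show ?thesis by (elim disjE) (auto simp del: split_paired_Ex)
qed

lemma even_turn: "even (fst (turn b q)) \<longleftrightarrow> odd (fst q)"
proof (cases q)
  case (Pair j x)
  have "even ((j + 1) mod 4) \<longleftrightarrow> odd j" by presburger
  then show ?thesis using Pair by (simp add: turn.simps)
qed

lemma even_spin: "(q, q') \<in> spin b \<Longrightarrow> even (fst q) \<noteq> even (fst q')"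
  by (auto simp: spin_def unturn_def even_turn)

lemma spin_connected:
  assumes "q \<in> set grid"
  shows "((0, 0), q) \<in> (spin False \<union> spin True)\<^sup>*"
proof -
  let ?R = "(spin False \<union> spin True)\<^sup>*"
  have turns: "(u, turn b u) \<in> ?R" "(u, unturn b u) \<in> ?R" if "u \<in> set grid" for u b
    using that by (cases b; auto simp: spin_def intro!: r_into_rtrancl)+
  have g: "(j, x) \<in> set grid \<longleftrightarrow> j < 4 \<and> x < 5" for j x by (auto simp: grid_def)
  have x0: "((0, 0), (0, x)) \<in> ?R" if "x < 5" for x
    using that
  proof (induction x)
    case (Suc x)
    \<comment> \<open>A forward step with one generator and a backward step with the other change
      only \<open>x\<close>, by one at level 0.\<close>
    have 1: "turn True (0, x) = (1, Suc x)" "unturn False (1, Suc x) = (0, Suc x)"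
      using Suc.prems by (simp_all add: unturn_def turn.simps)
    have "((0, x), (1, Suc x)) \<in> ?R" "((1, Suc x), (0, Suc x)) \<in> ?R"
      using turns(1)[of "(0, x)" True] turns(2)[of "(1, Suc x)" False] 1 g Suc.prems by auto
    then show ?case using Suc by (meson Suc_lessD rtrancl_trans)
  qed simp
  have "((0, x), (j, x)) \<in> ?R" if "j < 4" "x < 5" for j x
    using that
  proof (induction j)
    case (Suc j)
    have "turn False (j, x) = (Suc j, x)" using Suc.prems by (simp add: turn.simps)
    then have "((j, x), (Suc j, x)) \<in> ?R" using turns(1)[of "(j, x)" False] g Suc.prems by auto
    then show ?case using Suc by (meson Suc_lessD rtrancl_trans)
  qed simp
  then show ?thesis using x0 assms g by (cases q) (meson rtrancl_trans)
qed

section \<open>Twisted products over the group of order 20\<close>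

locale chiral =
  fixes X :: "'a pair_pre_digraph" and p :: "'a \<Rightarrow> bool"
  assumes cX: "vtg X" "bipartition X p"
begin

sublocale twisted X p "set grid" spin
proof
  show "vtg X" "bipartition X p" by (fact cX)+
  have o: "(0, 0) \<in> set grid" by (simp add: grid_def)
  then show "set grid \<noteq> {}" by (metis empty_iff)
  show "(q, q) \<notin> spin b" for q b by (auto simp: spin_def turn_grid dest!: sym[of q])
  show "\<exists>q'. (q, q') \<in> spin b" if "q \<in> set grid" for q b
    using that by (auto simp: spin_def simp del: split_paired_Ex)
  show "\<exists>\<alpha>. \<alpha> ` set grid \<subseteq> set grid \<and> inj_on \<alpha> (set grid) \<and>
      (\<forall>b u v. (u, v) \<in> spin b \<longrightarrow> (\<alpha> u, \<alpha> v) \<in> spin b) \<and> \<alpha> q = q'"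
    if q: "q \<in> set grid" "q' \<in> set grid" for q q'
  proof -
    obtain s where s: "s \<in> set grid" "shift s q = q'" using shift_move q by blast
    show ?thesis
      by (rule exI[of _ "shift s"]) (use s shift_inj[OF s(1)] spin_shift[OF s(1)] shift_grid(1) in blast)
  qed
  show "\<exists>\<tau>. \<tau> ` set grid \<subseteq> set grid \<and> inj_on \<tau> (set grid) \<and>
      (\<forall>b u v. (u, v) \<in> spin b \<longrightarrow> (\<tau> u, \<tau> v) \<in> spin (\<not> b))"
  proof (intro exI[of _ reflect] conjI allI impI)
    show "reflect ` set grid \<subseteq> set grid" using reflect_facts by blast
    show "inj_on reflect (set grid)" by (rule inj_on_inverseI[of _ reflect]) (use reflect_facts in blast)
  qed (rule spin_reflect)
  show "(q, q') \<in> (spin False \<union> spin True)\<^sup>*" if "q \<in> set grid" "q' \<in> set grid" for q q'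
  proof -
    have "sym (spin False \<union> spin True)" by (rule symI) (use spin_sym in blast)
    then have "(q, (0, 0)) \<in> (spin False \<union> spin True)\<^sup>*"
      using spin_connected[OF that(1)] sym_rtrancl symD by metis
    then show ?thesis using spin_connected[OF that(2)] by (rule rtrancl_trans)
  qed
qed (use spin_grid spin_sym in blast)+

lemma spin_disjoint: "spin False \<inter> spin True = {}"
proof -
  have "(q, q') \<notin> spin True" if "(q, q') \<in> spin False" for q q'
    using that turn_grid(10-12)[of q False] turn_grid(11)[of q True] by (auto simp: spin_def simp del: split_paired_All)
  then show ?thesis by auto
qed

text \<open>The partner is the other neighbour of \<open>q\<close> under the same generator. Its
  component is a 4-cycle, so the clause on hexagons holds vacuously.\<close>

lemma spin_bad_partner:
  assumes "(q, q1) \<in> spin b"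
  shows "\<exists>q2. bad_partner b q1 q q2"
proof -
  have q: "q \<in> set grid" using assms spin_grid by blast
  obtain q2 where q2: "(q1, q2) \<in> set [(turn b q, unturn b q), (unturn b q, turn b q)]"
    using partner_ex[OF assms] by blast
  have ne: "q2 \<noteq> q1" using q2 turn_grid(7)[OF q, of b] by auto
  have sp: "(q, q2) \<in> spin b" using q q2 by (auto simp: spin_def)
  have h1: "r \<noteq> turn c q1 \<and> r \<noteq> unturn c q1" if "r \<in> set [turn (\<not> b) q2, unturn (\<not> b) q2]" for r c
    using hexagon_free q q2 that mem_bool[of b] mem_bool[of c] unfolding hexagon_free_def by blast
  have h2: "r \<noteq> turn (\<not> b) q1 \<and> r \<noteq> unturn (\<not> b) q1" if "r \<in> set [turn b q2, unturn b q2]" for r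
    using hexagon_free q q2 that mem_bool[of b] unfolding hexagon_free_def by blast
  have h3: "c = q1 \<or> c = q2" if "a \<in> set (steps b q2)" "a \<noteq> q" "c \<in> set (steps b a)" for a c
    using opposite_facts q q2 that mem_bool[of b] by blast
  have s1: "r \<in> set [turn c u, unturn c u]" if "(u, r) \<in> spin c" for u r c
    using that by (auto simp: spin_def)
  have "bad_partner b q1 q q2"
    unfolding bad_partner_def
  proof (intro conjI allI impI)
    show "q2 \<noteq> q1" "(q, q2) \<in> spin b" by fact+
    fix r
    show "(r, q1) \<notin> spin b \<union> spin (\<not> b)" if "(q2, r) \<in> spin (\<not> b)"
      using h1[OF s1[OF that]] s1[OF spin_sym] by fastforce
    show "(r, q1) \<notin> spin (\<not> b)" if "(q2, r) \<in> spin b"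
      using h2[OF s1[OF that]] s1[OF spin_sym] by fastforce
  next
    fix a c d
    assume dist: "distinct [q1, q, q2, a, c, d]" and arcs: "{(q2, a), (a, c), (c, d), (d, q1)} \<subseteq> spin b"
    have False
      using h3[of a c] dist arcs by (auto simp: spin_iff)
    then show "square_at b q1 q q2" "square_at b q q2 a" "square_at b q2 a c"
      "square_at b a c d" "square_at b c d q1" "square_at b d q1 q" by blast+
  qed
  then show ?thesis by blast
qed

definition forward :: "(((nat \<times> nat) \<times> 'a) \<times> ((nat \<times> nat) \<times> 'a)) set" where
  "forward = {((q, x), (turn (p x) q, x)) | q x. q \<in> set grid \<and> x \<in> pverts X}"

text \<open>The walk of \<open>heading\<close>, with one old arc inserted at each change of
  generator to change the colour. Whatever old arcs are chosen, only their colours matter. So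
  direction is expressed through the kinds of arcs alone, which automorphisms preserve.\<close>

lemma forward_iff:
  "(v, w) \<in> forward \<longleftrightarrow> (v, w) \<in> Qarcs \<and> (\<exists>a1 a2 a3 a4 a5 a6 a7 a8.
     (w, a1) \<in> Xarcs \<and> (a1, a2) \<in> Qarcs \<and> (a2, a3) \<in> Qarcs \<and> (a3, a4) \<in> Xarcs \<and> (a4, a5) \<in> Qarcs \<and>
     (a5, a6) \<in> Qarcs \<and> (a6, a7) \<in> Xarcs \<and> (a7, a8) \<in> Qarcs \<and> (a8, v) \<in> Xarcs)" (is "_ \<longleftrightarrow> ?R")
proof
  assume "(v, w) \<in> forward"
  then obtain q x where v: "v = (q, x)" "w = (turn (p x) q, x)" "q \<in> set grid" "x \<in> pverts X"
    by (auto simp: forward_def)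
  obtain y where y: "(x, y) \<in> parcs X" using X_arc_ex v(4) by blast
  have "heading (p x) q (turn (p x) q)" using heading_iff[OF v(3)] by simp
  then obtain q2 q3 q4 q5 where w: "(q, turn (p x) q) \<in> spin (p x)" "(turn (p x) q, q2) \<in> spin (\<not> p x)"
    "(q2, q3) \<in> spin (\<not> p x)" "(q3, q4) \<in> spin (p x)" "(q4, q5) \<in> spin (p x)" "(q5, q) \<in> spin (\<not> p x)"
    unfolding heading_def by blast
  show ?R
  proof (intro conjI exI)
    note g = w[THEN spin_grid]
    show "(v, w) \<in> Qarcs" "(w, (turn (p x) q, y)) \<in> Xarcs" "((turn (p x) q, y), (q2, y)) \<in> Qarcs"
      "((q2, y), (q3, y)) \<in> Qarcs" "((q3, y), (q3, x)) \<in> Xarcs" "((q3, x), (q4, x)) \<in> Qarcs"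
      "((q4, x), (q5, x)) \<in> Qarcs" "((q5, x), (q5, y)) \<in> Xarcs" "((q5, y), (q, y)) \<in> Qarcs"
      "((q, y), v) \<in> Xarcs"
      using v y p_arc[OF y] XD(9)[OF y] XD(10)[OF y] w g by simp_all
  qed
next
  assume ?R
  then obtain a1 a2 a3 a4 a5 a6 a7 a8 where a: "(v, w) \<in> Qarcs" "(w, a1) \<in> Xarcs" "(a1, a2) \<in> Qarcs"
    "(a2, a3) \<in> Qarcs" "(a3, a4) \<in> Xarcs" "(a4, a5) \<in> Qarcs" "(a5, a6) \<in> Qarcs" "(a6, a7) \<in> Xarcs"
    "(a7, a8) \<in> Qarcs" "(a8, v) \<in> Xarcs" by blast
  obtain q x q' where v: "v = (q, x)" "w = (q', x)" "x \<in> pverts X" "(q, q') \<in> spin (p x)"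
    using a(1) by (auto simp: Qarcs_def)
  obtain y where y: "a1 = (q', y)" "p y = (\<not> p x)" using a(2) p_arc unfolding v by (cases a1) auto
  obtain q2 where q2: "a2 = (q2, y)" "(q', q2) \<in> spin (\<not> p x)" using a(3) y by (cases a2) auto
  obtain q3 where q3: "a3 = (q3, y)" "(q2, q3) \<in> spin (\<not> p x)" using a(4) q2 y by (cases a3) auto
  obtain z where z: "a4 = (q3, z)" "p z = p x" using a(5) p_arc q3 y by (cases a4) auto
  obtain q4 where q4: "a5 = (q4, z)" "(q3, q4) \<in> spin (p x)" using a(6) z by (cases a5) auto
  obtain q5 where q5: "a6 = (q5, z)" "(q4, q5) \<in> spin (p x)" using a(7) q4 z by (cases a6) auto
  obtain u where u: "a7 = (q5, u)" "p u = (\<not> p x)" using a(8) p_arc q5 z by (cases a7) auto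
  have "(q5, q) \<in> spin (\<not> p x)" using a(9,10) u v by (cases a8) auto
  then have "heading (p x) q q'" using v q2 q3 q4 q5 unfolding heading_def by blast
  then have "q' = turn (p x) q" using heading_iff spin_grid[OF v(4)] by blast
  then show "(v, w) \<in> forward" using v spin_grid[OF v(4)] by (auto simp: forward_def simp del: split_paired_Ex)
qed

text \<open>One forward arc leaves each vertex, so these arcs form a single orbit; it is not
  self-paired since \<open>turn\<close> is not an involution. The new arcs are the forward arcs and
  their reverses.\<close>

theorem chiral_type:
  assumes presX: "\<And>f e. f \<in> graph_aut Z \<Longrightarrow> e \<in> Xarcs \<Longrightarrow> map_prod f f e \<in> Xarcs"
    and presQ: "\<And>f e. f \<in> graph_aut Z \<Longrightarrow> e \<in> Qarcs \<Longrightarrow> map_prod f f e \<in> Qarcs"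
  shows "realized (arc_type X + ({#}, {#1#}))"
proof -
  have inv: "(f u, f v) \<in> forward" if f: "f \<in> graph_aut Z" and uv: "(u, v) \<in> forward" for f u v
  proof -
    have X: "(f a, f b) \<in> Xarcs" if "(a, b) \<in> Xarcs" for a b using presX[OF f that] by simp
    have Q: "(f a, f b) \<in> Qarcs" if "(a, b) \<in> Qarcs" for a b using presQ[OF f that] by simp
    show ?thesis using uv X Q unfolding forward_iff by blast
  qed
  have sub: "forward \<subseteq> parcs Z" using forward_iff by auto
  have fn: "\<exists>!w. (v, w) \<in> forward" if "v \<in> pverts Z" for v
  proof -
    obtain q x where v: "v = (q, x)" "q \<in> set grid" "x \<in> pverts X" using \<open>v \<in> pverts Z\<close> by auto
    show ?thesis
      by (rule ex1I[of _ "(turn (p x) q, x)"]) (use v in \<open>auto simp: forward_def simp del: split_paired_Ex\<close>)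
  qed
  have orb: "forward \<in> arc_orbits Z" "orbit_valency Z forward = 1"
    using functional_orbit[where D = forward, OF Z_vtg sub] inv fn by blast+
  have neq: "forward\<inverse> \<noteq> forward"
  proof
    assume eq: "forward\<inverse> = forward"
    obtain q x where qx: "q \<in> set grid" "x \<in> pverts X" using Q(2) XD(4) by (metis all_not_in_conv)
    then have "((q, x), (turn (p x) q, x)) \<in> forward" unfolding forward_def by blast
    then have "((turn (p x) q, x), (q, x)) \<in> forward" using eq by blast
    then have "q = turn (p x) (turn (p x) q)" by (auto simp: forward_def)
    then show False using turn_grid(9)[OF qx(1)] by metis
  qed
  have Q: "forward \<union> forward\<inverse> = Qarcs"
  proof
    show "forward \<union> forward\<inverse> \<subseteq> Qarcs" 
    proof -
      have "forward \<subseteq> Qarcs" using forward_iff by auto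
      then show ?thesis using Qarcs_converse by blast
    qed
    show "Qarcs \<subseteq> forward \<union> forward\<inverse>"
    proof
      fix e assume "e \<in> Qarcs"
      then obtain q q' x where e: "e = ((q, x), (q', x))" "x \<in> pverts X" "(q, q') \<in> spin (p x)"
        by (auto simp: Qarcs_def)
      have q: "q \<in> set grid" "q' \<in> set grid" using spin_grid[OF e(3)] by auto
      have f: "((u, x), (turn (p x) u, x)) \<in> forward" if "u \<in> set grid" for u
        using that e(2) unfolding forward_def by blast
      have "q' = turn (p x) q \<or> q = turn (p x) q'"
        using e(3) turn_grid(4)[OF q(1), of "p x"] unfolding spin_def by force
      then show "e \<in> forward \<union> forward\<inverse>" using e(1) f[OF q(1)] f[OF q(2)] by auto
    qed
  qed
  have conv: "forward\<inverse> \<in> arc_orbits Z" using arc_orbits_converse[OF Z_graph orb(1)] .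
  have "{D \<in> arc_orbits Z. D \<subseteq> Qarcs} = {forward, forward\<inverse>}"
  proof (intro equalityI subsetI)
    fix D assume D: "D \<in> {D \<in> arc_orbits Z. D \<subseteq> Qarcs}"
    then obtain e where "e \<in> D" "e \<in> forward \<union> forward\<inverse>" using arc_orbits_nonempty Q by blast
    then show "D \<in> {forward, forward\<inverse>}" using arc_orbits_disjoint[of D Z] D orb(1) conv by blast
  qed (use orb(1) conv Q in blast)
  then have "family_type (orbit_valency Z) {D \<in> arc_orbits Z. D \<subseteq> Qarcs} = ({#}, {#1#})"
    using family_type_pair[where val = "orbit_valency Z", OF neq]
      orbit_valency_converse[OF Z_graph vtgD(2)[OF Z_vtg] orb(1)] orb(2) by simp
  moreover have fX: "fibration X Z (set grid) Pair" by (rule X_fibration[OF presX])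
  have "fibration.lift (set grid) Pair (parcs X) = Xarcs"
    unfolding fibration.lift_def[OF fX] Xarcs_def by auto
  then have "family_type (orbit_valency Z) {D \<in> arc_orbits Z. D \<subseteq> Xarcs} = arc_type X"
    using fibration.layer_type[OF fX] by simp
  moreover have "arc_type Z = family_type (orbit_valency Z) {D \<in> arc_orbits Z. D \<subseteq> Xarcs} +
      family_type (orbit_valency Z) {D \<in> arc_orbits Z. D \<subseteq> Qarcs}"
    by (rule arc_type_split[OF Z_vtg _ Xarcs_Qarcs Xarcs_converse Qarcs_converse presX]) auto
  moreover have "bipartition Z (\<lambda>(q, x). even (fst q) \<noteq> p x)"
    by (rule Z_bipartition) (rule even_spin)
  ultimately show ?thesis
    using realizedI[OF Z_vtg _ disjI1[OF Z_unsquared[OF spin_disjoint]]] by simp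
qed

end

section \<open>Adjoining a bracketed pair of ones\<close>

lemma realized_add_pair:
  assumes "realized P"
  shows "realized (P + ({#}, {#1#}))"
proof -
  obtain X :: "nat pair_pre_digraph" and p where XP: "vtg X" "bipartition X p" "unsquared X \<or> squared X"
    "arc_type X = P" using assms unfolding realized_def by blast
  interpret chiral X p by unfold_locales (fact XP)+
  have deg: "\<exists>y'. y' \<noteq> y \<and> (x, y') \<in> parcs X" if "(x, y) \<in> parcs X" for x y
    using XP(3) that unfolding unsquared_def squared_def by blast
  show ?thesis
    unfolding XP(4)[symmetric]
    by (rule chiral_type; rule kinds_preserved[OF spin_disjoint deg spin_bad_partner])
qed

text \<open>\<open>K2\<close> has valency 1, so the 6-cycle argument does not apply to it. Here
  4-cycles suffice: both new arcs at a vertex lie on a common 4-cycle, as the generators have order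
  4, while every corner at the only old arc is mixed.\<close>

lemma realized_one_pair: "realized ({#1#}, {#1#})"
proof -
  interpret chiral K2 id by unfold_locales (fact K2_vtg K2_bipartition)+
  define \<Phi> where "\<Phi> v w \<longleftrightarrow> (\<exists>w'. (v, w') \<in> parcs Z \<and> w' \<noteq> w \<and> in_square Z w v w')" for v w
  have \<Phi>_imp: "\<Phi> (f v) (f w)" if f: "f \<in> graph_aut Z" and "\<Phi> v w" for f v w
  proof -
    obtain w' where "(v, w') \<in> parcs Z" "w' \<noteq> w" "in_square Z w v w'"
      using \<open>\<Phi> v w\<close> unfolding \<Phi>_def by blast
    then show ?thesis unfolding \<Phi>_def
      using graph_aut_arc_iff[OF Z_graph f] in_square_aut[OF Z_graph f] inj_eq[OF graph_autD(2)[OF f]]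
      by (intro exI[of _ "f w'"]) simp
  qed
  have \<Phi>: "\<Phi> (f v) (f w) \<longleftrightarrow> \<Phi> v w" if "f \<in> graph_aut Z" for f v w
    using graph_aut_iffI[OF that, of "\<lambda>u v w. \<Phi> v w"] \<Phi>_imp by blast
  have 1: "\<Phi> v w" if "(v, w) \<in> Qarcs" for v w
  proof -
    obtain q q1 x where x: "v = (q, x)" "w = (q1, x)" "x \<in> pverts K2" "(q, q1) \<in> spin (id x)"
      using \<open>(v, w) \<in> Qarcs\<close> by (auto simp: Qarcs_def)
    have q: "q \<in> set grid" using spin_grid x(4) by blast
    obtain q2 where q2: "(q1, q2) \<in> set [(turn x q, unturn x q), (unturn x q, turn x q)]"
      using partner_ex[OF x(4)] by auto
    define r where "r = turn x (turn x q)"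
    have r: "(turn x q, r) \<in> spin x" "(unturn x q, r) \<in> spin x" "r \<noteq> q"
      using turn_grid(8,9)[OF q, of x] turn_grid(1,2)[OF q] by (auto simp: spin_def r_def)
    have "(q, q2) \<in> spin x" "q2 \<noteq> q1" "(q1, r) \<in> spin x" "(r, q2) \<in> spin x" "r \<noteq> q"
    proof -
      have "(q, turn x q) \<in> spin x" "(q, unturn x q) \<in> spin x" using q by (simp_all add: spin_def)
      moreover have "(q1 = turn x q \<and> q2 = unturn x q) \<or> (q1 = unturn x q \<and> q2 = turn x q)"
        using q2 by auto
      ultimately show "(q, q2) \<in> spin x" "q2 \<noteq> q1" "(q1, r) \<in> spin x" "(r, q2) \<in> spin x" "r \<noteq> q"
        using r spin_sym[OF r(1)] spin_sym[OF r(2)] turn_grid(7)[OF q, of x] by metis+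
    qed
    then show ?thesis
      unfolding \<Phi>_def in_square_def using x
      by (intro exI[of _ "(q2, x)"] conjI exI[of _ "(r, x)"]) auto
  qed
  have 2: "\<not> \<Phi> v w" if "(v, w) \<in> Xarcs" for v w
  proof
    assume "\<Phi> v w"
    then obtain w' where w': "(v, w') \<in> parcs Z" "w' \<noteq> w" "in_square Z w v w'" unfolding \<Phi>_def by blast
    obtain q x y where x: "v = (q, x)" "w = (q, y)" "(x, y) \<in> parcs K2"
      using \<open>(v, w) \<in> Xarcs\<close> by (auto simp: Xarcs_def)
    then obtain q' where "w' = (q', x)" "(q, q') \<in> spin (id x)"
      using w'(1,2) by (cases w') auto
    then show False using mixed_not_square(1)[OF spin_disjoint x(3)] w'(3) x by simp
  qed
  have presX: "map_prod f f e \<in> Xarcs" if "f \<in> graph_aut Z" "e \<in> Xarcs" for f e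
    using \<Phi> 1 2 that Xarcs_preservedI(1)[where \<Phi> = \<Phi>] by blast
  have presQ: "map_prod f f e \<in> Qarcs" if "f \<in> graph_aut Z" "e \<in> Qarcs" for f e
    using \<Phi> 1 2 that Xarcs_preservedI(2)[where \<Phi> = \<Phi>] by blast
  show ?thesis using chiral_type[OF presX presQ] K2_type by simp
qed

section \<open>Complete bipartite graphs\<close>

definition complete_bipartite :: "nat \<Rightarrow> (bool \<times> nat) pair_pre_digraph" where
  "complete_bipartite n = \<lparr>pverts = UNIV \<times> {..<n},
     parcs = {((b, i), (\<not> b, j)) | b i j. i < n \<and> j < n}\<rparr>"

context
  fixes n :: nat
  assumes n: "n \<ge> 2"
begin

private abbreviation "K \<equiv> complete_bipartite n"

lemma K_simps:
  "pverts K = UNIV \<times> {..<n}" "((b, i), (c, j)) \<in> parcs K \<longleftrightarrow> c = (\<not> b) \<and> i < n \<and> j < n"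
  by (auto simp: complete_bipartite_def)

lemma K_graph: "pair_graph K"
proof (rule pair_graphI)
  show "parcs K \<subseteq> pverts K \<times> pverts K" by (auto simp: complete_bipartite_def)
  show "sym (parcs K)" by (rule symI) (auto simp: complete_bipartite_def)
  show "irrefl (parcs K)" by (auto simp: irrefl_def complete_bipartite_def)
qed (simp add: complete_bipartite_def)

lemma K_arc_move:
  assumes "i < n" "j < n" "i' < n" "j' < n"
  shows "\<exists>f \<in> graph_aut K. f (b, i) = (b', i') \<and> f (\<not> b, j) = (\<not> b', j')"
proof -
  define f where "f = (\<lambda>(c, k). (c \<noteq> (b \<noteq> b'), if c = b then Transposition.transpose i i' k else Transposition.transpose j j' k))"
  have lt: "Transposition.transpose u v k < n" if "u < n" "v < n" "k < n" for u v k
    using that by (auto simp: Transposition.transpose_def)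
  have "\<exists>g \<in> graph_aut K. \<forall>v \<in> pverts K. g v = f v"
  proof (rule graph_autI_exists[OF K_graph])
    show "f ` pverts K \<subseteq> pverts K" using lt assms by (auto simp: K_simps f_def)
    show "inj_on f (pverts K)"
      by (rule inj_onI) (auto simp: f_def split: if_splits dest: transpose_eq_imp_eq)
    show "(f u, f v) \<in> parcs K" if "(u, v) \<in> parcs K" for u v
      using that lt assms by (cases u; cases v) (auto simp: K_simps f_def)
  qed
  then obtain g where g: "g \<in> graph_aut K" "\<forall>v \<in> pverts K. g v = f v" by blast
  then show ?thesis using assms by (intro bexI[of _ g]) (auto simp: K_simps f_def)
qed

lemma K_vtg: "vtg K"
proof (rule vtgI[OF K_graph])
  have "((False, 0), (True, 0)) \<in> parcs K" using n by (simp add: K_simps)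
  then show "parcs K \<noteq> {}" by blast
  show "\<exists>f\<in>graph_aut K. f u = v" if "u \<in> pverts K" "v \<in> pverts K" for u v
    using K_arc_move[of "snd u" "snd u" "snd v" "snd v" "fst u" "fst v"] that by (auto simp: K_simps)
  show "((False, 0), v) \<in> (parcs K)\<^sup>*" if v: "v \<in> pverts K" for v
  proof -
    obtain b i where b: "v = (b, i)" "i < n" using v by (auto simp: K_simps)
    have "((False, 0), (True, 0)) \<in> parcs K" "((True, 0), (False, i)) \<in> parcs K" "((False, 0), (True, i)) \<in> parcs K"
      using b n by (simp_all add: K_simps)
    then show ?thesis using b by (cases b) (auto intro: rtrancl_into_rtrancl)
  qed
qed

lemma K_type: "arc_type K = ({#n#}, {#})"
proof (rule arc_type_arc_transitive[OF K_vtg])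
  show "\<exists>f\<in>graph_aut K. map_prod f f e = e'" if e: "e \<in> parcs K" "e' \<in> parcs K" for e e'
  proof -
    obtain b i j where 1: "e = ((b, i), (\<not> b, j))" "i < n" "j < n" using e(1) by (auto simp: complete_bipartite_def)
    obtain b' i' j' where 2: "e' = ((b', i'), (\<not> b', j'))" "i' < n" "j' < n"
      using e(2) by (auto simp: complete_bipartite_def)
    show ?thesis using K_arc_move[OF 1(2,3) 2(2,3), of b b'] 1(1) 2(1) by auto
  qed
  show "(False, 0) \<in> pverts K" using n by (simp add: K_simps)
  have "{w. ((False, 0), w) \<in> parcs K} = Pair True ` {..<n}" using n by (auto simp: K_simps)
  then show "card {w. ((False, 0), w) \<in> parcs K} = n" by (simp add: card_image inj_on_def)
qed

text \<open>As \<open>n \<ge> 2\<close>, the side of \<open>v\<close> has another vertex, and it is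
  adjacent to both \<open>u\<close> and \<open>w\<close>.\<close>

lemma K_square: "(u, v) \<in> parcs K \<Longrightarrow> (v, w) \<in> parcs K \<Longrightarrow> in_square K u v w"
proof -
  assume uv: "(u, v) \<in> parcs K" "(v, w) \<in> parcs K"
  obtain b i where v: "v = (b, i)" by (cases v)
  define k where "k = (if i = 0 then 1 else 0 :: nat)"
  have "(b, k) \<noteq> v" "(u, (b, k)) \<in> parcs K" "((b, k), w) \<in> parcs K"
    using uv n v by (cases u; cases w; auto simp: K_simps k_def)+
  then show ?thesis unfolding in_square_def by blast
qed

lemma K_partner: "(v, w) \<in> parcs K \<Longrightarrow> \<exists>w'. (v, w') \<in> parcs K \<and> w' \<noteq> w"
proof -
  assume vw: "(v, w) \<in> parcs K"
  obtain b i where w: "w = (b, i)" by (cases w)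
  define k where "k = (if i = 0 then 1 else 0 :: nat)"
  have "(v, (b, k)) \<in> parcs K \<and> (b, k) \<noteq> w"
    using vw n w by (cases v) (auto simp: K_simps k_def)
  then show ?thesis by blast
qed

lemma K_bipartition: "bipartition K fst"
  by (auto simp: bipartition_def complete_bipartite_def)

lemma realized_multiple: "realized ({#n#}, {#})"
proof -
  have "squared K"
    unfolding squared_def using K_partner K_square pair_graphD(5)[OF K_graph] by blast
  then show ?thesis using realizedI[OF K_vtg K_bipartition] K_type by simp
qed

text \<open>For \<open>n \<ge> 3\<close> there are 6-cycles, but all their corners lie on 4-cycles;
  \<open>good_corner\<close> discounts exactly these.\<close>

lemma realized_add_multiple:
  assumes "realized P"
  shows "realized (P + ({#n#}, {#}))"
proof -
  obtain X :: "nat pair_pre_digraph" and p where X: "vtg X" "bipartition X p" "unsquared X \<or> squared X"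
    "arc_type X = P" using assms unfolding realized_def by blast
  have "\<not> good_corner K u v w" for u v w
  proof
    assume "good_corner K u v w"
    then obtain a b c where arcs: "{(u, v), (v, w), (w, a), (a, b), (b, c), (c, u)} \<subseteq> parcs K"
      and ns: "\<not> (in_square K u v w \<and> in_square K v w a \<and> in_square K w a b \<and>
        in_square K a b c \<and> in_square K b c u \<and> in_square K c u v)"
      unfolding good_corner_def by blast
    show False using ns arcs K_square by simp
  qed
  then have "realized (arc_type X + arc_type K)"
    using realized_lamplighter[OF X(1,2) K_vtg K_bipartition X(3)] K_partner by blast
  then show ?thesis using X(4) K_type by simp
qed

end

section \<open>Two bracketed pairs of ones\<close>

text \<open>
  Twelve-fold rather than four-fold levels tell the two kinds of steps apart: only steps of the
  second kind close up after four moves. Directions are recognized in the quotient.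
\<close>

definition wheel :: "(nat \<times> nat) set" where
  "wheel = {..<12} \<times> {..<5}"

text \<open>The level increment 9 is 1 modulo 4, so that reduction modulo 4 gives
  \<open>turn\<close>, and 0 modulo 3, so that four such rolls return to the starting level. The
  other generator needs twelve.\<close>

fun roll :: "bool \<Rightarrow> nat \<times> nat \<Rightarrow> nat \<times> nat" where
  "roll b (j, x) = ((if b then j + 9 else j + 1) mod 12, (if b then x + 2 ^ (j mod 4) else x) mod 5)"

text \<open>The inverse of \<open>roll\<close>: 3 and 11 are -9 and -1 modulo 12, the factor 4 is -1
  modulo 5, and the exponent belongs to the level before the roll.\<close>

fun unroll :: "bool \<Rightarrow> nat \<times> nat \<Rightarrow> nat \<times> nat" where
  "unroll b (j, x) = ((if b then j + 3 else j + 11) mod 12,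
     (if b then x + 4 * 2 ^ ((j + 3) mod 4) else x) mod 5)"

fun twist :: "nat \<times> nat \<Rightarrow> nat \<times> nat \<Rightarrow> nat \<times> nat" where
  "twist (k, c) (j, x) = ((j + k) mod 12, (2 ^ (k mod 4) * x + c) mod 5)"

fun quot :: "nat \<times> nat \<Rightarrow> nat \<times> nat" where
  "quot (j, x) = (j mod 4, x)"

definition track :: "bool \<Rightarrow> ((nat \<times> nat) \<times> (nat \<times> nat)) set" where
  "track b = {(q, q'). q \<in> wheel \<and> (q' = roll b q \<or> q' = unroll b q)}"

lemma mod4_cases: "(j::nat) mod 4 = 0 \<or> j mod 4 = 1 \<or> j mod 4 = 2 \<or> j mod 4 = 3"
  by presburger

lemma roll_wheel:
  assumes "q \<in> wheel"
  shows "roll b q \<in> wheel" "unroll b q \<in> wheel" "unroll b (roll b q) = q" "roll b (unroll b q) = q"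
proof -
  obtain j x where q: "q = (j, x)" "j < 12" "x < 5" using assms by (auto simp: wheel_def)
  show "roll b q \<in> wheel" "unroll b q \<in> wheel" unfolding q by (auto simp: wheel_def)
  have j: "j \<in> set [0..<12]" and x: "x \<in> set [0..<5]" using q by auto
  have "\<forall>j \<in> set [0..<12]. \<forall>x \<in> set [0..<5]. \<forall>b \<in> set [False, True].
    unroll b (roll b (j, x)) = (j, x) \<and> roll b (unroll b (j, x)) = (j, x)"
    by code_simp
  then show "unroll b (roll b q) = q" "roll b (unroll b q) = q"
    unfolding q(1) using j x mem_bool[of b] by blast+
qed

lemma quot_roll:
  assumes "q \<in> wheel"
  shows "quot (roll b q) = turn b (quot q)" "quot (unroll b q) = unturn b (quot q)" "quot q \<in> set grid"
proof -
  obtain j x where q: "q = (j, x)" "j < 12" "x < 5" using assms by (auto simp: wheel_def)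
  show g: "quot q \<in> set grid" using q by (simp add: grid_def)
  have m: "k mod 12 mod 4 = k mod 4" for k :: nat by (rule mod_mod_cancel) simp
  have t: "quot (roll b u) = turn b (quot u)" for u
  proof (cases u)
    case (Pair j x)
    have "(j + 9) mod 4 = (j mod 4 + 1) mod 4" "(j + 1) mod 4 = (j mod 4 + 1) mod 4" by presburger+
    then show ?thesis using Pair by (simp add: turn.simps m)
  qed
  show "quot (roll b q) = turn b (quot q)" by (rule t)
  have "quot q = turn b (quot (unroll b q))"
    using t[of "unroll b q"] roll_wheel(4)[OF assms] by simp
  moreover have "quot (unroll b q) \<in> set grid" unfolding q(1) by (auto simp: grid_def)
  ultimately show "quot (unroll b q) = unturn b (quot q)" using turn_grid(3) by metis
qed

text \<open>Left multiplication commutes with right multiplication. The computation rests on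
  \<open>2^4 = 1\<close> modulo 5, which lets exponents be taken modulo 4.\<close>

lemma twist_wheel:
  assumes "s \<in> wheel" "q \<in> wheel"
  shows "twist s q \<in> wheel" "twist s (roll b q) = roll b (twist s q)" "twist s (unroll b q) = unroll b (twist s q)"
proof -
  obtain j x where q: "q = (j, x)" "j < 12" "x < 5" using assms by (auto simp: wheel_def)
  obtain k c where s: "s = (k, c)" "k < 12" "c < 5" using assms by (auto simp: wheel_def)
  show w: "twist s u \<in> wheel" for u unfolding s(1) by (cases u) (auto simp: wheel_def)
  have r: "twist s (roll b u) = roll b (twist s u)" for u
  proof (cases u)
    case (Pair j x)
    have m: "(i mod 12) mod 4 = i mod 4" for i :: nat by (rule mod_mod_cancel) simp
    have e: "(2 ^ (k mod 4) * ((x + 2 ^ (j mod 4)) mod 5) + c) mod 5 = ((2 ^ (k mod 4) * x + c) mod 5 + 2 ^ ((j + k) mod 4)) mod 5"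
    proof -
      have "(2::nat) ^ (k mod 4) * 2 ^ (j mod 4) mod 5 = 2 ^ ((j + k) mod 4) mod 5"
        using mod4_cases[of j] mod4_cases[of k] by (auto simp: mod_add_eq[of j 4 k, symmetric])
      then have "(2 ^ (k mod 4) * x + c + 2 ^ (k mod 4) * 2 ^ (j mod 4)) mod 5 = (2 ^ (k mod 4) * x + c + 2 ^ ((j + k) mod 4)) mod 5"
        by (rule mod_add_cong[OF refl])
      moreover have "(2 ^ (k mod 4) * ((x + 2 ^ (j mod 4)) mod 5) + c) mod 5 = (2 ^ (k mod 4) * (x + 2 ^ (j mod 4)) + c) mod 5"
        by (metis mod_add_left_eq mod_mult_right_eq)
      ultimately have "(2 ^ (k mod 4) * ((x + 2 ^ (j mod 4)) mod 5) + c) mod 5 = (2 ^ (k mod 4) * x + c + 2 ^ ((j + k) mod 4)) mod 5"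
        by (simp add: algebra_simps)
      then show ?thesis by (simp only: mod_add_left_eq)
    qed
    have f: "(2 ^ (k mod 4) * (x mod 5) + c) mod 5 = (2 ^ (k mod 4) * x + c) mod 5 mod 5"
      by (metis mod_add_left_eq mod_mod_trivial mod_mult_right_eq)
    have i: "((j + a) mod 12 + k) mod 12 = ((j + k) mod 12 + a) mod 12" for a by presburger
    show ?thesis unfolding Pair s(1) using e f i[of 9] i[of 1] by (cases b) (simp_all add: m)
  qed
  show "twist s (roll b q) = roll b (twist s q)" by (rule r)
  have "twist s q = roll b (twist s (unroll b q))"
    using r[of "unroll b q"] roll_wheel(4)[OF assms(2)] by simp
  then show "twist s (unroll b q) = unroll b (twist s q)" using roll_wheel(3)[OF w] by metis
qed

definition wheel_graph :: "(nat \<times> nat) pair_pre_digraph" where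
  "wheel_graph = \<lparr>pverts = wheel, parcs = track False \<union> track True\<rparr>"

declare roll.simps [simp del] unroll.simps [simp del] twist.simps [simp del] quot.simps [simp del]

section \<open>The Cayley graph of order 60\<close>

lemma wheel_graph_simps [simp]: "pverts wheel_graph = wheel" "parcs wheel_graph = track False \<union> track True"
  by (simp_all add: wheel_graph_def)

lemma track_arc: "(u, v) \<in> track b \<Longrightarrow> (u, v) \<in> parcs wheel_graph"
  by (cases b) auto

lemma arc_track: "(u, v) \<in> parcs wheel_graph \<Longrightarrow> \<exists>b. (u, v) \<in> track b"
  by auto

lemma track_wheel: "(u, v) \<in> track b \<Longrightarrow> u \<in> wheel \<and> v \<in> wheel"
  by (auto simp: track_def roll_wheel)

lemma track_sym: "(u, v) \<in> track b \<Longrightarrow> (v, u) \<in> track b"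
  by (auto simp: track_def roll_wheel)

lemma track_spin: "(u, v) \<in> track b \<Longrightarrow> (quot u, quot v) \<in> spin b"
  by (auto simp: track_def spin_def quot_roll)

lemma track_twist: "s \<in> wheel \<Longrightarrow> (u, v) \<in> track b \<Longrightarrow> (twist s u, twist s v) \<in> track b"
  by (auto simp: track_def twist_wheel)

lemma twist_origin: "v \<in> wheel \<Longrightarrow> twist v (0, 0) = v"
  by (auto simp: wheel_def twist.simps)

lemma origin_wheel: "(0, 0) \<in> wheel"
  by (simp add: wheel_def)

lemma wheel_graph_graph: "pair_graph wheel_graph"
proof (rule pair_graphI)
  show "finite (pverts wheel_graph)" by (simp add: wheel_def)
  show "parcs wheel_graph \<subseteq> pverts wheel_graph \<times> pverts wheel_graph"
    using track_wheel[of _ _ False] track_wheel[of _ _ True] by auto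
  show "sym (parcs wheel_graph)" by (rule symI) (auto dest: track_sym)
  have "(u, u) \<notin> track b" for u b using track_spin[of u u b] turn_grid(5,6)[of "quot u" b] by (auto simp: spin_def)
  then show "irrefl (parcs wheel_graph)" by (auto simp: irrefl_def)
qed

lemma twist_aut:
  assumes s: "s \<in> wheel"
  shows "\<exists>g \<in> graph_aut wheel_graph. \<forall>v \<in> wheel. g v = twist s v"
proof -
  have "finite wheel" by (simp add: wheel_def)
  have sub: "twist s ` wheel \<subseteq> wheel" using twist_wheel(1)[OF s] by blast
  moreover have "inj_on (twist s) wheel"
  proof (rule inj_onI)
    fix u v assume uv: "u \<in> wheel" "v \<in> wheel" "twist s u = twist s v"
    obtain k c j x i y where e: "s = (k, c)" "u = (j, x)" "v = (i, y)" by (metis surj_pair)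
    have lt: "j < 12" "i < 12" "x < 5" "y < 5" using uv e by (auto simp: wheel_def)
    have "[j + k = i + k] (mod 12)"
      using uv(3) e by (simp add: twist.simps cong_def)
    then have "j = i"
      using lt cong_less_modulus_unique_nat[of j i 12] by (simp add: cong_add_rcancel_nat)
    have "[2 ^ (k mod 4) * x + c = 2 ^ (k mod 4) * y + c] (mod 5)"
      using uv(3) e by (simp add: twist.simps cong_def)
    then have "[2 ^ (k mod 4) * x = 2 ^ (k mod 4) * y] (mod 5)" by (simp add: cong_add_rcancel_nat)
    moreover have "coprime ((2::nat) ^ (k mod 4)) 5" by simp
    ultimately have "[x = y] (mod 5)" by (simp add: cong_mult_lcancel_nat)
    then have "x = y" using lt cong_less_modulus_unique_nat[of x y 5] by simp
    then show "u = v" using e \<open>j = i\<close> by simp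
  qed
  moreover have "(twist s u, twist s v) \<in> parcs wheel_graph" if uv: "(u, v) \<in> parcs wheel_graph" for u v
  proof -
    obtain b where "(u, v) \<in> track b" using arc_track[OF uv] by blast
    then show ?thesis by (rule track_arc[OF track_twist[OF s]])
  qed
  ultimately show ?thesis
    using graph_autI_exists[OF wheel_graph_graph, of "twist s"] unfolding wheel_graph_simps(1) by blast
qed

lemma wheel_graph_vtg: "vtg wheel_graph"
proof (rule vtgI[OF wheel_graph_graph])
  let ?R = "(parcs wheel_graph)\<^sup>*"
  have "((0, 0), roll False (0, 0)) \<in> track False" using origin_wheel by (simp add: track_def)
  then show "parcs wheel_graph \<noteq> {}" by auto
  fix u v assume uv: "u \<in> pverts wheel_graph" "v \<in> pverts wheel_graph"
  obtain g h where g: "g \<in> graph_aut wheel_graph" "g (0, 0) = u" and h: "h \<in> graph_aut wheel_graph" "h (0, 0) = v"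
    using twist_aut[of u] twist_aut[of v] twist_origin origin_wheel uv by (metis wheel_graph_simps(1))
  have "(h \<circ> inv g) \<in> graph_aut wheel_graph" using graph_aut_comp[OF graph_aut_inv[OF g(1)] h(1)] .
  moreover have "(h \<circ> inv g) u = v" using g h graph_autD(2)[OF g(1)] by (metis comp_apply inv_f_f)
  ultimately show "\<exists>f\<in>graph_aut wheel_graph. f u = v" by blast
next
  let ?R = "(parcs wheel_graph)\<^sup>*"
  fix v assume v: "v \<in> pverts wheel_graph"
  have step: "(u, roll b u) \<in> ?R" if "u \<in> wheel" for u b
    using track_arc[of u "roll b u" b] that by (auto simp: track_def intro!: r_into_rtrancl)
  have w: "(j, x) \<in> wheel \<longleftrightarrow> j < 12 \<and> x < 5" for j x by (auto simp: wheel_def)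
  have x0: "((0, 0), (0, x)) \<in> ?R" if "x < 5" for x
    using that
  proof (induction x)
    case (Suc x)
    \<comment> \<open>The second generator raises \<open>x\<close> and goes to level 9; three rolls
      with the first generator return to level 0.\<close>
    have "roll True (0, x) = (9, Suc x)" "roll False (9, Suc x) = (10, Suc x)" "roll False (10, Suc x) = (11, Suc x)"
      "roll False (11, Suc x) = (0, Suc x)" using Suc.prems by (simp_all add: roll.simps)
    then have "((0, x), (9, Suc x)) \<in> ?R" "((9, Suc x), (10, Suc x)) \<in> ?R" "((10, Suc x), (11, Suc x)) \<in> ?R"
      "((11, Suc x), (0, Suc x)) \<in> ?R"
      using step[of "(0, x)" True] step[of "(9, Suc x)" False] step[of "(10, Suc x)" False] step[of "(11, Suc x)" False]
        Suc.prems w by auto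
    then show ?case using Suc by (meson Suc_lessD rtrancl_trans)
  qed simp
  have "((0, x), (j, x)) \<in> ?R" if "j < 12" "x < 5" for j x
    using that
  proof (induction j)
    case (Suc j)
    have "roll False (j, x) = (Suc j, x)" using Suc.prems by (simp add: roll.simps)
    then have "((j, x), (Suc j, x)) \<in> ?R" using step[of "(j, x)" False] w Suc.prems by auto
    then show ?case using Suc by (meson Suc_lessD rtrancl_trans)
  qed simp
  then show "((0, 0), v) \<in> ?R" using x0 v w by (cases v) (auto intro: rtrancl_trans)
qed

section \<open>4-cycles tell the generators apart\<close>

definition near :: "nat \<times> nat \<Rightarrow> (nat \<times> nat) list" where
  "near q = [roll False q, unroll False q, roll True q, unroll True q]"

lemma arc_near: "(u, v) \<in> parcs wheel_graph \<longleftrightarrow> u \<in> wheel \<and> v \<in> set (near u)"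
  by (auto simp: track_def near_def)

lemma square_near:
  assumes "w \<in> wheel"
  shows "in_square wheel_graph w v w' \<longleftrightarrow> (\<exists>u \<in> set (near w). u \<noteq> v \<and> w' \<in> set (near u))"
proof -
  have "u \<in> wheel" if "u \<in> set (near w)" for u using that roll_wheel[OF assms] by (auto simp: near_def)
  then show ?thesis unfolding in_square_def arc_near using assms by blast
qed

lemma origin_squares:
  "\<forall>w \<in> set [roll False (0, 0), unroll False (0, 0)]. \<forall>w' \<in> set (near (0, 0)). w' \<noteq> w \<longrightarrow>
     \<not> (\<exists>u \<in> set (near w). u \<noteq> (0, 0) \<and> w' \<in> set (near u))"
  "\<exists>u \<in> set (near (roll True (0, 0))). u \<noteq> (0, 0) \<and> unroll True (0, 0) \<in> set (near u)"
  "\<exists>u \<in> set (near (unroll True (0, 0))). u \<noteq> (0, 0) \<and> roll True (0, 0) \<in> set (near u)"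
  "unroll True (0, 0) \<noteq> roll True (0, 0)"
  by (simp_all add: near_def roll.simps unroll.simps)

definition squarable :: "nat \<times> nat \<Rightarrow> nat \<times> nat \<Rightarrow> bool" where
  "squarable v w \<longleftrightarrow> (\<exists>w'. (v, w') \<in> parcs wheel_graph \<and> w' \<noteq> w \<and> in_square wheel_graph w v w')"

lemma squarable_aut:
  assumes f: "f \<in> graph_aut wheel_graph"
  shows "squarable (f v) (f w) \<longleftrightarrow> squarable v w"
proof -
  have imp: "squarable (f v) (f w)" if f: "f \<in> graph_aut wheel_graph" and s: "squarable v w" for f v w
  proof -
    obtain w' where "(v, w') \<in> parcs wheel_graph" "w' \<noteq> w" "in_square wheel_graph w v w'"
      using s unfolding squarable_def by blast
    then show ?thesis unfolding squarable_def
      using graph_aut_arc_iff[OF wheel_graph_graph f] in_square_aut[OF wheel_graph_graph f] inj_eq[OF graph_autD(2)[OF f]]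
      by (intro exI[of _ "f w'"]) simp
  qed
  show ?thesis using graph_aut_iffI[OF f, of "\<lambda>u v w. squarable v w"] imp by blast
qed

text \<open>The second generator has order 4, so its arcs lie on 4-cycles with arcs of the same
  kind; arcs of the first generator lie on no 4-cycle at all. By the action of \<open>twist\<close>
  the origin suffices.\<close>

lemma track_squarable:
  assumes "(v, w) \<in> track b"
  shows "squarable v w \<longleftrightarrow> b"
proof -
  have v: "v \<in> wheel" using track_wheel assms by blast
  obtain g where g: "g \<in> graph_aut wheel_graph" "\<forall>v' \<in> wheel. g v' = twist v v'" using twist_aut[OF v] by blast
  have r: "roll c (0, 0) \<in> wheel" "unroll c (0, 0) \<in> wheel" for c using roll_wheel origin_wheel by blast+
  have "w = roll b v \<or> w = unroll b v" using assms by (simp add: track_def)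
  then obtain w0 where w0: "w0 \<in> set [roll b (0, 0), unroll b (0, 0)]" "w = twist v w0"
    using twist_wheel(2,3)[OF v origin_wheel] twist_origin[OF v] by (metis list.set_intros)
  then have "v = g (0, 0)" "w = g w0" using g(2) r origin_wheel twist_origin[OF v] by auto
  then have "squarable v w \<longleftrightarrow> squarable (0, 0) w0" using squarable_aut[OF g(1)] by simp
  also have "\<dots> \<longleftrightarrow> b"
  proof (cases b)
    case True
    then have "w0 = roll True (0, 0) \<or> w0 = unroll True (0, 0)" using w0(1) by auto
    moreover have "squarable (0, 0) (roll True (0, 0))"
      unfolding squarable_def square_near[OF r(1)] arc_near
      using origin_squares(2,4) origin_wheel by (intro exI[of _ "unroll True (0, 0)"]) (auto simp: near_def)
    moreover have "squarable (0, 0) (unroll True (0, 0))"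
      unfolding squarable_def square_near[OF r(2)] arc_near
      using origin_squares(3,4) origin_wheel by (intro exI[of _ "roll True (0, 0)"]) (auto simp: near_def)
    ultimately show ?thesis using True by auto
  next
    case False
    then have w: "w0 \<in> set [roll False (0, 0), unroll False (0, 0)]" using w0(1) by auto
    then have "w0 \<in> wheel" using r by auto
    have "\<not> squarable (0, 0) w0"
    proof
      assume "squarable (0, 0) w0"
      then obtain w' where w': "((0, 0), w') \<in> parcs wheel_graph" "w' \<noteq> w0" "in_square wheel_graph w0 (0, 0) w'"
        unfolding squarable_def by blast
      have "w' \<in> set (near (0, 0))" using w'(1) unfolding arc_near by blast
      moreover have "\<exists>u \<in> set (near w0). u \<noteq> (0, 0) \<and> w' \<in> set (near u)"
        using w'(3) square_near[OF \<open>w0 \<in> wheel\<close>] by blast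
      ultimately show False using origin_squares(1) w w'(2) by blast
    qed
    then show ?thesis using False by simp
  qed
  finally show ?thesis .
qed

definition heads :: "bool \<Rightarrow> nat \<times> nat \<Rightarrow> nat \<times> nat \<Rightarrow> bool" where
  "heads b q q' \<longleftrightarrow> (q, q') \<in> track b \<and> (\<exists>q2 q3 q4 q5. (q', q2) \<in> track (\<not> b) \<and>
     (q2, q3) \<in> track (\<not> b) \<and> (q3, q4) \<in> track b \<and> (q4, q5) \<in> track b \<and> (q5, q) \<in> track (\<not> b))"

text \<open>A closed walk projects to the quotient, where a backward start is impossible by
  \<open>heading_iff\<close>. Conversely the relation used there still holds in the larger
  group.\<close>

lemma heads_iff:
  assumes q: "q \<in> wheel"
  shows "heads b q q' \<longleftrightarrow> q' = roll b q"
proof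
  assume h: "heads b q q'"
  then obtain q2 q3 q4 q5 where w: "(q, q') \<in> track b" "(q', q2) \<in> track (\<not> b)" "(q2, q3) \<in> track (\<not> b)"
    "(q3, q4) \<in> track b" "(q4, q5) \<in> track b" "(q5, q) \<in> track (\<not> b)" unfolding heads_def by blast
  have "heading b (quot q) (quot q')" using w[THEN track_spin] unfolding heading_def by blast
  then have "quot q' = turn b (quot q)" using heading_iff quot_roll(3)[OF q] by blast
  then have "q' \<noteq> unroll b q" using quot_roll(2,3)[OF q] turn_grid(7) by metis
  then show "q' = roll b q" using w(1) by (simp add: track_def)
next
  assume q': "q' = roll b q"
  \<comment> \<open>The relation of \<open>headings_origin\<close>. Three forward rolls with
    \<open>b\<close> and three backward with \<open>\<not> b\<close> change the level by
    \<open>3*9 - 3*1 = 24\<close> up to sign, which is 0 modulo 12.\<close>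
  let ?c = "\<lambda>u. unroll (\<not> b) (roll b (roll b (unroll (\<not> b) (unroll (\<not> b) (roll b u)))))"
  have "?c (0, 0) = (0, 0)" by (cases b) (simp_all add: roll.simps unroll.simps)
  moreover have "?c (twist q (0, 0)) = twist q (?c (0, 0))"
    using twist_wheel[OF q] roll_wheel origin_wheel by simp
  ultimately have c: "?c q = q" using twist_origin[OF q] by simp
  have W: "roll b q \<in> wheel" "unroll (\<not> b) (roll b q) \<in> wheel" "unroll (\<not> b) (unroll (\<not> b) (roll b q)) \<in> wheel"
    "roll b (unroll (\<not> b) (unroll (\<not> b) (roll b q))) \<in> wheel"
    "roll b (roll b (unroll (\<not> b) (unroll (\<not> b) (roll b q)))) \<in> wheel"
    by (simp_all add: roll_wheel(1,2) q)
  show "heads b q q'"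
    unfolding heads_def q'
  proof (intro conjI exI)
    show "(q, roll b q) \<in> track b" "(roll b q, unroll (\<not> b) (roll b q)) \<in> track (\<not> b)"
      "(unroll (\<not> b) (roll b q), unroll (\<not> b) (unroll (\<not> b) (roll b q))) \<in> track (\<not> b)"
      "(unroll (\<not> b) (unroll (\<not> b) (roll b q)), roll b (unroll (\<not> b) (unroll (\<not> b) (roll b q)))) \<in> track b"
      "(roll b (unroll (\<not> b) (unroll (\<not> b) (roll b q))), roll b (roll b (unroll (\<not> b) (unroll (\<not> b) (roll b q))))) \<in> track b"
      using q W unfolding track_def by simp_all
    show "(roll b (roll b (unroll (\<not> b) (unroll (\<not> b) (roll b q)))), q) \<in> track (\<not> b)"
      using W(5) c unfolding track_def by simp
  qed
qed

text \<open>Automorphisms preserve the generator of an arc by \<open>squarable\<close>, hence also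
  its direction by \<open>heads\<close>. So each generator gives two orbits of valency 1, paired
  with each other.\<close>

lemma realized_two_pairs: "realized ({#}, {#1, 1#})"
proof -
  have tr: "(f u, f v) \<in> track b" if f: "f \<in> graph_aut wheel_graph" and uv: "(u, v) \<in> track b" for f u v b
  proof -
    have "(f u, f v) \<in> parcs wheel_graph"
      using graph_aut_arc_iff[OF wheel_graph_graph f] track_arc[OF uv] by blast
    then obtain b' where b': "(f u, f v) \<in> track b'" using arc_track by blast
    have "b' = b" using track_squarable[OF b'] track_squarable[OF uv] squarable_aut[OF f] by blast
    then show ?thesis using b' by simp
  qed
  define D where "D b = {(q, roll b q) | q. q \<in> wheel}" for b
  have D_iff: "(u, v) \<in> D b \<longleftrightarrow> u \<in> wheel \<and> heads b u v" for u v b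
    unfolding D_def using heads_iff by blast
  have D_track: "D b \<subseteq> track b" for b unfolding D_def track_def by blast
  have inv: "(f u, f v) \<in> D b" if f: "f \<in> graph_aut wheel_graph" and uv: "(u, v) \<in> D b" for f u v b
  proof -
    have "heads b u v" "f u \<in> wheel" using uv graph_autD(1)[OF f] D_iff by auto
    then show ?thesis using tr[OF f] unfolding D_iff heads_def by blast
  qed
  have orb: "D b \<in> arc_orbits wheel_graph" "orbit_valency wheel_graph (D b) = 1" for b
  proof -
    have sub: "D b \<subseteq> parcs wheel_graph"
      by (rule subrelI, rule track_arc, rule subsetD[OF D_track])
    have fn: "\<exists>!w. (v, w) \<in> D b" if "v \<in> pverts wheel_graph" for v
      using that heads_iff unfolding D_iff by auto
    show "D b \<in> arc_orbits wheel_graph" "orbit_valency wheel_graph (D b) = 1"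
      using functional_orbit[where D = "D b", OF wheel_graph_vtg sub] inv fn by blast+
  qed
  have conv: "(D b)\<inverse> \<in> arc_orbits wheel_graph" for b
    using arc_orbits_converse[OF wheel_graph_graph orb(1)] .
  have neq: "(D b)\<inverse> \<noteq> D b" for b
  proof
    assume eq: "(D b)\<inverse> = D b"
    have "((0, 0), roll b (0, 0)) \<in> D b" using origin_wheel unfolding D_def by blast
    then have "(roll b (0, 0), (0, 0)) \<in> D b" using eq by blast
    then have "(0, 0) = roll b (roll b (0, 0))" unfolding D_def by blast
    then show False by (cases b) (simp_all add: roll.simps)
  qed
  have tconv: "(D b)\<inverse> \<subseteq> track b" for b using D_track track_sym by blast
  have tdisj: "track False \<inter> track True = {}"
  proof -
    have "(u, v) \<notin> track True" if "(u, v) \<in> track False" for u v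
      using track_squarable[OF that] track_squarable[of u v True] by blast
    then show ?thesis by auto
  qed
  have cover: "track b \<subseteq> D b \<union> (D b)\<inverse>" for b
  proof
    fix e assume "e \<in> track b"
    then obtain q where q: "q \<in> wheel" "e = (q, roll b q) \<or> e = (q, unroll b q)" unfolding track_def by blast
    have u: "unroll b q \<in> wheel" "roll b (unroll b q) = q" using roll_wheel[OF q(1)] by auto
    have "(v, roll b v) \<in> D b" if "v \<in> wheel" for v using that unfolding D_def by blast
    from this[OF q(1)] this[OF u(1)] show "e \<in> D b \<union> (D b)\<inverse>" using q(2) u(2) by auto
  qed
  have "arc_orbits wheel_graph = {D False, (D False)\<inverse>} \<union> {D True, (D True)\<inverse>}"
  proof (rule arc_orbits_eqI[OF _ _ wheel_graph_graph])
    show "{D False, (D False)\<inverse>} \<union> {D True, (D True)\<inverse>} \<subseteq> arc_orbits wheel_graph"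
      using orb(1) conv by simp
    have "\<Union> ({D False, (D False)\<inverse>} \<union> {D True, (D True)\<inverse>}) =
        (D False \<union> (D False)\<inverse>) \<union> (D True \<union> (D True)\<inverse>)" by blast
    then show "parcs wheel_graph \<subseteq> \<Union> ({D False, (D False)\<inverse>} \<union> {D True, (D True)\<inverse>})"
      unfolding wheel_graph_simps(2) using cover[of False] cover[of True] by (simp only: Un_mono)
  qed
  moreover have disj: "{D False, (D False)\<inverse>} \<inter> {D True, (D True)\<inverse>} = {}"
  proof -
    have sub: "D' \<subseteq> track b" "D' \<noteq> {}" if "D' \<in> {D b, (D b)\<inverse>}" for D' b
    proof -
      have "((0, 0), roll b (0, 0)) \<in> D b" using origin_wheel unfolding D_def by blast
      then have "D b \<noteq> {}" by blast
      then show "D' \<subseteq> track b" "D' \<noteq> {}" using that D_track[of b] tconv[of b] by auto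
    qed
    have "D1 \<noteq> D2" if "D1 \<in> {D False, (D False)\<inverse>}" "D2 \<in> {D True, (D True)\<inverse>}" for D1 D2
    proof
      assume "D1 = D2"
      then have "D1 \<subseteq> track False \<inter> track True" using sub(1)[OF that(1)] sub(1)[OF that(2)] by simp
      then show False using sub(2)[OF that(1)] tdisj by simp
    qed
    then show ?thesis by (rule disjoint_iff_not_equal[THEN iffD2, rule_format])
  qed
  have "family_type (orbit_valency wheel_graph) ({D False, (D False)\<inverse>} \<union> {D True, (D True)\<inverse>}) =
      family_type (orbit_valency wheel_graph) {D False, (D False)\<inverse>} +
      family_type (orbit_valency wheel_graph) {D True, (D True)\<inverse>}"
    by (rule family_type_union[OF _ _ disj]) auto
  ultimately have "arc_type wheel_graph = family_type (orbit_valency wheel_graph) {D False, (D False)\<inverse>} +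
      family_type (orbit_valency wheel_graph) {D True, (D True)\<inverse>}"
    unfolding arc_type_family by (simp only:)
  moreover have "family_type (orbit_valency wheel_graph) {D b, (D b)\<inverse>} = ({#}, {#1#})" for b
    using family_type_pair[where val = "orbit_valency wheel_graph", OF neq]
      orbit_valency_converse[OF wheel_graph_graph vtgD(2)[OF wheel_graph_vtg] orb(1)] orb(2) by simp
  ultimately have type: "arc_type wheel_graph = ({#}, {#1, 1#})" by simp
  have "unsquared wheel_graph"
    unfolding unsquared_def
  proof (intro ballI, clarify)
    fix v w assume "(v, w) \<in> parcs wheel_graph"
    then obtain b where b: "(v, w) \<in> track b" using arc_track by blast
    have v: "v \<in> wheel" using track_wheel b by blast
    show "\<exists>w'. (v, w') \<in> parcs wheel_graph \<and> w' \<noteq> w \<and> \<not> in_square wheel_graph w v w'"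
    proof (cases b)
      case True
      have a: "(v, roll False v) \<in> track False" using v by (simp add: track_def)
      have ne: "roll False v \<noteq> w" using a b True tdisj by auto
      \<comment> \<open>Such a 4-cycle would pass through an arc of the first generator.\<close>
      have "\<not> in_square wheel_graph w v (roll False v)"
      proof
        assume "in_square wheel_graph w v (roll False v)"
        then obtain u where "u \<noteq> v" "(w, u) \<in> parcs wheel_graph" "(u, roll False v) \<in> parcs wheel_graph"
          unfolding in_square_def by blast
        then have "in_square wheel_graph (roll False v) v w"
          using pair_graphD(5)[OF wheel_graph_graph] unfolding in_square_def by blast
        then have "squarable v (roll False v)"
          unfolding squarable_def using track_arc[OF b] ne by (intro exI[of _ w]) simp
        then show False using track_squarable[OF a] by simp
      qed
      then show ?thesis using track_arc[OF a] ne by (intro exI[of _ "roll False v"]) simp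
    next
      case False
      have a: "(v, roll True v) \<in> track True" using v by (simp add: track_def)
      have ne: "roll True v \<noteq> w" using a b False tdisj by auto
      have "\<not> squarable v w" using track_squarable[OF b] False by simp
      moreover have "squarable v w" if "in_square wheel_graph w v (roll True v)"
        unfolding squarable_def using track_arc[OF a] ne that by (intro exI[of _ "roll True v"]) simp
      ultimately have "\<not> in_square wheel_graph w v (roll True v)" by blast
      then show ?thesis using track_arc[OF a] ne by (intro exI[of _ "roll True v"]) simp
    qed
  qed
  moreover have "bipartition wheel_graph (\<lambda>q. even (fst q))"
  proof -
    have "even (fst q) \<noteq> even (fst q')" if t: "(q, q') \<in> track b" for q q' b
    proof -
      have "even (fst (quot q)) \<noteq> even (fst (quot q'))" using even_spin[OF track_spin[OF t]] .
      moreover have "even (fst (quot u)) \<longleftrightarrow> even (fst u)" for u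
      proof (cases u)
        case (Pair j x)
        have "even (j mod 4) \<longleftrightarrow> even j" by presburger
        then show ?thesis using Pair by (simp add: quot.simps)
      qed
      ultimately show ?thesis by simp
    qed
    then show ?thesis unfolding bipartition_def wheel_graph_simps(2) by auto
  qed
  ultimately show ?thesis using realizedI[OF wheel_graph_vtg] type by force
qed

section \<open>Three ones\<close>

text \<open>The Haar graph of the integers modulo 10 with labels 0, 1, 3: a label is added on one
  side and subtracted on the other, so each \<open>hop c\<close> is an involution.\<close>

fun hop :: "nat \<Rightarrow> bool \<times> nat \<Rightarrow> bool \<times> nat" where
  "hop c (b, x) = (\<not> b, (if b then x + 10 - c else x + c) mod 10)"

text \<open>The dihedral group of order 20 acting regularly: translations keep the sides, the maps
  \<open>x |-> k - x\<close> exchange them and so turn addition of a label into subtraction.\<close>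

fun slide :: "bool \<times> nat \<Rightarrow> bool \<times> nat \<Rightarrow> bool \<times> nat" where
  "slide (s, k) (b, x) = (b \<noteq> s, (if s then k + 10 - x else k + x) mod 10)"

definition haar_list :: "(bool \<times> nat) list" where
  "haar_list = List.product [False, True] [0..<10]"

definition haar :: "(bool \<times> nat) pair_pre_digraph" where
  "haar = \<lparr>pverts = set haar_list, parcs = {(v, hop c v) | v c. v \<in> set haar_list \<and> c \<in> set [0, 1, 3]}\<rparr>"

definition hops :: "bool \<times> nat \<Rightarrow> (bool \<times> nat) list" where
  "hops v = [hop 0 v, hop 1 v, hop 3 v]"

lemma hop_facts:
  "\<forall>v \<in> set haar_list. fst (hop 0 v) = (\<not> fst v) \<and> fst (hop 1 v) = (\<not> fst v) \<and> fst (hop 3 v) = (\<not> fst v) \<and>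
     (\<forall>c \<in> set [0, 1, 3]. hop c v \<in> set haar_list \<and> hop c (hop c v) = v)"
  by code_simp

lemma slide_facts:
  "\<forall>s \<in> set haar_list. \<forall>v \<in> set haar_list. slide s v \<in> set haar_list \<and> slide s (False, 0) = s \<and>
     (\<forall>c \<in> set [0, 1, 3]. slide s (hop c v) = hop c (slide s v))"
  by code_simp

lemma slide_inv:
  "\<forall>s \<in> set haar_list. \<forall>v \<in> set haar_list. slide (fst s, if fst s then snd s else 10 - snd s) (slide s v) = v"
  by code_simp

lemma haar_simps [simp]: "pverts haar = set haar_list"
  by (simp add: haar_def)

declare hop.simps [simp del] slide.simps [simp del]

lemma haar_arc: "(u, v) \<in> parcs haar \<longleftrightarrow> u \<in> set haar_list \<and> v \<in> set (hops u)"
  unfolding haar_def hops_def by (auto simp del: split_paired_Ex)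

lemma haar_hop: "(u, v) \<in> parcs haar \<longleftrightarrow> u \<in> set haar_list \<and> (\<exists>c \<in> set [0, 1, 3]. v = hop c u)"
  unfolding haar_def by (auto simp del: split_paired_Ex)

lemma haar_graph: "pair_graph haar"
proof (rule pair_graphI)
  show "finite (pverts haar)" by simp
  have 1: "u \<in> set haar_list \<and> v \<in> set haar_list \<and> (v, u) \<in> parcs haar \<and> u \<noteq> v" if uv: "(u, v) \<in> parcs haar" for u v
  proof -
    obtain c where c: "u \<in> set haar_list" "c \<in> set [0, 1, 3]" "v = hop c u" using uv haar_hop by blast
    have v: "v \<in> set haar_list" "hop c v = u" using hop_facts c by blast+
    have "fst v = (\<not> fst u)" using hop_facts[rule_format, OF c(1)] c(2,3) by auto
    then have "u \<noteq> v" by auto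
    moreover have "(v, u) \<in> parcs haar" using v c(2) haar_hop by blast
    ultimately show ?thesis using c(1) v(1) by blast
  qed
  show "parcs haar \<subseteq> pverts haar \<times> pverts haar" using 1 by auto
  show "sym (parcs haar)" by (rule symI) (use 1 in blast)
  show "irrefl (parcs haar)" unfolding irrefl_def using 1 by blast
qed

lemma slide_aut:
  assumes s: "s \<in> set haar_list"
  shows "\<exists>g \<in> graph_aut haar. \<forall>v \<in> set haar_list. g v = slide s v"
proof -
  have sub: "slide s ` pverts haar \<subseteq> pverts haar" using slide_facts s by (simp add: image_subset_iff)
  have inj: "inj_on (slide s) (pverts haar)"
    by (rule inj_on_inverseI[of _ "slide (fst s, if fst s then snd s else 10 - snd s)"])
      (use slide_inv s in simp)
  have "(slide s u, slide s v) \<in> parcs haar" if uv: "(u, v) \<in> parcs haar" for u v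
  proof -
    obtain c where c: "u \<in> set haar_list" "c \<in> set [0, 1, 3]" "v = hop c u" using uv haar_hop by blast
    then have "slide s u \<in> set haar_list" "slide s v = hop c (slide s u)" using slide_facts s by blast+
    then show ?thesis using c(2) haar_hop by blast
  qed
  then show ?thesis using graph_autI_exists[OF haar_graph sub inj] by simp
qed

lemma haar_origin: "(False, 0) \<in> set haar_list"
  by (simp add: haar_list_def)

lemma haar_vtg: "vtg haar"
proof (rule vtgI[OF haar_graph])
  have "((False, 0), hop 0 (False, 0)) \<in> parcs haar" unfolding haar_hop using haar_origin by simp
  then show "parcs haar \<noteq> {}" by blast
  fix u v assume uv: "u \<in> pverts haar" "v \<in> pverts haar"
  have ex: "\<exists>g \<in> graph_aut haar. g (False, 0) = w" if w: "w \<in> set haar_list" for w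
  proof -
    obtain g where g: "g \<in> graph_aut haar" "\<forall>v \<in> set haar_list. g v = slide w v" using slide_aut[OF w] by blast
    have "slide w (False, 0) = w" using slide_facts w haar_origin by blast
    then have "g (False, 0) = w" using bspec[OF g(2) haar_origin] by simp
    then show ?thesis using g(1) by blast
  qed
  obtain g where g: "g \<in> graph_aut haar" "g (False, 0) = u" using ex[of u] uv(1) unfolding haar_simps by blast
  obtain h where h: "h \<in> graph_aut haar" "h (False, 0) = v" using ex[of v] uv(2) unfolding haar_simps by blast
  have "(h \<circ> inv g) \<in> graph_aut haar" using graph_aut_comp[OF graph_aut_inv[OF g(1)] h(1)] .
  moreover have "(h \<circ> inv g) u = v" using g h graph_autD(2)[OF g(1)] by (metis comp_apply inv_f_f)
  ultimately show "\<exists>f\<in>graph_aut haar. f u = v" by blast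
next
  let ?R = "(parcs haar)\<^sup>*"
  fix v assume v: "v \<in> pverts haar"
  have step: "(u, hop c u) \<in> ?R" if "u \<in> set haar_list" "c \<in> set [0, 1, 3]" for u c
    by (rule r_into_rtrancl) (use that haar_hop in blast)
  have w: "(b, x) \<in> set haar_list \<longleftrightarrow> x < 10" for b x by (auto simp: haar_list_def)
  have x0: "((False, 0), (False, x)) \<in> ?R" if "x < 10" for x
    using that
  proof (induction x)
    case (Suc x)
    have "(11 + x) mod 10 = Suc x" using Suc.prems by presburger
    then have "hop 1 (False, x) = (True, Suc x)" "hop 0 (True, Suc x) = (False, Suc x)"
      using Suc.prems by (simp_all add: hop.simps)
    then have "((False, x), (True, Suc x)) \<in> ?R" "((True, Suc x), (False, Suc x)) \<in> ?R"
      using step[of "(False, x)" 1] step[of "(True, Suc x)" 0] Suc.prems w by auto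
    then show ?case using Suc by (meson Suc_lessD rtrancl_trans)
  qed simp
  have "((False, x), (True, x)) \<in> ?R" if "x < 10" for x
    using step[of "(False, x)" 0] that w by (simp add: hop.simps)
  then show "((False, 0), v) \<in> ?R" using x0 v w by (cases v; cases "fst v") (auto intro: rtrancl_trans)
qed

section \<open>Counting 6-cycles through an arc\<close>

definition hexagons :: "'a pair_pre_digraph \<Rightarrow> 'a \<Rightarrow> 'a \<Rightarrow> ('a \<times> 'a \<times> 'a \<times> 'a) set" where
  "hexagons X v w = {(a, b, c, d). distinct [v, w, a, b, c, d] \<and> (w, a) \<in> parcs X \<and> (a, b) \<in> parcs X \<and>
     (b, c) \<in> parcs X \<and> (c, d) \<in> parcs X \<and> (d, v) \<in> parcs X}"

lemma hexagons_aut: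
  assumes g: "pair_graph X" and f: "f \<in> graph_aut X"
  shows "card (hexagons X (f v) (f w)) = card (hexagons X v w)"
proof -
  let ?F = "\<lambda>(a, b, c, d). (f a, f b, f c, f d)"
  have "hexagons X (f v) (f w) = ?F ` hexagons X v w"
  proof (intro equalityI subsetI)
    fix e assume "e \<in> ?F ` hexagons X v w"
    then show "e \<in> hexagons X (f v) (f w)"
      by (auto simp: hexagons_def graph_aut_arc_iff[OF g f] inj_eq[OF graph_autD(2)[OF f]])
  next
    fix e assume e: "e \<in> hexagons X (f v) (f w)"
    obtain a b c d where "e = (f a, f b, f c, f d)"
      using graph_aut_inverse[OF f] by (metis prod_cases4)
    then have "e = ?F (a, b, c, d)" "(a, b, c, d) \<in> hexagons X v w"
      using e by (auto simp: hexagons_def graph_aut_arc_iff[OF g f] inj_eq[OF graph_autD(2)[OF f]])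
    then show "e \<in> ?F ` hexagons X v w" by blast
  qed
  moreover have "inj_on ?F (hexagons X v w)"
    by (rule inj_onI) (auto simp: inj_eq[OF graph_autD(2)[OF f]])
  ultimately show ?thesis by (simp add: card_image)
qed

definition hexagon_list :: "bool \<times> nat \<Rightarrow> bool \<times> nat \<Rightarrow> ((bool \<times> nat) \<times> (bool \<times> nat) \<times> (bool \<times> nat) \<times> (bool \<times> nat)) list" where
  "hexagon_list v w = filter (\<lambda>(a, b, c, d). distinct [v, w, a, b, c, d] \<and> v \<in> set (hops d))
     (concat (map (\<lambda>a. concat (map (\<lambda>b. concat (map (\<lambda>c. map (\<lambda>d. (a, b, c, d)) (hops c)) (hops b))) (hops a))) (hops w)))"

lemma hexagons_list:
  assumes "w \<in> set haar_list"
  shows "hexagons haar v w = set (hexagon_list v w)"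
proof -
  have step: "u' \<in> set haar_list" if "u \<in> set haar_list" "u' \<in> set (hops u)" for u u'
    using that(2) hop_facts[rule_format, OF that(1)] by (auto simp: hops_def)
  define P where "P a b c d \<longleftrightarrow> distinct [v, w, a, b, c, d]" for a b c d
  have 1: "(a, b, c, d) \<in> set (hexagon_list v w) \<longleftrightarrow> P a b c d \<and> a \<in> set (hops w) \<and> b \<in> set (hops a) \<and>
      c \<in> set (hops b) \<and> d \<in> set (hops c) \<and> v \<in> set (hops d)" for a b c d
    unfolding hexagon_list_def P_def[symmetric] by auto
  have 2: "(a, b, c, d) \<in> hexagons haar v w \<longleftrightarrow> P a b c d \<and> a \<in> set (hops w) \<and> b \<in> set (hops a) \<and>
      c \<in> set (hops b) \<and> d \<in> set (hops c) \<and> v \<in> set (hops d)" for a b c d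
    using assms step unfolding hexagons_def haar_arc P_def[symmetric] by blast
  show ?thesis
  proof (intro set_eqI)
    fix e show "e \<in> hexagons haar v w \<longleftrightarrow> e \<in> set (hexagon_list v w)"
      using 1 2 by (cases e) simp
  qed
qed

text \<open>Every edge lies on two 6-cycles that use each label twice. The relation 1+1+1 = 3+0+0
  gives further ones with three edges labelled 1, two labelled 0 and one labelled 3. Sums of three
  labels are at most 9, so modulo 10 there is no other coincidence, and the counts are 2+2, 2+3 and
  2+1.\<close>

lemma hexagon_counts:
  "length (remdups (hexagon_list (False, 0) (hop 0 (False, 0)))) = 4"
  "length (remdups (hexagon_list (False, 0) (hop 1 (False, 0)))) = 5"
  "length (remdups (hexagon_list (False, 0) (hop 3 (False, 0)))) = 3"
  by (simp_all add: hexagon_list_def hops_def hop.simps)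

lemma hexagons_hop:
  assumes v: "v \<in> set haar_list" and c: "c \<in> set [0, 1, 3]"
  shows "card (hexagons haar v (hop c v)) = (if c = 0 then 4 else if c = 1 then 5 else 3)"
proof -
  obtain g where g: "g \<in> graph_aut haar" "\<forall>u \<in> set haar_list. g u = slide v u" using slide_aut[OF v] by blast
  have h: "hop c (False, 0) \<in> set haar_list" using hop_facts haar_origin c by blast
  have "slide v (False, 0) = v" "slide v (hop c (False, 0)) = hop c (slide v (False, 0))"
    using slide_facts v haar_origin c by blast+
  then have "v = g (False, 0)" "hop c v = g (hop c (False, 0))"
    using bspec[OF g(2) h] bspec[OF g(2) haar_origin] by simp_all
  then have "card (hexagons haar v (hop c v)) = card (hexagons haar (False, 0) (hop c (False, 0)))"
    using hexagons_aut[OF haar_graph g(1)] by metis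
  also have "\<dots> = length (remdups (hexagon_list (False, 0) (hop c (False, 0))))"
    unfolding hexagons_list[OF h] by (rule List.card_set)
  finally show ?thesis using hexagon_counts c by auto
qed

text \<open>The differences between two of 0, 1, 3 are all distinct modulo 10.\<close>

lemma origin_no_square:
  "\<forall>c \<in> set [0, 1, 3]. \<forall>c' \<in> set [0, 1, 3]. c \<noteq> c' \<longrightarrow> hop c (False, 0) \<noteq> hop c' (False, 0) \<and>
     (\<forall>u \<in> set (hops (hop c (False, 0))). u \<noteq> (False, 0) \<longrightarrow> hop c' (False, 0) \<notin> set (hops u))"
  by (simp add: hops_def hop.simps)

text \<open>The number of 6-cycles through an arc reveals its label. Each label is then one orbit
  with one arc per vertex, self-paired because hops are involutions.\<close>

lemma realized_three_ones: "realized ({#1, 1, 1#}, {#})"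
proof -
  define D where "D c = {(v, hop c v) | v. v \<in> set haar_list}" for c
  have D_iff: "(u, v) \<in> D c \<longleftrightarrow> u \<in> set haar_list \<and> v = hop c u" for u v c
    unfolding D_def by (auto simp del: split_paired_Ex)
  have sub: "D c \<subseteq> parcs haar" if "c \<in> set [0, 1, 3]" for c
    using that haar_hop unfolding D_def by blast
  have inv: "(f u, f v) \<in> D c" if c: "c \<in> set [0, 1, 3]" and f: "f \<in> graph_aut haar" and uv: "(u, v) \<in> D c" for f u v c
  proof -
    have u: "u \<in> set haar_list" "v = hop c u" using uv unfolding D_iff by auto
    have "(f u, f v) \<in> parcs haar" using graph_aut_arc_iff[OF haar_graph f] sub[OF c] uv by blast
    then obtain c' where c': "f u \<in> set haar_list" "c' \<in> set [0, 1, 3]" "f v = hop c' (f u)" using haar_hop by blast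
    have "card (hexagons haar (f u) (f v)) = card (hexagons haar u v)" by (rule hexagons_aut[OF haar_graph f])
    then have "c' = c" using hexagons_hop[OF u(1) c] hexagons_hop[OF c'(1,2)] c'(2,3) u(2) c by (auto split: if_splits)
    then show ?thesis using c' D_iff by simp
  qed
  have orb: "D c \<in> arc_orbits haar" "orbit_valency haar (D c) = 1" if c: "c \<in> set [0, 1, 3]" for c
  proof -
    have fn: "\<exists>!w. (v, w) \<in> D c" if "v \<in> pverts haar" for v using that unfolding D_iff by simp
    show "D c \<in> arc_orbits haar" "orbit_valency haar (D c) = 1"
      using functional_orbit[where D = "D c", OF haar_vtg sub[OF c]] inv[OF c] fn by blast+
  qed
  have conv: "(D c)\<inverse> = D c" if c: "c \<in> set [0, 1, 3]" for c
  proof -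
    have "(v, u) \<in> D c" if "(u, v) \<in> D c" for u v
      using that hop_facts c unfolding D_iff by metis
    then show ?thesis by auto
  qed
  have ne: "D c \<noteq> D c'" if "c \<in> set [0, 1, 3]" "c' \<in> set [0, 1, 3]" "c \<noteq> c'" for c c'
  proof
    assume "D c = D c'"
    moreover have "((False, 0), hop c (False, 0)) \<in> D c" using haar_origin D_iff by blast
    ultimately have "hop c (False, 0) = hop c' (False, 0)" using D_iff by blast
    then show False using origin_no_square that by blast
  qed
  have "arc_orbits haar = {D 0} \<union> ({D 1} \<union> {D 3})"
  proof (rule arc_orbits_eqI[OF _ _ haar_graph])
    show "{D 0} \<union> ({D 1} \<union> {D 3}) \<subseteq> arc_orbits haar" using orb(1) by simp
    show "parcs haar \<subseteq> \<Union> ({D 0} \<union> ({D 1} \<union> {D 3}))"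
    proof (rule subrelI)
      fix u v assume "(u, v) \<in> parcs haar"
      then have "u \<in> set haar_list" "v = hop 0 u \<or> v = hop 1 u \<or> v = hop 3 u" unfolding haar_hop by auto
      then have "(u, v) \<in> D 0 \<or> (u, v) \<in> D 1 \<or> (u, v) \<in> D 3" using D_iff by blast
      then show "(u, v) \<in> \<Union> ({D 0} \<union> ({D 1} \<union> {D 3}))" by auto
    qed
  qed
  moreover have "family_type (orbit_valency haar) ({D 0} \<union> ({D 1} \<union> {D 3})) =
      family_type (orbit_valency haar) {D 0} + family_type (orbit_valency haar) ({D 1} \<union> {D 3})"
    by (rule family_type_union) (use ne[of 0 1] ne[of 0 3] ne[of 1 3] conv[of 0] conv[of 1] conv[of 3] in auto)
  moreover have "family_type (orbit_valency haar) ({D 1} \<union> {D 3}) =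
      family_type (orbit_valency haar) {D 1} + family_type (orbit_valency haar) {D 3}"
    by (rule family_type_union) (use ne[of 0 1] ne[of 0 3] ne[of 1 3] conv[of 0] conv[of 1] conv[of 3] in auto)
  moreover have "family_type (orbit_valency haar) {D c} = ({#1#}, {#})" if "c \<in> set [0, 1, 3]" for c
    using family_type_selfpaired[OF conv[OF that]] orb(2)[OF that] by simp
  ultimately have type: "arc_type haar = ({#1, 1, 1#}, {#})"
    unfolding arc_type_family by simp
  have "unsquared haar"
    unfolding unsquared_def
  proof (intro ballI, clarify)
    fix v w assume "(v, w) \<in> parcs haar"
    then obtain c where c: "v \<in> set haar_list" "c \<in> set [0, 1, 3]" "w = hop c v" using haar_hop by blast
    define c' where "c' = (if c = 0 then 1 else 0 :: nat)"
    have c': "c' \<in> set [0, 1, 3]" "c \<noteq> c'" using c(2) by (auto simp: c'_def)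
    obtain g where g: "g \<in> graph_aut haar" "\<forall>u \<in> set haar_list. g u = slide v u" using slide_aut[OF c(1)] by blast
    have h: "hop c (False, 0) \<in> set haar_list" "hop c' (False, 0) \<in> set haar_list" using hop_facts haar_origin c c' by blast+
    have "slide v (False, 0) = v" "slide v (hop c (False, 0)) = hop c (slide v (False, 0))"
      "slide v (hop c' (False, 0)) = hop c' (slide v (False, 0))"
      using slide_facts c(1) haar_origin c(2) c'(1) by blast+
    then have e: "v = g (False, 0)" "w = g (hop c (False, 0))" "hop c' v = g (hop c' (False, 0))"
      using bspec[OF g(2) h(1)] bspec[OF g(2) h(2)] bspec[OF g(2) haar_origin] c(3) by simp_all
    have "\<not> in_square haar (hop c (False, 0)) (False, 0) (hop c' (False, 0))"
    proof
      assume "in_square haar (hop c (False, 0)) (False, 0) (hop c' (False, 0))"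
      then obtain u where "u \<noteq> (False, 0)" "(hop c (False, 0), u) \<in> parcs haar" "(u, hop c' (False, 0)) \<in> parcs haar"
        unfolding in_square_def by blast
      then have "u \<in> set (hops (hop c (False, 0)))" "u \<noteq> (False, 0)" "hop c' (False, 0) \<in> set (hops u)"
        unfolding haar_arc by auto
      then show False using origin_no_square c(2) c' by blast
    qed
    moreover have "in_square haar w v (hop c' v) \<longleftrightarrow> in_square haar (hop c (False, 0)) (False, 0) (hop c' (False, 0))"
      unfolding e(2,3) unfolding e(1) by (rule in_square_aut[OF haar_graph g(1)])
    ultimately have "\<not> in_square haar w v (hop c' v)" by simp
    moreover have "hop c' (False, 0) \<noteq> hop c (False, 0)"
      by (rule not_sym) (use bspec[OF bspec[OF origin_no_square c(2)] c'(1)] c'(2) in simp)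
    then have "hop c' v \<noteq> w" unfolding e(2,3) inj_eq[OF graph_autD(2)[OF g(1)]] .
    moreover have "(v, hop c' v) \<in> parcs haar" using c(1) c'(1) haar_hop by blast
    ultimately show "\<exists>w'. (v, w') \<in> parcs haar \<and> w' \<noteq> w \<and> \<not> in_square haar w v w'" by blast
  qed
  moreover have "bipartition haar fst"
    unfolding bipartition_def
  proof (intro ballI, clarify)
    fix u v assume "(u, v) \<in> parcs haar" and eq: "fst u = fst v"
    then obtain c where c: "u \<in> set haar_list" "c \<in> set [0, 1, 3]" "v = hop c u" using haar_hop by blast
    have "fst v = (\<not> fst u)" using hop_facts[rule_format, OF c(1)] c(2,3) by auto
    then show False using eq by simp
  qed
  ultimately show ?thesis using realizedI[OF haar_vtg] type by force
qed

section \<open>Bouwer graphs\<close>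

text \<open>
  A vertex \<open>(x, y)\<close> stands for a level \<open>a\<close> modulo 8, recorded as \<open>x = 9 ^ a\<close>, and a vector \<open>y\<close>
  modulo 17. After rescaling coordinates by \<open>2 ^ a\<close> the arcs increase the level by one and add
  \<open>2 ^ a\<close> times a unit vector; the scaling makes the rule uniform in \<open>a\<close>.
\<close>

type_synonym spot = "17 \<times> (nat \<Rightarrow> 17)"

definition unit_at :: "nat \<Rightarrow> nat \<Rightarrow> 17" where
  "unit_at i t = (if t = i then 1 else 0)"

text \<open>9 is the inverse of 2 modulo 17. As \<open>2^8 = 1\<close> modulo 17, the scaling factor
  of a level is well defined modulo 8.\<close>

definition up :: "nat \<Rightarrow> spot \<Rightarrow> spot" where
  "up i u = (9 * fst u, \<lambda>t. 9 * (snd u t + unit_at i t))"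

definition dn :: "nat \<Rightarrow> spot \<Rightarrow> spot" where
  "dn i u = (2 * fst u, \<lambda>t. 2 * snd u t - unit_at i t)"

lemma seventeen [simp]: "(17::17) = 0"
  by simp

lemma half: "(9::17) * (2 * x) = x" "(2::17) * (9 * x) = x"
  unfolding mult.assoc[symmetric] by simp_all

text \<open>Doubling avoids the factor 9, so that coordinate equations have small
  coefficients.\<close>

lemma up_simps [simp]: "fst (up i u) = 9 * fst u" "2 * snd (up i u) t = snd u t + unit_at i t"
  by (simp_all add: up_def half)

lemma dn_simps [simp]: "fst (dn i u) = 2 * fst u" "snd (dn i u) t = 2 * snd u t - unit_at i t"
  by (simp_all add: dn_def)

lemma up_dn [simp]: "up i (dn i u) = u" "dn i (up i u) = u"
  by (simp_all add: prod_eq_iff fun_eq_iff half) (simp_all add: up_def half)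

lemma up_eq_iff [simp]: "up i u = up i v \<longleftrightarrow> u = v" "dn i u = dn i v \<longleftrightarrow> u = v"
  by (metis up_dn)+

lemma up_index [simp]: "up i u = up j u \<longleftrightarrow> i = j" "dn i u = dn j u \<longleftrightarrow> i = j"
proof -
  have "unit_at i \<noteq> unit_at j" if "i \<noteq> j" using that by (auto simp: unit_at_def fun_eq_iff)
  moreover have "unit_at i = unit_at j" if "up i u = up j u"
  proof
    fix t show "unit_at i t = unit_at j t" using up_simps(2)[of i u t] up_simps(2)[of j u t] that by simp
  qed
  moreover have "unit_at i = unit_at j" if "dn i u = dn j u"
  proof
    fix t show "unit_at i t = unit_at j t" using dn_simps(2)[of i u t] dn_simps(2)[of j u t] that by simp
  qed
  ultimately show "up i u = up j u \<longleftrightarrow> i = j" "dn i u = dn j u \<longleftrightarrow> i = j" by blast+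
qed

definition step :: "bool \<Rightarrow> nat \<Rightarrow> spot \<Rightarrow> spot" where
  "step b i u = (if b then up i u else dn i u)"

text \<open>\<open>x ^ 7\<close> is an inverse of \<open>x\<close>. Cancelling level factors turns a
  statement about levels into one about powers of 2.\<close>

lemma unit_cancel:
  fixes x :: 17 assumes "x ^ 8 = 1" "c * x = d * x" shows "c = d"
proof -
  have "c * x * x ^ 7 = d * x * x ^ 7" using assms(2) by simp
  moreover have "x * x ^ 7 = 1" using assms(1) by (simp add: numeral_eq_Suc)
  ultimately show ?thesis by (simp add: mult.assoc)
qed

definition scale :: "bool \<Rightarrow> 17" where
  "scale b = (if b then 9 else 2)"

lemma step_fst [simp]: "fst (step b i u) = scale b * fst u"
  by (simp add: step_def scale_def)

text \<open>2 has order 8 modulo 17, so four steps with net change -2 modulo 8 have net change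
  exactly -2: one ascent and three descents.\<close>

lemma scale_patterns:
  assumes "x ^ 8 = 1" "scale \<delta> * (scale \<gamma> * (scale \<beta> * (scale \<alpha> * x))) = 2 * (2 * x)"
  shows "(\<alpha> \<and> \<not> \<beta> \<and> \<not> \<gamma> \<and> \<not> \<delta>) \<or> (\<not> \<alpha> \<and> \<beta> \<and> \<not> \<gamma> \<and> \<not> \<delta>) \<or>
    (\<not> \<alpha> \<and> \<not> \<beta> \<and> \<gamma> \<and> \<not> \<delta>) \<or> (\<not> \<alpha> \<and> \<not> \<beta> \<and> \<not> \<gamma> \<and> \<delta>)"
proof -
  have "scale \<delta> * (scale \<gamma> * (scale \<beta> * scale \<alpha>)) = 2 * 2"
    by (rule unit_cancel[OF assms(1)]) (simp only: mult.assoc assms(2))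
  then show ?thesis
    by (cases \<alpha>; cases \<beta>; cases \<gamma>; cases \<delta>) (simp_all add: scale_def)
qed

lemma scale_pattern:
  assumes "x ^ 8 = 1" "scale \<beta> * (scale \<alpha> * x) = 2 * (2 * x)"
  shows "\<not> \<alpha> \<and> \<not> \<beta>"
proof -
  have "scale \<beta> * scale \<alpha> = 2 * 2"
    by (rule unit_cancel[OF assms(1)]) (simp only: mult.assoc assms(2))
  then show ?thesis
    by (cases \<alpha>; cases \<beta>) (simp_all add: scale_def)
qed

subsection \<open>Closed walks\<close>

text \<open>One coordinate of a walk, with intermediate vertices eliminated. U and D are ascents and
  descents; \<open>P\<close> to \<open>S\<close> are entries of the unit vectors along the walk,
  \<open>J\<close> and \<open>I\<close> those of two successive descents with the same ends.\<close>

lemma walk_UDDD: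
  fixes y :: "'a :: comm_ring_1"
  assumes "2 * a = y + P" "b = 2 * a - Q" "c = 2 * b - R" "d = 2 * c - S" "2 * (2 * y - J) - I = d"
  shows "4 * P - 4 * Q - 2 * R - S = - 2 * J - I"
  using assms(5) unfolding assms(4) assms(3) assms(2) assms(1) by (simp add: algebra_simps)

lemma walk_DUDD:
  fixes y :: "'a :: comm_ring_1"
  assumes "a = 2 * y - P" "2 * b = a + Q" "c = 2 * b - R" "d = 2 * c - S" "2 * (2 * y - J) - I = d"
  shows "2 * Q - 2 * P - 2 * R - S = - 2 * J - I"
  using assms(5) unfolding assms(4) assms(3) assms(2) assms(1) by (simp add: algebra_simps)

lemma walk_DDUD:
  fixes y :: "'a :: comm_ring_1"
  assumes "a = 2 * y - P" "b = 2 * a - Q" "2 * c = b + R" "d = 2 * c - S" "2 * (2 * y - J) - I = d"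
  shows "R - 2 * P - Q - S = - 2 * J - I"
  using assms(5) unfolding assms(4) assms(3) assms(2) assms(1) by (simp add: algebra_simps)

lemma walk_DDDU:
  fixes y :: "'a :: comm_ring_1"
  assumes "a = 2 * y - P" "b = 2 * a - Q" "c = 2 * b - R" "2 * d = c + S" "2 * (2 * y - J) - I = d"
  shows "S - 4 * P - 2 * Q - R = - 4 * J - 2 * I"
  using arg_cong[OF assms(5), of "(*) 2"] unfolding assms(4) assms(3) assms(2) assms(1) by (simp add: algebra_simps)

lemma walk_DDUUDU:
  fixes y :: "'a :: comm_ring_1"
  assumes "a = 2 * y - P" "b = 2 * a - Q" "2 * c = b + R" "2 * d = c + S" "e = 2 * d - T" "2 * y = e + U"
  shows "2 * P + Q + 2 * T = R + 2 * S + 2 * U"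
proof -
  have "2 * (2 * y) = 2 * (2 * d - T + U)" using assms(5,6) by simp
  also have "\<dots> = 2 * c + 2 * S - 2 * T + 2 * U" unfolding assms(4) by (simp add: algebra_simps)
  finally have "2 * (2 * y) = b + R + 2 * S - 2 * T + 2 * U" unfolding assms(3) .
  then show ?thesis unfolding assms(2) assms(1) by (simp add: algebra_simps)
qed

text \<open>At coordinate \<open>p\<close> the left side is between 1 and 4 and the right side
  between -3 and 0; such values differ modulo 17 as well.\<close>

lemma no_UDDD: "p \<noteq> q \<Longrightarrow> 4 * unit_at p p - 4 * unit_at q p - 2 * unit_at r p - unit_at s p \<noteq> - 2 * unit_at j p - unit_at i p"
  by (auto simp: unit_at_def)

lemma no_DUDD: "p \<noteq> q \<Longrightarrow> r \<noteq> q \<Longrightarrow> 2 * unit_at q q - 2 * unit_at p q - 2 * unit_at r q - unit_at s q \<noteq> - 2 * unit_at j q - unit_at i q"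
  by (auto simp: unit_at_def)

lemma no_DDDU: "r \<noteq> s \<Longrightarrow> p \<noteq> j \<Longrightarrow> unit_at s p - 4 * unit_at p p - 2 * unit_at q p - unit_at r p \<noteq> - 4 * unit_at j p - 2 * unit_at i p"
  by (auto simp: unit_at_def)

text \<open>The coordinates of the ascent and of the descent before it determine all
  indices.\<close>

lemma only_DDUD:
  assumes "\<And>t. unit_at r t - 2 * unit_at p t - unit_at q t - unit_at s t = - 2 * unit_at j t - unit_at i t" "q \<noteq> r" "r \<noteq> s"
  shows "p = i" "r = i" "q = j" "i \<noteq> j"
  using assms(1)[of r] assms(1)[of q] assms(2,3) by (auto simp: unit_at_def split: if_splits)

text \<open>At coordinate \<open>q\<close> the left side is odd and the right side even, and both
  lie between 0 and 5.\<close>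

lemma no_DDUUDU:
  assumes "q \<noteq> r"
  shows "2 * unit_at p q + unit_at q q + 2 * unit_at t q \<noteq> unit_at r q + 2 * unit_at s q + 2 * unit_at u q"
  using assms by (auto simp: unit_at_def)

lemma no_DD: "p \<noteq> i \<Longrightarrow> - 2 * unit_at p p - unit_at q p \<noteq> - 2 * unit_at i p - unit_at i p"
  by (auto simp: unit_at_def)

text \<open>The other four steps fall two levels in total, so one of them is an ascent. A suitable
  coordinate excludes it from the first, second and last place; in the third place it fixes the
  whole path.\<close>

lemma straight_hexagon:
  assumes x: "fst v ^ 8 = 1" and w: "w = dn i (dn j v)"
    and st: "a = step \<alpha> p v" "b = step \<beta> q a" "c = step \<gamma> r b" "w = step \<delta> s c"
    and d: "a \<noteq> dn j v" "b \<noteq> v" "c \<noteq> a" "w \<noteq> b"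
  shows "i \<noteq> j \<and> a = dn i v \<and> b = dn j a \<and> c = up i b"
proof -
  have "scale \<delta> * (scale \<gamma> * (scale \<beta> * (scale \<alpha> * fst v))) = fst w" unfolding st by simp
  also have "\<dots> = 2 * (2 * fst v)" unfolding w by simp
  finally have "scale \<delta> * (scale \<gamma> * (scale \<beta> * (scale \<alpha> * fst v))) = 2 * (2 * fst v)" .
  note scale_patterns[OF x this]
  then consider "\<alpha>" "\<not> \<beta>" "\<not> \<gamma>" "\<not> \<delta>" | "\<not> \<alpha>" "\<beta>" "\<not> \<gamma>" "\<not> \<delta>" | "\<not> \<alpha>" "\<not> \<beta>" "\<gamma>" "\<not> \<delta>"
    | "\<not> \<alpha>" "\<not> \<beta>" "\<not> \<gamma>" "\<delta>"
    by blast
  then show ?thesis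
  proof cases
    case 1
    then have e: "a = up p v" "b = dn q a" "c = dn r b" "w = dn s c" using st by (simp_all add: step_def)
    have "p \<noteq> q" using d(2) e by auto
    moreover have "2 * snd a p = snd v p + unit_at p p" "snd b p = 2 * snd a p - unit_at q p" "snd c p = 2 * snd b p - unit_at r p"
      "snd w p = 2 * snd c p - unit_at s p" "2 * (2 * snd v p - unit_at j p) - unit_at i p = snd w p"
      by (subst e(1), simp, subst e(2), simp, subst e(3), simp, subst e(4), simp, subst w, simp)
    note walk_UDDD[OF this]
    ultimately show ?thesis using no_UDDD by blast
  next
    case 2
    then have e: "a = dn p v" "b = up q a" "c = dn r b" "w = dn s c" using st by (simp_all add: step_def)
    have "p \<noteq> q" "r \<noteq> q" using d(2,3) e by auto
    moreover have "snd a q = 2 * snd v q - unit_at p q" "2 * snd b q = snd a q + unit_at q q" "snd c q = 2 * snd b q - unit_at r q"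
      "snd w q = 2 * snd c q - unit_at s q" "2 * (2 * snd v q - unit_at j q) - unit_at i q = snd w q"
      by (subst e(1), simp, subst e(2), simp, subst e(3), simp, subst e(4), simp, subst w, simp)
    note walk_DUDD[OF this]
    ultimately show ?thesis using no_DUDD by blast
  next
    case 3
    then have e: "a = dn p v" "b = dn q a" "c = up r b" "w = dn s c" using st by (simp_all add: step_def)
    have ne: "q \<noteq> r" "r \<noteq> s" using d(3,4) e by auto
    have "unit_at r t - 2 * unit_at p t - unit_at q t - unit_at s t = - 2 * unit_at j t - unit_at i t" for t
    proof -
      have "snd a t = 2 * snd v t - unit_at p t" "snd b t = 2 * snd a t - unit_at q t" "2 * snd c t = snd b t + unit_at r t"
        "snd w t = 2 * snd c t - unit_at s t" "2 * (2 * snd v t - unit_at j t) - unit_at i t = snd w t"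
        by (subst e(1), simp, subst e(2), simp, subst e(3), simp, subst e(4), simp, subst w, simp)
      then show ?thesis by (rule walk_DDUD)
    qed
    from only_DDUD[OF this ne] e show ?thesis by simp
  next
    case 4
    then have e: "a = dn p v" "b = dn q a" "c = dn r b" "w = up s c" using st by (simp_all add: step_def)
    have "r \<noteq> s" "p \<noteq> j" using d(1,4) e by auto
    moreover have "snd a p = 2 * snd v p - unit_at p p" "snd b p = 2 * snd a p - unit_at q p" "snd c p = 2 * snd b p - unit_at r p"
      "2 * snd w p = snd c p + unit_at s p" "2 * (2 * snd v p - unit_at j p) - unit_at i p = snd w p"
      by (subst e(1), simp, subst e(2), simp, subst e(3), simp, subst e(4), simp, subst w, simp)
    note walk_DDDU[OF this]
    ultimately show ?thesis using no_DDDU by blast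
  qed
qed

lemma straight_square:
  assumes x: "fst v ^ 8 = 1" and w: "w = dn i (dn i v)"
    and st: "a = step \<alpha> p v" "w = step \<beta> q a" and d: "a \<noteq> dn i v"
  shows False
proof -
  have "scale \<beta> * (scale \<alpha> * fst v) = fst w" unfolding st by simp
  also have "\<dots> = 2 * (2 * fst v)" unfolding w by simp
  finally have "scale \<beta> * (scale \<alpha> * fst v) = 2 * (2 * fst v)" .
  note scale_pattern[OF x this]
  then have e: "a = dn p v" "w = dn q a" using st by (simp_all add: step_def)
  have "2 * (2 * snd v p - unit_at p p) - unit_at q p = 2 * (2 * snd v p - unit_at i p) - unit_at i p"
    using arg_cong[OF trans[OF e(2)[symmetric] w], of "\<lambda>u. snd u p"] e(1) by simp
  then have "- 2 * unit_at p p - unit_at q p = - 2 * unit_at i p - unit_at i p" by (simp add: algebra_simps)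
  moreover have "p \<noteq> i" using d e by auto
  ultimately show False using no_DD by blast
qed

text \<open>The parity argument of \<open>no_DDUUDU\<close> at the coordinate of the second descent,
  which \<open>a \<noteq> c\<close> makes different from that of the ascent after it.\<close>

lemma no_reversed_walk:
  assumes st: "a = dn p v" "b = dn q a" "c = up r b" "d = up s c" "e = dn t d" "v = up u e" and ne: "a \<noteq> c"
  shows False
proof -
  have "q \<noteq> r" using ne unfolding st(3) by (metis st(2) up_dn(1))
  moreover have "snd a q = 2 * snd v q - unit_at p q" "snd b q = 2 * snd a q - unit_at q q" "2 * snd c q = snd b q + unit_at r q"
    "2 * snd d q = snd c q + unit_at s q" "snd e q = 2 * snd d q - unit_at t q" "2 * snd v q = snd e q + unit_at u q"
    by (subst st(1), simp, subst st(2), simp, subst st(3), simp, subst st(4), simp, subst st(5), simp, subst st(6), simp)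
  note walk_DDUUDU[OF this]
  ultimately show False using no_DDUUDU by blast
qed

subsection \<open>The graph and its automorphisms\<close>

definition home :: spot where
  "home = (1, \<lambda>_. 0)"

definition nbrs :: "nat \<Rightarrow> spot rel" where
  "nbrs k = {(u, v). \<exists>i<k. v = up i u \<or> v = dn i u}"

text \<open>Taking the component of \<open>home\<close> makes connectedness hold by
  construction.\<close>

definition spots :: "nat \<Rightarrow> spot set" where
  "spots k = {v. (home, v) \<in> (nbrs k)\<^sup>*}"

definition bouwer :: "nat \<Rightarrow> spot pair_pre_digraph" where
  "bouwer k = \<lparr>pverts = spots k, parcs = {(u, v). u \<in> spots k \<and> (u, v) \<in> nbrs k}\<rparr>"

definition raises :: "nat \<Rightarrow> spot \<Rightarrow> spot \<Rightarrow> bool" where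
  "raises k u v \<longleftrightarrow> (\<exists>i<k. v = up i u)"

lemma raises_iff: "raises k u v \<longleftrightarrow> (\<exists>i<k. u = dn i v)"
  unfolding raises_def by (metis up_dn)

lemma nbrs_iff: "(u, v) \<in> nbrs k \<longleftrightarrow> raises k u v \<or> raises k v u"
  unfolding raises_iff[of k v u] unfolding raises_def nbrs_def by blast

lemma nbrsI: "i < k \<Longrightarrow> (u, up i u) \<in> nbrs k" "i < k \<Longrightarrow> (u, dn i u) \<in> nbrs k"
  unfolding nbrs_def by blast+

lemma nbrs_sym: "(u, v) \<in> nbrs k \<Longrightarrow> (v, u) \<in> nbrs k"
  unfolding nbrs_iff by blast

lemma nbrs_step: "(u, v) \<in> nbrs k \<Longrightarrow> \<exists>b i. i < k \<and> v = step b i u"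
  unfolding nbrs_def step_def by (auto simp del: split_paired_Ex)

lemma home_spot: "home \<in> spots k"
  by (simp add: spots_def)

lemma spots_nbr: "u \<in> spots k \<Longrightarrow> (u, v) \<in> nbrs k \<Longrightarrow> v \<in> spots k"
  unfolding spots_def mem_Collect_eq by (rule rtrancl.rtrancl_into_rtrancl)

lemma spots_up [simp]: "u \<in> spots k \<Longrightarrow> i < k \<Longrightarrow> up i u \<in> spots k"
  by (rule spots_nbr[OF _ nbrsI(1)])

lemma spots_dn [simp]: "u \<in> spots k \<Longrightarrow> i < k \<Longrightarrow> dn i u \<in> spots k"
  by (rule spots_nbr[OF _ nbrsI(2)])

lemma spots_induct:
  assumes "v \<in> spots k" "P home" "\<And>u i. i < k \<Longrightarrow> P u \<Longrightarrow> P (up i u)" "\<And>u i. i < k \<Longrightarrow> P u \<Longrightarrow> P (dn i u)"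
  shows "P v"
proof -
  have "(home, v) \<in> (nbrs k)\<^sup>*" using assms(1) by (simp add: spots_def)
  then show ?thesis
  proof (induction rule: rtrancl_induct)
    case (step u v)
    then obtain i where "i < k" "v = up i u \<or> v = dn i u" unfolding nbrs_def by blast
    then show ?case using assms(3,4) step.IH by blast
  qed (rule assms(2))
qed

lemma spots_connected:
  assumes "u \<in> spots k" "v \<in> spots k"
  shows "(u, v) \<in> (nbrs k)\<^sup>*"
proof -
  have "sym ((nbrs k)\<^sup>*)" by (intro sym_rtrancl symI) (rule nbrs_sym)
  then have "(u, home) \<in> (nbrs k)\<^sup>*" using assms(1) unfolding spots_def by (auto dest: symD)
  then show ?thesis using assms(2) unfolding spots_def by (auto intro: rtrancl_trans)
qed

lemma spots_unit: "v \<in> spots k \<Longrightarrow> fst v ^ 8 = 1"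
  by (erule spots_induct) (simp_all add: home_def power_mult_distrib)

text \<open>The parity of the level: both 2 and 9 have fourth power 16, which is -1.\<close>

lemma spots_parity: "v \<in> spots k \<Longrightarrow> fst v ^ 4 = 1 \<or> fst v ^ 4 = 16"
  by (erule spots_induct) (auto simp: home_def power_mult_distrib)

text \<open>Vectors are functions on all naturals; only the first \<open>k\<close> entries can be
  nonzero, which gives finiteness.\<close>

lemma spots_support: "v \<in> spots k \<Longrightarrow> k \<le> t \<Longrightarrow> snd v t = 0"
  by (erule spots_induct) (auto simp: home_def up_def unit_at_def)

lemma finite_spots: "finite (spots k)"
proof (rule finite_subset)
  show "spots k \<subseteq> UNIV \<times> {y. \<forall>t. (t \<in> {..<k} \<longrightarrow> y t \<in> UNIV) \<and> (t \<notin> {..<k} \<longrightarrow> y t = 0)}"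
  proof
    fix v assume "v \<in> spots k"
    then have "\<forall>t. k \<le> t \<longrightarrow> snd v t = 0" using spots_support by blast
    then show "v \<in> UNIV \<times> {y. \<forall>t. (t \<in> {..<k} \<longrightarrow> y t \<in> UNIV) \<and> (t \<notin> {..<k} \<longrightarrow> y t = 0)}"
      by (cases v) simp
  qed
  show "finite ((UNIV :: 17 set) \<times> {y. \<forall>t. (t \<in> {..<k} \<longrightarrow> y t \<in> (UNIV :: 17 set)) \<and> (t \<notin> {..<k} \<longrightarrow> y t = 0)})"
    by (intro finite_cartesian_product finite_set_of_finite_funs) simp_all
qed

lemma bouwer_simps [simp]: "pverts (bouwer k) = spots k"
  "(u, v) \<in> parcs (bouwer k) \<longleftrightarrow> u \<in> spots k \<and> (u, v) \<in> nbrs k"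
  by (simp_all add: bouwer_def)

lemma raises_level: "u \<in> spots k \<Longrightarrow> raises k u v \<Longrightarrow> fst u \<noteq> fst v" "u \<in> spots k \<Longrightarrow> raises k u v \<Longrightarrow> \<not> raises k v u"
proof -
  assume u: "u \<in> spots k" and r: "raises k u v"
  have f: "fst v = 9 * fst u" using r by (auto simp: raises_def)
  show "fst u \<noteq> fst v"
  proof
    assume "fst u = fst v"
    then have "1 * fst u = 9 * fst u" using f by simp
    then show False using unit_cancel[OF spots_unit[OF u], of 1 9] by simp
  qed
  show "\<not> raises k v u"
  proof
    assume "raises k v u"
    then have "fst u = 9 * fst v" by (auto simp: raises_def)
    then have "1 * fst u = (9 * 9) * fst u" using f by (simp add: mult.assoc)
    then have "1 = (9 * 9 :: 17)" by (rule unit_cancel[OF spots_unit[OF u]])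
    then show False by simp
  qed
qed

lemma bouwer_graph: "pair_graph (bouwer k)"
proof (rule pair_graphI)
  show "parcs (bouwer k) \<subseteq> pverts (bouwer k) \<times> pverts (bouwer k)"
    using spots_nbr by (auto simp del: split_paired_All)
  show "sym (parcs (bouwer k))"
    by (rule symI) (use spots_nbr nbrs_sym in auto)
  show "irrefl (parcs (bouwer k))"
  proof (rule irreflI)
    fix u show "(u, u) \<notin> parcs (bouwer k)" using raises_level(1) unfolding bouwer_simps nbrs_iff by blast
  qed
qed (simp add: finite_spots)

section \<open>Affine automorphisms\<close>

definition affine :: "17 \<Rightarrow> (nat \<Rightarrow> 17) \<Rightarrow> nat \<Rightarrow> nat \<Rightarrow> spot \<Rightarrow> spot" where
  "affine s c i j u = (fst u * s, \<lambda>t. snd u (transpose i j t) + fst u * s * c t)"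

lemma unit_at_transpose: "unit_at l (transpose i j t) = unit_at (transpose i j l) t"
  by (auto simp: unit_at_def transpose_def)

lemma affine_up: "affine s c i j (up l u) = up (transpose i j l) (affine s c i j u)"
  by (simp add: affine_def up_def unit_at_transpose fun_eq_iff algebra_simps)

lemma affine_dn: "affine s c i j (dn l u) = dn (transpose i j l) (affine s c i j u)"
  by (simp add: affine_def dn_def unit_at_transpose fun_eq_iff algebra_simps)

text \<open>A transposition of coordinates carries direction \<open>i\<close> to \<open>j\<close>; a
  change of level and a translation carry \<open>u\<close> to \<open>u'\<close>. In the rescaled
  coordinates a translation is multiplied by the level factor.\<close>

lemma bouwer_aut:
  assumes u: "u \<in> spots k" and u': "u' \<in> spots k" and ij: "i < k" "j < k"
  shows "\<exists>g \<in> graph_aut (bouwer k). g u = u' \<and> g (up i u) = up j u'"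
proof -
  \<comment> \<open>Solved from \<open>?g u = u'\<close>, with seventh powers as inverses.\<close>
  define s where "s = fst u' * fst u ^ 7"
  define c where "c t = fst u' ^ 7 * (snd u' t - snd u (transpose i j t))" for t
  let ?g = "affine s c i j"
  have pow: "x * x ^ 7 = 1" if "x ^ 8 = 1" for x :: 17 using that by (simp add: numeral_eq_Suc)
  note pu = pow[OF spots_unit[OF u]] and pu' = pow[OF spots_unit[OF u']]
  have f: "fst u * s = fst u'" unfolding s_def by (simp only: mult.left_commute[of "fst u"] pu mult_1_right)
  have gu: "?g u = u'"
    unfolding affine_def f c_def by (simp add: prod_eq_iff fun_eq_iff mult.assoc[symmetric] pu')
  have tr: "transpose i j l < k" if "l < k" for l using ij that by (auto simp: transpose_def)
  have nb: "(?g v, ?g w) \<in> nbrs k" if vw: "(v, w) \<in> nbrs k" for v w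
  proof -
    obtain l where l: "l < k" "w = up l v \<or> w = dn l v" using vw unfolding nbrs_def by blast
    then have "?g w = up (transpose i j l) (?g v) \<or> ?g w = dn (transpose i j l) (?g v)"
      using affine_up affine_dn by metis
    then show ?thesis using tr[OF l(1)] unfolding nbrs_def by blast
  qed
  have cl: "?g v \<in> spots k" if "v \<in> spots k" for v
    using spots_connected[OF u that]
  proof (induction rule: rtrancl_induct)
    case base then show ?case using gu u' by simp
  next
    case (step v w) then show ?case using spots_nbr nb by blast
  qed
  have inj: "inj_on ?g (spots k)"
  proof (rule inj_onI)
    fix v w assume e: "?g v = ?g w"
    have "s * (fst u * fst u' ^ 7) = fst u * s * fst u' ^ 7" by (simp only: mult_ac)
    also have "\<dots> = 1" unfolding f by (rule pu')
    finally have "s * (fst u * fst u' ^ 7) = 1" .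
    then have s: "x * s * (fst u * fst u' ^ 7) = x" for x by (simp only: mult.assoc mult_1_right)
    have "fst v * s = fst w * s" using e by (simp add: affine_def)
    then have "fst v * s * (fst u * fst u' ^ 7) = fst w * s * (fst u * fst u' ^ 7)" by simp
    then have 1: "fst v = fst w" unfolding s .
    have "snd v (transpose i j t) = snd w (transpose i j t)" for t
      using arg_cong[OF e, of "\<lambda>u. snd u t"] 1 by (simp add: affine_def)
    then have "snd v (transpose i j (transpose i j t)) = snd w (transpose i j (transpose i j t))" for t .
    then have "snd v t = snd w t" for t by simp
    then show "v = w" using 1 by (simp add: prod_eq_iff fun_eq_iff)
  qed
  have "\<exists>g \<in> graph_aut (bouwer k). \<forall>v \<in> pverts (bouwer k). g v = ?g v"
    by (rule graph_autI_exists[OF bouwer_graph]) (use cl inj nb in auto)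
  then obtain g where g: "g \<in> graph_aut (bouwer k)" "\<forall>v \<in> spots k. g v = ?g v" by auto
  have "?g (up i u) = up j u'" unfolding affine_up gu by simp
  then show ?thesis using g(1) bspec[OF g(2) u] bspec[OF g(2) spots_up[OF u ij(1)]] gu by auto
qed

lemma bouwer_vtg:
  assumes "k > 0" shows "vtg (bouwer k)"
proof (rule vtgI[OF bouwer_graph, where r = home])
  show "parcs (bouwer k) \<noteq> {}" using home_spot nbrsI(1)[OF assms] bouwer_simps(2) by blast
  show "\<exists>f \<in> graph_aut (bouwer k). f u = v" if "u \<in> pverts (bouwer k)" "v \<in> pverts (bouwer k)" for u v
    using bouwer_aut[of u k v 0 0] that assms by auto
  show "(home, v) \<in> (parcs (bouwer k))\<^sup>*" if "v \<in> pverts (bouwer k)" for v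
  proof -
    have "(home, v) \<in> (nbrs k)\<^sup>*" using that by (simp add: spots_def)
    then have "v \<in> spots k \<and> (home, v) \<in> (parcs (bouwer k))\<^sup>*"
    proof (induction rule: rtrancl_induct)
      case (step u v)
      then have "u \<in> spots k" "(u, v) \<in> nbrs k" "(home, u) \<in> (parcs (bouwer k))\<^sup>*" by simp_all
      moreover from this have "(u, v) \<in> parcs (bouwer k)" by simp
      ultimately show ?case using spots_nbr rtrancl.rtrancl_into_rtrancl by metis
    qed (simp add: home_spot)
    then show ?thesis by blast
  qed
qed

lemma bouwer_bipartition: "bipartition (bouwer k) (\<lambda>v. fst v ^ 4 = 1)"
proof -
  have "(fst u ^ 4 = 1) \<noteq> (fst v ^ 4 = 1)" if uv: "(u, v) \<in> parcs (bouwer k)" for u v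
  proof -
    have u: "u \<in> spots k" and n: "(u, v) \<in> nbrs k" using uv by simp_all
    obtain b i where "v = step b i u" using nbrs_step[OF n] by blast
    then have "fst v ^ 4 = scale b ^ 4 * fst u ^ 4" by (simp add: power_mult_distrib)
    moreover have "scale b ^ 4 = 16" by (simp add: scale_def)
    ultimately show ?thesis using spots_parity[OF u] by auto
  qed
  then show ?thesis unfolding bipartition_def by blast
qed

subsection \<open>Straight and zigzag corners\<close>

text \<open>
  A corner between two ascending arcs lies in at most one 6-cycle, any other corner in at least two.
  So automorphisms preserve the two kinds, and one that reversed an arc would turn a 6-cycle with
  ascents and descents \<open>++--+-\<close> into one with \<open>--++-+\<close>, which does not exist.
\<close>

definition hexagon :: "nat \<Rightarrow> spot \<Rightarrow> spot \<Rightarrow> spot \<Rightarrow> spot \<Rightarrow> spot \<Rightarrow> spot \<Rightarrow> bool" where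
  "hexagon k w v w' a b c \<longleftrightarrow> distinct [w, v, w', a, b, c] \<and> set [w, v, w', a, b, c] \<subseteq> spots k \<and>
     (w, v) \<in> nbrs k \<and> (v, w') \<in> nbrs k \<and> (w', a) \<in> nbrs k \<and> (a, b) \<in> nbrs k \<and> (b, c) \<in> nbrs k \<and> (c, w) \<in> nbrs k"

lemma hexagon_sym: "hexagon k w v w' a b c \<Longrightarrow> hexagon k w' v w c b a"
  unfolding hexagon_def by (auto intro: nbrs_sym simp del: split_paired_All)

lemma hexagon_straight:
  assumes h: "hexagon k w v w' a b c" and s: "raises k w v" "raises k v w'"
  obtains i j where "i \<noteq> j" "w = dn i v" "v = dn j w'" "a = dn i w'" "c = up i (dn j a)"
proof -
  obtain i where i: "w = dn i v" using s(1) unfolding raises_iff by blast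
  obtain j where j: "v = dn j w'" using s(2) unfolding raises_iff by blast
  obtain \<alpha> p where a: "a = step \<alpha> p w'" using h nbrs_step unfolding hexagon_def by blast
  obtain \<beta> q where b: "b = step \<beta> q a" using h nbrs_step unfolding hexagon_def by blast
  obtain \<gamma> r where c: "c = step \<gamma> r b" using h nbrs_step unfolding hexagon_def by blast
  obtain \<delta> t where w: "w = step \<delta> t c" using h nbrs_step unfolding hexagon_def by blast
  have "w' \<in> spots k" using h unfolding hexagon_def by simp
  note x = spots_unit[OF this]
  have d: "a \<noteq> dn j w'" "b \<noteq> w'" "c \<noteq> a" "w \<noteq> b" using h j unfolding hexagon_def by auto
  have "w = dn i (dn j w')" using i j by simp
  from straight_hexagon[OF x this a b c w d] show thesis using that i j by blast
qed

text \<open>The directions of the two arcs are read off the corner and determine the rest; two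
  descents are treated by reversing the 6-cycle.\<close>

lemma hexagon_straight_unique:
  assumes "hexagon k w v w' a b c" "hexagon k w v w' a' b' c'" "raises k w v \<longleftrightarrow> raises k v w'"
  shows "a = a'"
proof -
  have 1: "a = a' \<and> c = c'"
    if h: "hexagon k w v w' a b c" "hexagon k w v w' a' b' c'" and r: "raises k w v" "raises k v w'" for w w' a b c a' b' c'
  proof -
    obtain i j where 1: "w = dn i v" "v = dn j w'" "a = dn i w'" "c = up i (dn j a)"
      using hexagon_straight[OF h(1) r] by metis
    obtain i' j' where 2: "w = dn i' v" "v = dn j' w'" "a' = dn i' w'" "c' = up i' (dn j' a')"
      using hexagon_straight[OF h(2) r] by metis
    have "i' = i" using 1(1) 2(1) up_index(2) by metis
    moreover have "j' = j" using 1(2) 2(2) up_index(2) by metis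
    ultimately show ?thesis using 1(3,4) 2(3,4) by simp
  qed
  show ?thesis
  proof (cases "raises k w v")
    case True
    then show ?thesis using 1[OF assms(1,2)] assms(3) by blast
  next
    case False
    then have "raises k w' v" "raises k v w" using assms(1,3) unfolding hexagon_def nbrs_iff by blast+
    then show ?thesis using 1[OF hexagon_sym[OF assms(1)] hexagon_sym[OF assms(2)]] by blast
  qed
qed

lemma hexagon_rotate: "hexagon k w v w' a b c \<Longrightarrow> hexagon k v w' a b c w"
  unfolding hexagon_def by auto

text \<open>In unscaled coordinates, from level 0 the 6-cycle sums to
  \<open>e_i + 2 e_j - 2 e_i - e_j + e_i - e_j = 0\<close>.\<close>

lemma zigzag_close: "dn j (dn i (up j (up i u))) = dn i (up j u)"
proof -
  have "2 * snd (up i (dn j (dn i (up j (up i u))))) t = 2 * snd (up j u) t" for t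
  proof -
    have "2 * snd (up i (dn j (dn i (up j (up i u))))) t =
      2 * (2 * snd (up j (up i u)) t - unit_at i t) - unit_at j t + unit_at i t"
      unfolding up_simps(2)[of i "dn j _"] by simp
    also have "\<dots> = 2 * snd (up i u) t + unit_at j t - unit_at i t"
      unfolding up_simps(2)[of j "up i u"] by (simp only: algebra_simps) simp
    also have "\<dots> = 2 * snd (up j u) t" by simp
    finally show ?thesis .
  qed
  \<comment> \<open>For the level factors: \<open>9*2*2*9*9 - 9 = 2907 = 17*171\<close>.\<close>
  moreover have z: "(2907::17) = 0" by simp
  ultimately have "snd (up i (dn j (dn i (up j (up i u))))) t = snd (up j u) t" for t by (metis half(1))
  then have "up i (dn j (dn i (up j (up i u)))) = up j u"
    by (simp add: prod_eq_iff fun_eq_iff z)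
  then show ?thesis by (metis up_dn(2))
qed

lemma zigzag_hexagon:
  assumes u: "u \<in> spots k" and ij: "i < k" "j < k" "i \<noteq> j"
  shows "hexagon k u (up i u) (up j (up i u)) (dn i (up j (up i u))) (dn i (up j u)) (up j u)"
proof -
  \<comment> \<open>Vertices at different levels differ; at equal levels they are reached from a
    common vertex in different directions.\<close>
  have ne: "v \<noteq> w" if "fst v = c * fst u" "fst w = d * fst u" "c \<noteq> d" for v w c d
    using unit_cancel[OF spots_unit[OF u]] that by metis
  let ?p = "dn i (up j (up i u))"
  have q: "dn i (up j u) = dn j ?p" using zigzag_close by simp
  have z: "(68::17) = 0" "(153::17) = 0" by simp_all
  have f: "fst u = 1 * fst u" "fst (up i u) = 9 * fst u" "fst (up j u) = 9 * fst u" "fst (up j (up i u)) = 13 * fst u"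
    "fst ?p = 9 * fst u" "fst (dn i (up j u)) = 1 * fst u"
    by (simp_all add: mult.assoc[symmetric] z)
  have "distinct [u, up i u, up j (up i u), ?p, dn i (up j u), up j u]"
  proof -
    have 1: "u \<noteq> up i u" "u \<noteq> up j (up i u)" "u \<noteq> ?p" "u \<noteq> up j u" "up i u \<noteq> up j (up i u)" "up i u \<noteq> dn i (up j u)"
      "up j (up i u) \<noteq> ?p" "up j (up i u) \<noteq> dn i (up j u)" "up j (up i u) \<noteq> up j u" "?p \<noteq> dn i (up j u)" "dn i (up j u) \<noteq> up j u"
      using ne[OF f(1) f(2)] ne[OF f(1) f(4)] ne[OF f(1) f(5)] ne[OF f(1) f(3)] ne[OF f(2) f(4)] ne[OF f(2) f(6)]
        ne[OF f(4) f(5)] ne[OF f(4) f(6)] ne[OF f(4) f(3)] ne[OF f(5) f(6)] ne[OF f(6) f(3)] by simp_all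
    have "u = dn j (up j u)" by simp
    then have 2: "u \<noteq> dn i (up j u)" using up_index(2) ij(3) by metis
    have "up i u = dn j (up j (up i u))" by simp
    then have 3: "up i u \<noteq> ?p" using up_index(2) ij(3) by metis
    have 4: "up i u \<noteq> up j u" using ij(3) by simp
    have "?p = up j (dn i (up j u))" "up j u = up i (dn i (up j u))" unfolding q by simp (simp flip: q)
    then have 5: "?p \<noteq> up j u" using up_index(1) ij(3) by metis
    show ?thesis using 1 2 3 4 5 by simp
  qed
  moreover have "(up j (up i u), ?p) \<in> nbrs k" "(?p, dn i (up j u)) \<in> nbrs k"
    "(dn i (up j u), up j u) \<in> nbrs k" "(up j u, u) \<in> nbrs k"
    using nbrsI(2)[OF ij(1)] nbrsI(2)[OF ij(2), of ?p, folded q] nbrs_sym[OF nbrsI(2)[OF ij(1), of "up j u"]]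
      nbrs_sym[OF nbrsI(1)[OF ij(2), of u]] by simp_all
  ultimately show ?thesis using u ij nbrsI(1) unfolding hexagon_def by simp
qed

text \<open>At a lowest vertex the two 6-cycles come from exchanging \<open>i\<close> and
  \<open>j\<close>. At a highest vertex they come from the two peaks of the pattern
  \<open>++--+-\<close>, placed at \<open>v\<close> in turn.\<close>

lemma zigzag_hexagons:
  assumes v: "v \<in> spots k" and n: "(v, w) \<in> nbrs k" "(v, w') \<in> nbrs k" "w \<noteq> w'" and z: "raises k v w \<longleftrightarrow> raises k v w'"
  obtains a b c a' b' c' where "hexagon k w v w' a b c" "hexagon k w v w' a' b' c'" "a \<noteq> a'"
proof -
  have w': "w' \<in> spots k" using spots_nbr[OF v n(2)] .
  have ne: "dn i w' \<noteq> up i w'" for i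
  proof
    assume "dn i w' = up i w'"
    then have "2 * fst w' = 9 * fst w'" by (metis up_simps(1) dn_simps(1))
    then have "2 = (9::17)" by (rule unit_cancel[OF spots_unit[OF w']])
    then show False by simp
  qed
  show thesis
  proof (cases "raises k v w")
    case True
    then obtain i j where ij: "i < k" "j < k" "w = up i v" "w' = up j v" using z unfolding raises_def by blast
    then have d: "i \<noteq> j" "j \<noteq> i" using n(3) by auto
    note h = zigzag_hexagon[OF v ij(1,2) d(1), folded ij(3,4)]
    note h' = zigzag_hexagon[OF v ij(2,1) d(2), folded ij(3,4)]
    have "hexagon k w v w' (dn i w') (dn i (up j w)) (up j w)"
      using hexagon_sym hexagon_rotate[OF hexagon_rotate[OF hexagon_rotate[OF hexagon_rotate[OF hexagon_rotate[OF h]]]]] by blast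
    moreover have "hexagon k w v w' (up i w') (dn j (up i w')) (dn j w)"
      using hexagon_rotate[OF hexagon_rotate[OF hexagon_rotate[OF hexagon_rotate[OF hexagon_rotate[OF h']]]]] .
    ultimately show thesis using that ne by blast
  next
    case False
    then have "raises k w v" "raises k w' v" using n z unfolding nbrs_iff by blast+
    then obtain i j where ij: "i < k" "j < k" "w = dn i v" "w' = dn j v" unfolding raises_iff by blast
    then have d: "i \<noteq> j" "j \<noteq> i" using n(3) by auto
    let ?u = "dn j w"
    have s: "?u \<in> spots k" using spots_dn[OF spots_dn[OF v ij(1)] ij(2)] ij(3) by simp
    have e: "up j ?u = w" "up i w = v" "up j w' = v" using ij by simp_all
    have "hexagon k ?u w v w' (dn j (up i ?u)) (up i ?u)"
      using zigzag_hexagon[OF s ij(2,1) d(2)] unfolding e ij(4)[symmetric] .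
    then have "hexagon k w v w' (dn j (up i ?u)) (up i ?u) ?u" by (rule hexagon_rotate)
    moreover have "dn j (up i ?u) = dn i w'" using zigzag_close[of i j ?u] unfolding e ij(4)[symmetric] by simp
    moreover have "hexagon k w' (up i w') (up j (up i w')) (dn i (up j (up i w'))) w v"
      using zigzag_hexagon[OF w' ij(1,2) d(1)] unfolding e ij(3)[symmetric] .
    then have "hexagon k w v w' (up i w') (up j (up i w')) (dn i (up j (up i w')))"
      by (rule hexagon_rotate[OF hexagon_rotate[OF hexagon_rotate[OF hexagon_rotate]]])
    ultimately show thesis using that ne by metis
  qed
qed

lemma bouwer_autD:
  assumes g: "g \<in> graph_aut (bouwer k)"
  shows "g v \<in> spots k \<longleftrightarrow> v \<in> spots k" "inj g" "u \<in> spots k \<Longrightarrow> (g u, g v) \<in> nbrs k \<longleftrightarrow> (u, v) \<in> nbrs k"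
proof -
  show s: "g v \<in> spots k \<longleftrightarrow> v \<in> spots k" for v using graph_autD(1)[OF g, of v] by simp
  show "inj g" by (rule graph_autD(2)[OF g])
  show "(g u, g v) \<in> nbrs k \<longleftrightarrow> (u, v) \<in> nbrs k" if "u \<in> spots k"
    using graph_aut_arc_iff[OF bouwer_graph g, of u v] that s by simp
qed

lemma hexagon_aut:
  assumes g: "g \<in> graph_aut (bouwer k)" and h: "hexagon k w v w' a b c"
  shows "hexagon k (g w) (g v) (g w') (g a) (g b) (g c)"
proof -
  have "distinct [g w, g v, g w', g a, g b, g c]"
    using h unfolding hexagon_def by (simp add: inj_eq[OF bouwer_autD(2)[OF g]])
  then show ?thesis using h bouwer_autD(1,3)[OF g] unfolding hexagon_def by simp
qed

lemma raises_flip: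
  assumes "u \<in> spots k" "(u, v) \<in> nbrs k"
  shows "raises k v u \<longleftrightarrow> \<not> raises k u v"
  using assms raises_level(2)[OF assms(1)] unfolding nbrs_iff by blast

text \<open>Two 6-cycles with different continuations cannot be mapped to a straight corner, where
  the continuation is unique.\<close>

lemma zigzag_imp:
  assumes g: "g \<in> graph_aut (bouwer k)" and v: "v \<in> spots k" and n: "(v, w) \<in> nbrs k" "(v, w') \<in> nbrs k" "w \<noteq> w'"
    and z: "raises k v w \<longleftrightarrow> raises k v w'"
  shows "raises k (g v) (g w) \<longleftrightarrow> raises k (g v) (g w')"
proof (rule ccontr)
  assume r: "\<not> ?thesis"
  obtain a b c a' b' c' where h: "hexagon k w v w' a b c" "hexagon k w v w' a' b' c'" "a \<noteq> a'"
    using zigzag_hexagons[OF v n z] .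
  have "raises k (g w) (g v) \<longleftrightarrow> raises k (g v) (g w')"
    using raises_flip[of "g v" k "g w"] bouwer_autD(1)[OF g] bouwer_autD(3)[OF g v] v n r by blast
  then have "g a = g a'"
    using hexagon_straight_unique[OF hexagon_aut[OF g h(1)] hexagon_aut[OF g h(2)]] by blast
  then show False using h(3) bouwer_autD(2)[OF g] by (simp add: inj_eq)
qed

lemma zigzag_iff:
  assumes g: "g \<in> graph_aut (bouwer k)" and v: "v \<in> spots k" and n: "(v, w) \<in> nbrs k" "(v, w') \<in> nbrs k" "w \<noteq> w'"
  shows "(raises k (g v) (g w) \<longleftrightarrow> raises k (g v) (g w')) \<longleftrightarrow> (raises k v w \<longleftrightarrow> raises k v w')"
proof
  assume z: "raises k (g v) (g w) \<longleftrightarrow> raises k (g v) (g w')"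
  have i: "inv g (g x) = x" for x using bouwer_autD(2)[OF g] by simp
  show "raises k v w \<longleftrightarrow> raises k v w'"
    using zigzag_imp[OF graph_aut_inv[OF g], of "g v" "g w" "g w'"] z n v bouwer_autD(1)[OF g] bouwer_autD(3)[OF g v]
    unfolding i inj_eq[OF bouwer_autD(2)[OF g]] by blast
qed (rule zigzag_imp[OF g v n])

lemma raises_aut:
  assumes k: "k \<ge> 2" and g: "g \<in> graph_aut (bouwer k)" and u: "u \<in> spots k" and i: "i < k"
  shows "raises k (g u) (g (up i u))"
proof (rule ccontr)
  \<comment> \<open>A second direction, available because \<open>k \<ge> 2\<close>.\<close>
  define j where "j = (if i = 0 then 1 else 0 :: nat)"
  have j: "j < k" "i \<noteq> j" using k by (auto simp: j_def)
  define p1 where "p1 = up i u"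
  define p2 where "p2 = up j p1"
  define p3 where "p3 = dn i p2"
  define p4 where "p4 = dn i (up j u)"
  define p5 where "p5 = up j u"
  have h: "hexagon k u p1 p2 p3 p4 p5"
    using zigzag_hexagon[OF u i j] unfolding p1_def p2_def p3_def p4_def p5_def .
  have s: "p1 \<in> spots k" "p2 \<in> spots k" "p3 \<in> spots k" "p4 \<in> spots k" "p5 \<in> spots k" using h unfolding hexagon_def by simp_all
  have n: "(u, p1) \<in> nbrs k" "(p1, p2) \<in> nbrs k" "(p2, p3) \<in> nbrs k" "(p3, p4) \<in> nbrs k" "(p4, p5) \<in> nbrs k" "(p5, u) \<in> nbrs k"
    using h unfolding hexagon_def by blast+
  note n' = n[THEN nbrs_sym]
  have d: "u \<noteq> p2" "p1 \<noteq> p3" "p2 \<noteq> p4" "p3 \<noteq> p5" "p4 \<noteq> u" using h unfolding hexagon_def by auto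
  have p4: "p4 = dn j p3" unfolding p4_def p3_def p2_def p1_def by (rule zigzag_close[symmetric])
  have r: "raises k u p1" "raises k p1 p2" "raises k u p5" "raises k p3 p2" "raises k p4 p3"
    using i j(1) unfolding raises_iff[of k p3] raises_iff[of k p4] unfolding raises_def p1_def p2_def p3_def p4 p5_def by blast+
  moreover have "raises k p4 p5" using i unfolding raises_iff p4_def p5_def by blast
  ultimately have r: "raises k u p1" "raises k p1 p2" "raises k p3 p2" "raises k p4 p3" "raises k p4 p5" "raises k u p5" by blast+
  then have nr: "\<not> raises k p1 u" "\<not> raises k p2 p1" "\<not> raises k p2 p3" "\<not> raises k p3 p4" "\<not> raises k p5 p4" "\<not> raises k p5 u"
    using raises_level(2) s u by blast+
  have flip: "raises k (g y) (g x) \<longleftrightarrow> \<not> raises k (g x) (g y)" if "x \<in> spots k" "(x, y) \<in> nbrs k" for x y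
    using raises_flip[of "g x" k "g y"] bouwer_autD(1)[OF g] bouwer_autD(3)[OF g] that by blast
  assume "\<not> raises k (g u) (g (up i u))"
  \<comment> \<open>One reversed arc forces the next: \<open>g\<close> keeps every corner of the
    6-cycle straight or zigzag, so the reversal spreads all the way round.\<close>
  then have 0: "raises k (g p1) (g u)" using flip[OF u n(1)] unfolding p1_def by blast
  then have "\<not> raises k (g p1) (g p2)" using zigzag_iff[OF g s(1) n'(1) n(2) d(1)] r(2) nr(1) by blast
  then have 1: "raises k (g p2) (g p1)" using flip[OF s(1) n(2)] by blast
  then have 2: "raises k (g p2) (g p3)" using zigzag_iff[OF g s(2) n'(2) n(3) d(2)] nr(2,3) by blast
  then have "\<not> raises k (g p3) (g p2)" using flip[OF s(2) n(3)] by blast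
  then have 3: "raises k (g p3) (g p4)" using zigzag_iff[OF g s(3) n'(3) n(4) d(3)] r(3) nr(4) by blast
  then have "\<not> raises k (g p4) (g p3)" using flip[OF s(3) n(4)] by blast
  then have "\<not> raises k (g p4) (g p5)" using zigzag_iff[OF g s(4) n'(4) n(5) d(4)] r(4,5) by blast
  then have 4: "raises k (g p5) (g p4)" using flip[OF s(4) n(5)] by blast
  then have 5: "raises k (g p5) (g u)" using zigzag_iff[OF g s(5) n'(5) n(6) d(5)] nr(5,6) by blast
  obtain m0 where m0: "g p1 = dn m0 (g u)" using 0 unfolding raises_iff by blast
  obtain m1 where m1: "g p2 = dn m1 (g p1)" using 1 unfolding raises_iff by blast
  obtain m2 where m2: "g p3 = up m2 (g p2)" using 2 unfolding raises_def by blast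
  obtain m3 where m3: "g p4 = up m3 (g p3)" using 3 unfolding raises_def by blast
  obtain m4 where m4: "g p5 = dn m4 (g p4)" using 4 unfolding raises_iff by blast
  obtain m5 where m5: "g u = up m5 (g p5)" using 5 unfolding raises_def by blast
  have "g p1 \<noteq> g p3" using d(2) bouwer_autD(2)[OF g] by (simp add: inj_eq)
  from no_reversed_walk[OF m0 m1 m2 m3 m4 m5 this] show False .
qed

section \<open>The arc-type of Bouwer graphs and their use in lamplighters\<close>

lemma bouwer_type:
  assumes k: "k \<ge> 2" shows "arc_type (bouwer k) = ({#}, {#k#})"
proof -
  note V = bouwer_vtg[of k]
  have vt: "vtg (bouwer k)" using V k by simp
  define D where "D = {(u, v). u \<in> spots k \<and> raises k u v}"
  have D: "(u, v) \<in> D \<longleftrightarrow> u \<in> spots k \<and> raises k u v" for u v by (simp add: D_def)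
  have k0: "0 < k" using k by simp
  have home: "(home, up 0 home) \<in> D" unfolding D raises_def using home_spot k0 by blast
  have orb: "D \<in> arc_orbits (bouwer k)"
  proof (rule arc_orbitsI)
    show "D \<subseteq> parcs (bouwer k)" by (rule subrelI) (simp add: D nbrs_iff)
    show "D \<noteq> {}" using home by blast
    show "map_prod g g e \<in> D" if g: "g \<in> graph_aut (bouwer k)" and e: "e \<in> D" for g e
    proof -
      obtain u v where uv: "e = (u, v)" "u \<in> spots k" "raises k u v" using e D by (metis surj_pair)
      then obtain i where "i < k" "v = up i u" unfolding raises_def by blast
      then have "(g u, g v) \<in> D" unfolding D using raises_aut[OF k g uv(2)] bouwer_autD(1)[OF g] uv(2) by blast
      then show ?thesis using uv(1) by simp
    qed
    show "\<exists>g \<in> graph_aut (bouwer k). map_prod g g e = e'" if e: "e \<in> D" "e' \<in> D" for e e'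
    proof -
      obtain u v where uv: "e = (u, v)" "u \<in> spots k" "raises k u v" using e(1) D by (metis surj_pair)
      obtain i where i: "i < k" "v = up i u" using uv(3) unfolding raises_def by blast
      obtain u' v' where uv': "e' = (u', v')" "u' \<in> spots k" "raises k u' v'" using e(2) D by (metis surj_pair)
      obtain j where j: "j < k" "v' = up j u'" using uv'(3) unfolding raises_def by blast
      obtain g where "g \<in> graph_aut (bouwer k)" "g u = u'" "g (up i u) = up j u'"
        using bouwer_aut[OF uv(2) uv'(2) i(1) j(1)] by blast
      then show ?thesis using uv(1) uv'(1) i(2) j(2) by auto
    qed
  qed
  have "{w. (home, w) \<in> D} = (\<lambda>i. up i home) ` {..<k}"
    using home_spot unfolding D raises_def by blast
  then have val: "orbit_valency (bouwer k) D = k"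
    unfolding orbit_valency_card[OF vt orb, of home, unfolded bouwer_simps, OF home_spot]
    by (simp add: card_image inj_on_def)
  have ne: "D\<inverse> \<noteq> D"
  proof
    assume "D\<inverse> = D"
    then have "(up 0 home, home) \<in> D" using home by blast
    then show False using home raises_level(2) unfolding D by blast
  qed
  have orbs: "arc_orbits (bouwer k) = {D, D\<inverse>}"
  proof (rule arc_orbits_eqI[OF _ _ bouwer_graph])
    show "{D, D\<inverse>} \<subseteq> arc_orbits (bouwer k)" using orb arc_orbits_converse[OF bouwer_graph orb] by simp
    show "parcs (bouwer k) \<subseteq> \<Union> {D, D\<inverse>}"
    proof (rule subrelI)
      fix u v assume "(u, v) \<in> parcs (bouwer k)"
      then have uv: "u \<in> spots k" "(u, v) \<in> nbrs k" by simp_all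
      then have "(u, v) \<in> D \<or> (v, u) \<in> D" using spots_nbr[OF uv] unfolding D nbrs_iff by blast
      then show "(u, v) \<in> \<Union> {D, D\<inverse>}" by auto
    qed
  qed
  have "orbit_valency (bouwer k) (D\<inverse>) = orbit_valency (bouwer k) D"
    by (rule orbit_valency_converse[OF vtgD(1,2)[OF vt] orb])
  from family_type_pair[OF ne this] show ?thesis unfolding arc_type_family orbs val .
qed

text \<open>The 6-cycle through a straight corner needs two different directions, so repeating a
  direction leaves none.\<close>

lemma bouwer_line:
  assumes v: "v \<in> spots k" and i: "i < k"
  shows "\<not> in_square (bouwer k) (dn i v) v (up i v)" "\<not> hexagon k (dn i v) v (up i v) a b c"
proof -
  show "\<not> in_square (bouwer k) (dn i v) v (up i v)"
  proof
    assume "in_square (bouwer k) (dn i v) v (up i v)"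
    then obtain x where x: "x \<noteq> v" "(dn i v, x) \<in> nbrs k" "(x, up i v) \<in> nbrs k"
      unfolding in_square_def by auto
    obtain \<alpha> p where p: "x = step \<alpha> p (up i v)" using nbrs_step[OF nbrs_sym[OF x(3)]] by blast
    obtain \<beta> q where q: "dn i v = step \<beta> q x" using nbrs_step[OF nbrs_sym[OF x(2)]] by blast
    have e: "dn i v = dn i (dn i (up i v))" by simp
    show False
      by (rule straight_square[OF spots_unit[OF spots_up[OF v i]] e p q]) (use x(1) in simp)
  qed
  show "\<not> hexagon k (dn i v) v (up i v) a b c"
  proof
    assume h: "hexagon k (dn i v) v (up i v) a b c"
    have "raises k (dn i v) v" "raises k v (up i v)" using i unfolding raises_iff by auto
    from hexagon_straight[OF h this] obtain i' j' where 1: "i' \<noteq> j'" "dn i v = dn i' v" "v = dn j' (up i v)" by metis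
    have "up j' v = up i v" using arg_cong[OF 1(3), of "up j'"] by simp
    then show False using 1(1,2) by simp
  qed
qed

lemma good_corner_hexagon:
  assumes "good_corner (bouwer k) w v w'"
  obtains a b c where "hexagon k w v w' a b c"
proof -
  obtain a b c where "distinct [w, v, w', a, b, c]" "(w, v) \<in> parcs (bouwer k)" "(v, w') \<in> parcs (bouwer k)"
    "(w', a) \<in> parcs (bouwer k)" "(a, b) \<in> parcs (bouwer k)" "(b, c) \<in> parcs (bouwer k)" "(c, w) \<in> parcs (bouwer k)"
    using assms unfolding good_corner_def insert_subset by blast
  then have "hexagon k w v w' a b c" unfolding hexagon_def by simp
  then show thesis by (rule that)
qed

text \<open>Continuing straight on in the same direction serves both \<open>unsquared\<close> and
  the lamplighter.\<close>

lemma bouwer_partner: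
  assumes "(v, w) \<in> parcs (bouwer k)"
  obtains w' where "(v, w') \<in> parcs (bouwer k)" "w' \<noteq> w" "\<not> in_square (bouwer k) w v w'" "\<not> good_corner (bouwer k) w v w'"
proof -
  have v: "v \<in> spots k" and n: "(v, w) \<in> nbrs k" using assms by simp_all
  obtain i where i: "i < k" "w = up i v \<or> w = dn i v" using n unfolding nbrs_def by blast
  have ne: "up i v \<noteq> dn i v"
  proof
    assume "up i v = dn i v"
    then have "9 * fst v = 2 * fst v" by (metis up_simps(1) dn_simps(1))
    then have "9 = (2::17)" by (rule unit_cancel[OF spots_unit[OF v]])
    then show False by simp
  qed
  note L = bouwer_line[OF v i(1)]
  from i(2) show thesis
  proof
    assume w: "w = dn i v"
    have "\<not> good_corner (bouwer k) w v (up i v)" using L(2) good_corner_hexagon unfolding w by metis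
    then show thesis using that[of "up i v"] L(1) ne v nbrsI(1)[OF i(1)] w by simp
  next
    assume w: "w = up i v"
    have "\<not> good_corner (bouwer k) w v (dn i v)" using L(2) good_corner_hexagon hexagon_sym unfolding w by metis
    moreover have "\<not> in_square (bouwer k) w v (dn i v)"
    proof
      assume "in_square (bouwer k) w v (dn i v)"
      then obtain x where "x \<noteq> v" "(w, x) \<in> parcs (bouwer k)" "(x, dn i v) \<in> parcs (bouwer k)" unfolding in_square_def by blast
      then have "x \<noteq> v" "(dn i v, x) \<in> parcs (bouwer k)" "(x, w) \<in> parcs (bouwer k)"
        using pair_graphD(5)[OF bouwer_graph] by blast+
      then show False using L(1) unfolding w in_square_def by blast
    qed
    ultimately show thesis using that[of "dn i v"] ne v nbrsI(2)[OF i(1)] w by simp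
  qed
qed

lemma realized_pair_multiple:
  assumes "k \<ge> 2" shows "realized ({#}, {#k#})"
proof -
  have "unsquared (bouwer k)"
    unfolding unsquared_def
  proof (intro ballI, clarify)
    fix v w assume "(v, w) \<in> parcs (bouwer k)"
    from bouwer_partner[OF this]
    show "\<exists>w'. (v, w') \<in> parcs (bouwer k) \<and> w' \<noteq> w \<and> \<not> in_square (bouwer k) w v w'" by metis
  qed
  then show ?thesis
    using realizedI[OF bouwer_vtg bouwer_bipartition, of k] assms bouwer_type[OF assms] by simp
qed

lemma realized_add_pair_multiple:
  assumes k: "k \<ge> 2" and P: "realized P" shows "realized (P + ({#}, {#k#}))"
proof -
  obtain X :: "nat pair_pre_digraph" and p where X: "vtg X" "bipartition X p" "unsquared X \<or> squared X" "arc_type X = P"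
    using P unfolding realized_def by blast
  have vt: "vtg (bouwer k)" using bouwer_vtg[of k] k by simp
  have "\<exists>y2. (y, y2) \<in> parcs (bouwer k) \<and> y2 \<noteq> y1 \<and> \<not> good_corner (bouwer k) y1 y y2" if "(y, y1) \<in> parcs (bouwer k)" for y y1
    using bouwer_partner[OF that] by metis
  from realized_lamplighter[OF X(1,2) vt bouwer_bipartition X(3) this] show ?thesis
    unfolding X(4) bouwer_type[OF k] .
qed

section \<open>All marked partitions\<close>

lemma realized_add:
  assumes "realized P" "\<forall>n \<in># A. n > 0" "\<forall>m \<in># B. m > 0"
  shows "realized (P + (A, B))"
  using assms(2)
proof (induction A)
  case empty
  show ?case using assms(3)
  proof (induction B)
    case empty
    have "P + ({#}, {#}) = P" by (cases P) simp
    then show ?case using assms(1) by simp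
  next
    case (add m B)
    have e: "P + ({#}, add_mset m B) = P + ({#}, B) + ({#}, {#m#})" by (cases P) simp
    have "realized (P + ({#}, B))" using add by simp
    moreover have "m = 1 \<or> m \<ge> 2" using add.prems by auto
    ultimately show ?case unfolding e using realized_add_pair realized_add_pair_multiple by blast
  qed
next
  case (add n A)
  have e: "P + (add_mset n A, B) = P + (A, B) + ({#n#}, {#})" by (cases P) simp
  have "realized (P + (A, B))" using add by simp
  moreover have "n = 1 \<or> n \<ge> 2" using add.prems by auto
  ultimately show ?case unfolding e using realized_add_one realized_add_multiple by blast
qed

lemma vtg_connected:
  fixes X :: "'a pair_pre_digraph"
  assumes X: "vtg X" shows "connected (with_proj X)"
proof -
  note D = vtgD[OF X]
  have "parcs (mk_symmetric (with_proj X)) = parcs X"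
    using D(10) unfolding mk_symmetric_def by auto
  then have e: "mk_symmetric (with_proj X) = X"
    by (cases X) (simp add: mk_symmetric_def)
  have "u \<rightarrow>\<^sup>*\<^bsub>with_proj X\<^esub> v" if u: "u \<in> pverts X" and v: "v \<in> pverts X" for u v
    using D(5)[OF u v]
  proof (induction rule: rtrancl_induct)
    case base
    then show ?case using u unfolding reachable_def by simp
  next
    case (step w z)
    have "z \<in> pverts X" using D(9) step.hyps(2) .
    moreover have "(w, z) \<in> arcs_ends (with_proj X)"
      using step.hyps(2) by (simp add: arcs_ends_def arc_to_ends_def)
    ultimately show ?case
      using step.IH rtrancl_on_into_rtrancl_on unfolding reachable_def with_proj_simps by metis
  qed
  then show ?thesis unfolding connected_def e strongly_connected_def using D(4) by simp
qed

text \<open>A summand of at least 2 supplies the starting graph. If all summands are 1, anything but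
  the four exceptions contains (1+1)+(1+1), 1+(1+1) or 1+1+1, and the rest is adjoined by
  \<open>realized_add\<close>.\<close>

lemma realized_or_K2:
  assumes pos: "\<forall>n \<in># N. n > 0" "\<forall>m \<in># M. m > 0"
    and ex: "(N, M) \<noteq> ({#}, {#})" "(N, M) \<noteq> ({#1, 1#}, {#})" "(N, M) \<noteq> ({#}, {#1#})" "(N, M) \<noteq> ({#1#}, {#})"
  shows "realized (N, M)"
proof -
  have ext: "realized (N, M)" if "realized (A, B)" "N = A + A'" "M = B + B'" for A A' B B'
    using realized_add[OF that(1), of A' B'] pos that(2,3) by simp
  show ?thesis
  proof (cases "\<exists>n \<in># N. n \<ge> 2")
    case True
    then obtain n where "n \<in># N" "n \<ge> 2" by blast
    then show ?thesis using ext[of "{#n#}" "{#}" "N - {#n#}" M] realized_multiple by simp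
  next
    case ones: False
    show ?thesis
    proof (cases "\<exists>m \<in># M. m \<ge> 2")
      case True
      then obtain m where "m \<in># M" "m \<ge> 2" by blast
      then show ?thesis using ext[of "{#}" "{#m#}" N "M - {#m#}"] realized_pair_multiple by simp
    next
      case False
      have one: "A = replicate_mset (size A) 1" if "\<forall>n \<in># A. n > 0" "\<not> (\<exists>n \<in># A. n \<ge> 2)" for A :: "nat multiset"
      proof (rule set_mset_subset_singletonD)
        show "set_mset A \<subseteq> {1}" using that by (auto simp: not_le less_2_cases_iff)
      qed
      note N = one[OF pos(1) ones] and M = one[OF pos(2) False]
      have n: "n = 0 \<or> n = 1 \<or> n = 2 \<or> (\<exists>s. n = Suc (Suc (Suc s)))" for n :: nat by presburger
      have m: "m = 0 \<or> m = 1 \<or> (\<exists>s. m = Suc (Suc s))" for m :: nat by presburger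
      have "(\<exists>s. size M = Suc (Suc s)) \<or> size M = 1 \<and> (\<exists>s. size N = Suc s) \<or> size M = 1 \<and> size N = 0 \<or>
          size M = 0 \<and> (\<exists>s. size N = Suc (Suc (Suc s))) \<or> size M = 0 \<and> (size N = 0 \<or> size N = 1 \<or> size N = 2)"
        using n[of "size N"] m[of "size M"] not0_implies_Suc[of "size N"] by metis
      then show ?thesis
      proof (elim disjE exE conjE)
        fix s assume s: "size M = Suc (Suc s)"
        show ?thesis using ext[OF realized_two_pairs, of N "replicate_mset s 1"] M[unfolded s] by simp
      next
        fix s assume s: "size M = 1" "size N = Suc s"
        show ?thesis using ext[OF realized_one_pair, of "replicate_mset s 1" "{#}"] M[unfolded s] N[unfolded s] by simp
      next
        fix s assume s: "size M = 0" "size N = Suc (Suc (Suc s))"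
        show ?thesis using ext[OF realized_three_ones, of "replicate_mset s 1" "{#}"] M[unfolded s] N[unfolded s] by simp
      next
        assume s: "size M = 1" "size N = 0"
        show ?thesis using ex(3) M[unfolded s] N[unfolded s] by simp
      next
        assume s: "size M = 0" "size N = 0"
        show ?thesis using ex(1) M[unfolded s] N[unfolded s] by simp
      next
        assume s: "size M = 0" "size N = 1"
        show ?thesis using ex(4) M[unfolded s] N[unfolded s] by simp
      next
        assume s: "size M = 0" "size N = 2"
        show ?thesis using ex(2) M[unfolded s] N[unfolded s] by (simp add: numeral_2_eq_2)
      qed
    qed
  qed
qed

theorem theorem29:
  fixes d :: nat and P :: marked_partition
  assumes "d > 0"
    and "marked_partition_of d P"
    and "P \<noteq> ({#1, 1#}, {#})"
    and "P \<noteq> ({#}, {#1#})"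
  shows "\<exists>X :: nat pair_pre_digraph.
           nontrivial_graph X \<and> connected (with_proj X) \<and> vertex_transitive X \<and> arc_type X = P"
proof -
  obtain N M where P: "P = (N, M)" by fastforce
  have "\<exists>X :: nat pair_pre_digraph. vtg X \<and> arc_type X = P"
  \<comment> \<open>The single edge has valency 1 and lies outside \<open>realized\<close>.\<close>
  proof (cases "P = ({#1#}, {#})")
    case True
    then show ?thesis using transport[OF K2_vtg] K2_type by metis
  next
    case False
    have "P \<noteq> ({#}, {#})" using assms(1,2) by (auto simp: marked_partition_of_def)
    then have "realized P"
      using realized_or_K2[of N M] assms(2-4) False unfolding P by (simp add: marked_partition_of_def)
    then show ?thesis unfolding realized_def by blast
  qed
  then obtain X :: "nat pair_pre_digraph" where X: "vtg X" "arc_type X = P" by blast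
  then show ?thesis
    using vtg_connected[OF X(1)] vtgD(1,2,3)[OF X(1)] unfolding nontrivial_graph_def by blast
qed

end
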